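(* Let $I:\mathbb{R}\to\mathbb{R}$ be $C^\infty$, $\lambda>0$ and $\eta>0$, and consider the flow on $\mathbb{R}^4$, with variables $(\omega,\Omega,\alpha,\theta)$, of $$\epsilon\dot\omega=-\sin(\Omega+\omega)\bigl(I(\theta)-\alpha\cos(\Omega+\omega)\bigr),\quad \dot\Omega=\lambda\omega,\quad \dot\alpha=\eta\cos(\Omega+\omega)\bigl(I(\theta)-\alpha\cos(\Omega+\omega)\bigr),\quad \dot\theta=1 .$$ For $\epsilon$ sufficiently small, there exist infinitely many slow invariant manifolds for this flow. They consist of simply connected, compact subsets of $\mathbb{R}^4$ with one of the following three forms: - $M^-_{\pi,\epsilon}$: $\ \omega=(k\pi-\Omega)\left(1+\frac{\epsilon\lambda}{(-1)^kI(\theta)-\alpha}\right)+O(\epsilon^2)$, with $\alpha<(-1)^kI(\theta)$, $k\in\mathbb{Z}$; - $M^+_{\pi,\epsilon}$: $\ \omega=(k\pi-\Omega)\left(1+\frac{\epsilon\lambda}{(-1)^kI(\theta)-\alpha}\right)+O(\epsilon^2)$, with $\alpha>(-1)^kI(\theta)$, $k\in\mathbb{Z}$; - $M_{F,\epsilon}$: $\ \alpha\cos(\Omega+\omega)=I(\theta)+O(\epsilon)$, with $\sin(\Omega+\omega)\neq0$, $\alpha\neq0$. Manifolds of the type $M^-_{\pi,\epsilon}$ are locally attracting, those of the type $M^+_{\pi,\epsilon}$ are locally repelling, and those of the form $M_{F,\epsilon}$ are locally attracting if $\alpha>0$ and repelling otherwise.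
   Context: Here $0<\epsilon\ll1$ is the singular perturbation parameter, dots denote $d/dt$, $\omega$ is the fast variable and $\Omega,\alpha,\theta$ are the slow variables. The terms are those of geometric singular perturbation theory (Fenichel). For $\epsilon=0$ the critical manifolds are sets of zeros of the right-hand side of the $\omega$ equation, i.e. of fixed points of the fast system obtained with the time $\tau=t/\epsilon$. A slow manifold is a manifold $O(\epsilon)$ close to such a critical manifold. Invariance is understood locally: solutions can leave the manifold only through its boundary. Attracting/repelling refers to the direction transverse to the manifold (the $\omega$ direction). *)

theory Defs
  imports "HOL-Analysis.Analysis"
begin

text \<open>
  The phase space is \<open>\<real> \<times> \<real> \<times> \<real> \<times> \<real>\<close> (with its Euclidean structure), a point being
  \<open>(\<omega>, \<Omega>, \<alpha>, \<theta>)\<close>; thus \<open>fst\<close> is the fast variable and \<open>snd\<close> the triple of slow variables.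
\<close>

type_synonym slow = "real \<times> real \<times> real"
type_synonym state = "real \<times> slow"

definition smooth :: "(real \<Rightarrow> real) \<Rightarrow> bool" where
  "smooth f \<longleftrightarrow> (\<forall>n x. (deriv ^^ n) f differentiable (at x))"

fun fast_rhs :: "(real \<Rightarrow> real) \<Rightarrow> state \<Rightarrow> real" where
  "fast_rhs I (\<omega>, \<Omega>, \<alpha>, \<theta>) = - sin (\<Omega> + \<omega>) * (I \<theta> - \<alpha> * cos (\<Omega> + \<omega>))"

fun slow_rhs :: "(real \<Rightarrow> real) \<Rightarrow> real \<Rightarrow> real \<Rightarrow> state \<Rightarrow> slow" where
  "slow_rhs I lam eta (\<omega>, \<Omega>, \<alpha>, \<theta>) =
     (lam * \<omega>, eta * cos (\<Omega> + \<omega>) * (I \<theta> - \<alpha> * cos (\<Omega> + \<omega>)), 1)"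

definition solution ::
  "(real \<Rightarrow> real) \<Rightarrow> real \<Rightarrow> real \<Rightarrow> real \<Rightarrow> (real \<Rightarrow> state) \<Rightarrow> real set \<Rightarrow> bool" where
  "solution I lam eta eps z S \<longleftrightarrow>
     (\<forall>t\<in>S. (z has_vector_derivative (fast_rhs I (z t) / eps, slow_rhs I lam eta (z t)))
              (at t within S))"

text \<open>\<open>C1_with_gradient g G K\<close>: \<open>g\<close> is \<open>C\<^sup>1\<close> with gradient \<open>G\<close> on an open neighbourhood of \<open>K\<close>.\<close>

definition C1_with_gradient :: "(slow \<Rightarrow> real) \<Rightarrow> (slow \<Rightarrow> slow) \<Rightarrow> slow set \<Rightarrow> bool" where
  "C1_with_gradient g G K \<longleftrightarrow>
     (\<exists>U. open U \<and> K \<subseteq> U \<and> (\<forall>x\<in>U. GDERIV g x :> G x) \<and> continuous_on U G)"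

text \<open>
  Nonempty, compact, simply connected, full-dimensional \<open>C\<^sup>1\<close> submanifolds with boundary of the
  space of slow variables: near each boundary point the set is a sublevel set of a \<open>C\<^sup>1\<close> function
  without critical points.
\<close>

definition compact_domain :: "slow set \<Rightarrow> bool" where
  "compact_domain K \<longleftrightarrow> K \<noteq> {} \<and> compact K \<and> simply_connected K \<and>
     (\<forall>p\<in>frontier K. \<exists>U g G. open U \<and> p \<in> U \<and> C1_with_gradient g G U \<and>
        (\<forall>x\<in>U. G x \<noteq> 0) \<and> K \<inter> U = {x\<in>U. g x \<le> 0})"

definition graph_over :: "slow set \<Rightarrow> (slow \<Rightarrow> real) \<Rightarrow> state set" where
  "graph_over K h = (\<lambda>x. (h x, x)) ` K"

text \<open>
  Normal hyperbolicity of a set of fixed points of the fast system: its linearisation, which is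
  the scalar \<open>\<partial>(fast_rhs)/\<partial>\<omega>\<close>, does not vanish.
\<close>

definition normally_hyperbolic_zero :: "(real \<Rightarrow> real) \<Rightarrow> state \<Rightarrow> bool" where
  "normally_hyperbolic_zero I p \<longleftrightarrow>
     fast_rhs I p = 0 \<and> deriv (\<lambda>w. fast_rhs I (w, snd p)) (fst p) \<noteq> 0"

definition critical_manifold :: "(real \<Rightarrow> real) \<Rightarrow> state set \<Rightarrow> bool" where
  "critical_manifold I M0 \<longleftrightarrow>
     (\<exists>K h0 G0. compact_domain K \<and> C1_with_gradient h0 G0 K \<and> M0 = graph_over K h0) \<and>
     (\<forall>p\<in>M0. normally_hyperbolic_zero I p)"

text \<open>The boundary, as a manifold, of a graph over a domain in the slow variables.\<close>

definition graph_boundary :: "state set \<Rightarrow> state set" where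
  "graph_boundary M = {p\<in>M. snd p \<in> frontier (snd ` M)}"

text \<open>
  Local invariance: forward and backward in time, a solution stays in \<open>M\<close> unless and until it
  reaches the boundary of \<open>M\<close>.
\<close>

definition locally_invariant ::
  "(real \<Rightarrow> real) \<Rightarrow> real \<Rightarrow> real \<Rightarrow> real \<Rightarrow> state set \<Rightarrow> bool" where
  "locally_invariant I lam eta eps M \<longleftrightarrow>
     (\<forall>z a b. a \<le> b \<and> solution I lam eta eps z {a..b} \<longrightarrow>
        (z a \<in> M \<longrightarrow> (\<forall>t\<in>{a..b}. z t \<in> M) \<or>
           (\<exists>t\<in>{a..b}. z t \<in> graph_boundary M \<and> (\<forall>s\<in>{a..t}. z s \<in> M))) \<and>
        (z b \<in> M \<longrightarrow> (\<forall>t\<in>{a..b}. z t \<in> M) \<or>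
           (\<exists>t\<in>{a..b}. z t \<in> graph_boundary M \<and> (\<forall>s\<in>{t..b}. z s \<in> M))))"

text \<open>
  A slow invariant manifold is a family \<open>M eps\<close>, \<open>0 < eps < e0\<close>, of locally invariant manifolds
  that are \<open>O(eps)\<close> close to a compact normally hyperbolic critical manifold \<open>M0\<close>. As usual in
  Fenichel theory, \<open>M eps\<close> is a graph over the same domain as \<open>M0\<close> and closeness is in the
  \<open>C\<^sup>1\<close> sense.
\<close>

definition slow_invariant_manifold ::
  "(real \<Rightarrow> real) \<Rightarrow> real \<Rightarrow> real \<Rightarrow> real \<Rightarrow> state set \<Rightarrow> (real \<Rightarrow> state set) \<Rightarrow> bool" where
  "slow_invariant_manifold I lam eta e0 M0 M \<longleftrightarrow> critical_manifold I M0 \<and>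
     (\<exists>K h0 G0 h G C. compact_domain K \<and> C1_with_gradient h0 G0 K \<and> M0 = graph_over K h0 \<and>
        (\<forall>eps\<in>{0<..<e0}.
           C1_with_gradient (h eps) (G eps) K \<and> M eps = graph_over K (h eps) \<and>
           (\<forall>x\<in>K. \<bar>h eps x - h0 x\<bar> \<le> C * eps \<and> norm (G eps x - G0 x) \<le> C * eps) \<and>
           locally_invariant I lam eta eps (M eps)))"

definition form_pi_minus ::
  "(real \<Rightarrow> real) \<Rightarrow> real \<Rightarrow> int \<Rightarrow> real \<Rightarrow> (real \<Rightarrow> state set) \<Rightarrow> bool" where
  "form_pi_minus I lam k e0 M \<longleftrightarrow>
     (\<exists>C. \<forall>eps\<in>{0<..<e0}. \<forall>(\<omega>, \<Omega>, \<alpha>, \<theta>)\<in>M eps.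
        \<alpha> < (-1) powi k * I \<theta> \<and>
        \<bar>\<omega> - (of_int k * pi - \<Omega>) * (1 + eps * lam / ((-1) powi k * I \<theta> - \<alpha>))\<bar> \<le> C * eps\<^sup>2)"

definition form_pi_plus ::
  "(real \<Rightarrow> real) \<Rightarrow> real \<Rightarrow> int \<Rightarrow> real \<Rightarrow> (real \<Rightarrow> state set) \<Rightarrow> bool" where
  "form_pi_plus I lam k e0 M \<longleftrightarrow>
     (\<exists>C. \<forall>eps\<in>{0<..<e0}. \<forall>(\<omega>, \<Omega>, \<alpha>, \<theta>)\<in>M eps.
        \<alpha> > (-1) powi k * I \<theta> \<and>
        \<bar>\<omega> - (of_int k * pi - \<Omega>) * (1 + eps * lam / ((-1) powi k * I \<theta> - \<alpha>))\<bar> \<le> C * eps\<^sup>2)"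

definition form_F :: "(real \<Rightarrow> real) \<Rightarrow> real \<Rightarrow> (real \<Rightarrow> state set) \<Rightarrow> bool" where
  "form_F I e0 M \<longleftrightarrow>
     (\<exists>C. \<forall>eps\<in>{0<..<e0}. \<forall>(\<omega>, \<Omega>, \<alpha>, \<theta>)\<in>M eps.
        \<bar>\<alpha> * cos (\<Omega> + \<omega>) - I \<theta>\<bar> \<le> C * eps \<and> sin (\<Omega> + \<omega>) \<noteq> 0 \<and> \<alpha> \<noteq> 0)"

definition of_three_forms ::
  "(real \<Rightarrow> real) \<Rightarrow> real \<Rightarrow> real \<Rightarrow> (real \<Rightarrow> state set) \<Rightarrow> bool" where
  "of_three_forms I lam e0 M \<longleftrightarrow>
     (\<exists>k. form_pi_minus I lam k e0 M) \<or> (\<exists>k. form_pi_plus I lam k e0 M) \<or> form_F I e0 M"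

text \<open>
  Distance to \<open>M\<close> along the fast fibre; for a graph over \<open>K\<close> and \<open>x \<in> K\<close> this is
  \<open>\<bar>\<omega> - h x\<bar>\<close> at \<open>(\<omega>, x)\<close>.
\<close>

definition transverse_dist :: "state set \<Rightarrow> state \<Rightarrow> real" where
  "transverse_dist M p = infdist (fst p) {w. (w, snd p) \<in> M}"

text \<open>
  Attraction at an exponential rate \<open>\<kappa>/eps\<close>, uniformly on a neighbourhood of size independent of
  \<open>eps\<close>, for as long as the slow variables stay in the domain of the manifold. Repulsion is
  attraction for the time-reversed flow.
\<close>

definition locally_attracting ::
  "(real \<Rightarrow> real) \<Rightarrow> real \<Rightarrow> real \<Rightarrow> real \<Rightarrow> (real \<Rightarrow> state set) \<Rightarrow> bool" where
  "locally_attracting I lam eta e0 M \<longleftrightarrow>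
     (\<exists>\<delta>>0. \<exists>\<kappa>>0. \<exists>C. \<forall>eps\<in>{0<..<e0}. \<forall>z a b.
        a \<le> b \<and> solution I lam eta eps z {a..b} \<and> (\<forall>t\<in>{a..b}. snd (z t) \<in> snd ` M eps) \<and>
        transverse_dist (M eps) (z a) < \<delta> \<longrightarrow>
        transverse_dist (M eps) (z b)
          \<le> C * exp (- \<kappa> * (b - a) / eps) * transverse_dist (M eps) (z a))"

definition locally_repelling ::
  "(real \<Rightarrow> real) \<Rightarrow> real \<Rightarrow> real \<Rightarrow> real \<Rightarrow> (real \<Rightarrow> state set) \<Rightarrow> bool" where
  "locally_repelling I lam eta e0 M \<longleftrightarrow>
     (\<exists>\<delta>>0. \<exists>\<kappa>>0. \<exists>C. \<forall>eps\<in>{0<..<e0}. \<forall>z a b.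
        a \<le> b \<and> solution I lam eta eps z {a..b} \<and> (\<forall>t\<in>{a..b}. snd (z t) \<in> snd ` M eps) \<and>
        transverse_dist (M eps) (z b) < \<delta> \<longrightarrow>
        transverse_dist (M eps) (z a)
          \<le> C * exp (- \<kappa> * (b - a) / eps) * transverse_dist (M eps) (z b))"

end

theory Submission
  imports Defs
begin

text \<open>
  On a graph \<open>\<omega> = h(x)\<close> over the slow variables, local invariance is equivalent to the first order
  equation \<open>f(h, x) = \<epsilon> \<nabla>h \<bullet> g(h, x)\<close> for the fast component \<open>f\<close> and the slow component \<open>g\<close>. Near a
  compact normally hyperbolic branch \<open>\<omega> = h0(x)\<close> of \<open>f = 0\<close> put \<open>v = \<omega> - h0(x)\<close>, reverse time if the
  branch attracts, and cut the field off so that \<open>v\<close> expands at a rate of order \<open>1/\<epsilon>\<close> everywhere. For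
  each \<open>x\<close> a connectedness argument yields a \<open>V(x) = O(\<epsilon>)\<close> whose forward orbit stays \<open>O(\<epsilon>)\<close>-close to
  \<open>v = 0\<close>. Comparing two such orbits shows that \<open>V\<close> is Lipschitz with constant \<open>O(\<epsilon>)\<close>; comparing
  three of them bounds its second differences, so \<open>V\<close> is continuously differentiable and
  \<open>h0 + V\<close> solves the equation near the given compact set.

  Conversely every slow manifold satisfies the equation. Expanding it to first order in \<open>\<epsilon>\<close> gives
  the stated forms, and along solutions the deviation \<open>\<omega> - h(x)\<close> obeys a scalar equation whose
  leading rate is \<open>1/\<epsilon>\<close> times the derivative of \<open>f\<close> in \<open>\<omega>\<close>, which determines the stability.
\<close>

section \<open>Ordinary differential equations and differential inequalities\<close>

text \<open>Closeness is required of the gradients too, so the gradient of \<open>h eps\<close> must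
  exist on an open set and be O(eps) close to that of \<open>h0\<close>. Second differences are used
  instead of a variational equation: they are stable under cutoffs and compositions, and they can be
  estimated directly along orbits on an infinite time interval. As only Lipschitz derivatives are
  asked for, all cutoff functions can be built from \<open>(max 0 s)\<^sup>2\<close>.

  The constant O(eps), rather than O(1), in the Lipschitz estimate for V comes from the fact that,
  in the coordinate v, the fast field depends on x only through terms of size |v| + eps. For the
  given field this is a separation of variables by the addition theorems. The cutoff must preserve
  the expansion, so the field is interpolated with a linear field A v whose rate A is at least that
  of the given field in the tube.

  Infinitely many manifolds with one bound on eps cannot be had by treating each branch separately;
  the invariance of the field under shifts of \<Omega> by multiples of 2 pi reduces the branches to
  two.\<close>

lemma primitive_has_vector_derivative:
  fixes H :: "real \<Rightarrow> 'a::banach"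
  assumes H: "continuous_on UNIV H" and t: "t \<ge> 0"
  shows "((\<lambda>t. integral {0..t} H) has_vector_derivative H t) (at t within {0..})"
proof -
  have "((\<lambda>t. integral {0..t} H) has_vector_derivative H t) (at t within {0..t+1})"
    using t by (intro integral_has_vector_derivative continuous_on_subset[OF H]) auto
  moreover have "at t within {0..t+1} = at t within {0..}"
    by (rule at_within_nhd[where S="{..<t+1}"]) auto
  ultimately show ?thesis by simp
qed

text \<open>The integral of \<open>exp (\<mu> * s)\<close> over [0, t] is at most
  \<open>exp (\<mu> * t) / \<mu>\<close>, so the weight gains a factor \<open>1 / \<mu>\<close>.
  This factor makes the Picard operator below a contraction on an unbounded time interval.\<close>

lemma exp_weighted_integral_bound:
  fixes H :: "real \<Rightarrow> 'a::euclidean_space"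
  assumes H: "continuous_on UNIV H" and mu: "\<mu> > 0" and t: "t \<ge> 0" and M: "M \<ge> 0"
    and bound: "\<And>s. s \<ge> 0 \<Longrightarrow> norm (H s) \<le> M * exp (\<mu> * s)"
  shows "norm (exp (- \<mu> * t) *\<^sub>R integral {0..t} H) \<le> M / \<mu>"
proof -
  have 1: "((\<lambda>s. M * exp (\<mu> * s)) has_integral (M / \<mu> * exp (\<mu> * t) - M / \<mu> * exp (\<mu> * 0))) {0..t}"
    using t mu by (intro fundamental_theorem_of_calculus)
      (auto intro!: derivative_eq_intros simp flip: has_real_derivative_iff_has_vector_derivative)
  have "norm (integral {0..t} H) \<le> integral {0..t} (\<lambda>s. M * exp (\<mu> * s))"
    using 1 bound by (intro integral_norm_bound_integral integrable_continuous_real continuous_on_subset[OF H])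
      (auto intro!: continuous_intros)
  also have "\<dots> \<le> M / \<mu> * exp (\<mu> * t)"
    using integral_unique[OF 1] M mu by simp
  finally have "norm (integral {0..t} H) \<le> M / \<mu> * exp (\<mu> * t)" .
  then have "exp (- \<mu> * t) * norm (integral {0..t} H) \<le> exp (- \<mu> * t) * (M / \<mu> * exp (\<mu> * t))"
    by (intro mult_left_mono) auto
  then show ?thesis by (simp add: exp_minus field_simps)
qed

text \<open>Picard iteration in an exponentially weighted norm: the fixed point is
  \<open>y t = exp (- \<mu> * t) *\<^sub>R (z t - z0)\<close>, bounded on the whole half-line, so
  local solutions need not be continued.\<close>

theorem lipschitz_ode_global_solution:
  fixes F :: "'a::euclidean_space \<Rightarrow> 'a"
  assumes F: "\<And>x y. norm (F x - F y) \<le> L * norm (x - y)"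
  shows "\<exists>z. z 0 = z0 \<and> (\<forall>t\<ge>0. (z has_vector_derivative F (z t)) (at t within {0..}))"
proof -
  have contF: "continuous_on UNIV F"
  proof (rule lipschitz_on_continuous_on[of "\<bar>L\<bar>"])
    have "norm (F x - F y) \<le> \<bar>L\<bar> * norm (x - y)" for x y
      by (rule order_trans[OF F]) (auto intro: mult_right_mono)
    then show "\<bar>L\<bar>-lipschitz_on UNIV F" by (auto simp: lipschitz_on_def dist_norm)
  qed
  \<comment> \<open>The operator has Lipschitz constant \<open>\<bar>L\<bar> / \<mu>\<close>, which
    this choice keeps below 1/2.\<close>
  define \<mu> where "\<mu> = 2 * \<bar>L\<bar> + 1"
  have mu: "\<mu> > 0" by (simp add: \<mu>_def)
  define H where "H = (\<lambda>(y::real \<Rightarrow>\<^sub>C 'a) s. F (z0 + exp (\<mu> * s) *\<^sub>R apply_bcontfun y s))"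
  have contH: "continuous_on UNIV (H y)" for y
    unfolding H_def by (intro continuous_on_compose2[OF contF] continuous_intros) auto
  \<comment> \<open>Replacing t by \<open>max 0 t\<close> extends the operator by 0 to negative
    times, because the bounded continuous functions live on all reals.\<close>
  define T where "T = (\<lambda>y t. exp (- \<mu> * max 0 t) *\<^sub>R integral {0..max 0 t} (H y))"
  have T_in: "T y \<in> bcontfun" for y
  proof (rule bcontfun_normI)
    have "continuous_on {0..} (\<lambda>t. integral {0..t} (H y))"
      by (rule continuous_on_vector_derivative[where f'="H y"])
        (auto intro: primitive_has_vector_derivative[OF contH])
    then have "continuous_on UNIV (\<lambda>t. integral {0..max 0 t} (H y))"
      by (rule continuous_on_compose2) (auto intro!: continuous_intros)
    then show "continuous_on UNIV (T y)"
      unfolding T_def by (intro continuous_on_scaleR) (auto intro!: continuous_intros)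
    fix t
    have "norm (H y s) \<le> (norm (F z0) + \<bar>L\<bar> * norm y) * exp (\<mu> * s)" if "s \<ge> 0" for s
    proof -
      have "norm (H y s) \<le> norm (F z0) + norm (F (z0 + exp (\<mu> * s) *\<^sub>R apply_bcontfun y s) - F z0)"
        unfolding H_def by norm
      also have "\<dots> \<le> norm (F z0) + L * (exp (\<mu> * s) * norm (apply_bcontfun y s))"
        using F[of "z0 + exp (\<mu> * s) *\<^sub>R apply_bcontfun y s" z0] by simp
      also have "L * (exp (\<mu> * s) * norm (apply_bcontfun y s)) \<le> \<bar>L\<bar> * (exp (\<mu> * s) * norm y)"
        by (intro mult_mono norm_bounded) auto
      also have "norm (F z0) \<le> norm (F z0) * exp (\<mu> * s)"
        using that mu by (simp add: mult_le_cancel_left1)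
      finally show ?thesis by (simp add: algebra_simps)
    qed
    then show "norm (T y t) \<le> (norm (F z0) + \<bar>L\<bar> * norm y) / \<mu>"
      unfolding T_def by (intro exp_weighted_integral_bound contH mu) auto
  qed
  have contr: "dist (Bcontfun (T y)) (Bcontfun (T y')) \<le> 1/2 * dist y y'" for y y'
  proof (rule dist_bound)
    fix t
    have "dist (T y t) (T y' t) = norm (exp (- \<mu> * max 0 t) *\<^sub>R integral {0..max 0 t} (\<lambda>s. H y s - H y' s))"
      unfolding T_def dist_norm
      by (subst integral_diff)
        (auto intro!: integrable_continuous_real continuous_on_subset[OF contH] simp: algebra_simps)
    also have "\<dots> \<le> (\<bar>L\<bar> * dist y y') / \<mu>"
    proof (intro exp_weighted_integral_bound mu continuous_on_diff contH)
      fix s :: real assume "s \<ge> 0"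
      have "norm (H y s - H y' s) \<le> L * norm (exp (\<mu> * s) *\<^sub>R (apply_bcontfun y s - apply_bcontfun y' s))"
        unfolding H_def using F[of "z0 + exp (\<mu> * s) *\<^sub>R apply_bcontfun y s"
            "z0 + exp (\<mu> * s) *\<^sub>R apply_bcontfun y' s"] by (simp add: algebra_simps)
      also have "\<dots> = L * (exp (\<mu> * s) * dist (apply_bcontfun y s) (apply_bcontfun y' s))"
        by (simp add: dist_norm)
      also have "\<dots> \<le> \<bar>L\<bar> * (exp (\<mu> * s) * dist y y')"
        by (intro mult_mono dist_bounded) auto
      finally show "norm (H y s - H y' s) \<le> \<bar>L\<bar> * dist y y' * exp (\<mu> * s)" by (simp add: algebra_simps)
    qed auto
    also have "\<dots> \<le> 1/2 * dist y y'"
    proof -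
      have "\<bar>L\<bar> * dist y y' \<le> \<mu> / 2 * dist y y'" by (intro mult_right_mono) (auto simp: \<mu>_def)
      then show ?thesis using mu by (simp add: field_simps)
    qed
    finally show "dist (apply_bcontfun (Bcontfun (T y)) t) (apply_bcontfun (Bcontfun (T y')) t) \<le> 1/2 * dist y y'"
      by (simp add: Bcontfun_inverse T_in)
  qed
  obtain y where y: "Bcontfun (T y) = y"
    using banach_fix_type[of "1/2" "\<lambda>y. Bcontfun (T y)"] contr by auto
  have yT: "apply_bcontfun y t = T y t" for t
    by (metis y T_in Bcontfun_inverse)
  define z where "z = (\<lambda>t. z0 + integral {0..t} (H y))"
  have zH: "F (z t) = H y t" if "t \<ge> 0" for t
    using that by (simp add: z_def H_def yT[of t] T_def max_def exp_minus)
  have "(z has_vector_derivative F (z t)) (at t within {0..})" if "t \<ge> 0" for t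
    unfolding zH[OF that] unfolding z_def
    using primitive_has_vector_derivative[OF contH that] by (auto intro!: derivative_eq_intros)
  moreover have "z 0 = z0" by (simp add: z_def)
  ultimately show ?thesis by blast
qed

lemma mvt_within_half_line:
  fixes W W' :: "real \<Rightarrow> real"
  assumes der: "\<And>t. t \<ge> 0 \<Longrightarrow> (W has_real_derivative W' t) (at t within {0..})"
    and "0 \<le> a" "a < b"
  shows "\<exists>\<xi>. a < \<xi> \<and> \<xi> < b \<and> W b - W a = (b - a) * W' \<xi>"
proof -
  have cont: "continuous_on {0..} W"
    by (rule DERIV_continuous_on) (use der in auto)
  obtain \<xi> where "a < \<xi>" "\<xi> < b" "W b - W a = (b - a) * W' \<xi>"
  proof (rule mvt[OF \<open>a < b\<close>, where f=W and f'="\<lambda>x h. h * W' x"])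
    have "{a..b} \<subseteq> {0..}" using \<open>0 \<le> a\<close> by auto
    then show "continuous_on {a..b} W" by (rule continuous_on_subset[OF cont])
    fix x assume x: "a < x" "x < b"
    have "at x within {0..} = at x" using x \<open>0 \<le> a\<close> by (intro at_within_interior) auto
    then show "(W has_derivative (\<lambda>h. h * W' x)) (at x)"
      using der[of x] x \<open>0 \<le> a\<close> by (simp add: has_field_derivative_def mult_commute_abs)
  qed
  then show ?thesis by (intro exI[of _ \<xi>]) simp
qed

text \<open>Take the last time s up to t with \<open>W s \<ge> W 0\<close>. By continuity W is still
  positive shortly after s, hence does not decrease there, which contradicts the choice of
  s.\<close>

lemma stays_above_if_increasing_when_positive:
  fixes W W' :: "real \<Rightarrow> real"
  assumes der: "\<And>t. t \<ge> 0 \<Longrightarrow> (W has_real_derivative W' t) (at t within {0..})"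
    and grow: "\<And>t. t \<ge> 0 \<Longrightarrow> W t > 0 \<Longrightarrow> W' t \<ge> 0"
    and W0: "W 0 > 0" and t: "t \<ge> 0"
  shows "W t \<ge> W 0"
proof (rule ccontr)
  have cont: "continuous_on {0..} W"
    by (rule DERIV_continuous_on) (use der in auto)
  note mvt = mvt_within_half_line[OF der]
  assume neg: "\<not> W 0 \<le> W t"
  define S where "S = {s\<in>{0..t}. W s \<ge> W 0}"
  have clS: "closed S"
  proof -
    have "closed ({0..t} \<inter> W -` {W 0..})"
      by (rule continuous_closed_preimage[OF continuous_on_subset[OF cont]]) auto
    moreover have "S = {0..t} \<inter> W -` {W 0..}" by (auto simp: S_def)
    ultimately show ?thesis by simp
  qed
  have S0: "0 \<in> S" using t by (auto simp: S_def)
  have bS: "bdd_above S" by (auto simp: S_def intro!: bdd_aboveI[of _ t])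
  define s where "s = Sup S"
  have sS: "s \<in> S" unfolding s_def using closed_contains_Sup clS S0 bS by blast
  have st: "s < t" using sS neg by (cases "s = t") (auto simp: S_def)
  have s0: "s \<ge> 0" using sS by (auto simp: S_def)
  have notin: "W r < W 0" if "s < r" "r \<le> t" for r
  proof (rule ccontr)
    assume "\<not> W r < W 0"
    then have "r \<in> S" using that s0 by (auto simp: S_def)
    then have "r \<le> s" using cSup_upper[OF _ bS] by (simp add: s_def)
    then show False using that by simp
  qed
  have "continuous (at s within {0..}) W" using cont s0 by (auto simp: continuous_on_eq_continuous_within)
  moreover have "W s > 0" using sS W0 by (auto simp: S_def)
  ultimately have "eventually (\<lambda>r. W r > 0) (at s within {0..})"
    unfolding continuous_within by (rule order_tendstoD)
  then obtain d where d: "d > 0" "\<And>r. r \<in> {0..} \<Longrightarrow> r \<noteq> s \<Longrightarrow> dist r s < d \<Longrightarrow> W r > 0"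
    by (auto simp: eventually_at)
  define b where "b = min t (s + d / 2)"
  have b: "s < b" "b \<le> t" using st d by (auto simp: b_def)
  obtain \<xi> where xi: "s < \<xi>" "\<xi> < b" "W b - W s = (b - s) * W' \<xi>" using mvt[OF _ s0 b(1)] by blast
  have "W \<xi> > 0" using xi s0 d by (intro d(2)) (auto simp: b_def dist_real_def)
  then have "W' \<xi> \<ge> 0" using grow[of \<xi>] xi s0 by simp
  then have "W b \<ge> W s" using xi b by (smt (verit) mult_nonneg_nonneg)
  then show False using notin[OF b] sS by (auto simp: S_def)
qed

text \<open>If W started positive it would stay above \<open>W 0\<close>, so its derivative would be
  at least \<open>\<mu> * W 0\<close> and W would leave every bound. The cone estimate and the
  second difference estimate both apply this to a quadratic expression in differences of
  orbits.\<close>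

lemma growth_bounded_nonpos:
  fixes W W' :: "real \<Rightarrow> real"
  assumes der: "\<And>t. t \<ge> 0 \<Longrightarrow> (W has_real_derivative W' t) (at t within {0..})"
    and grow: "\<And>t. t \<ge> 0 \<Longrightarrow> W t > 0 \<Longrightarrow> W' t \<ge> \<mu> * W t"
    and mu: "\<mu> > 0" and bdd: "\<And>t. t \<ge> 0 \<Longrightarrow> W t \<le> B"
  shows "W 0 \<le> 0"
proof (rule ccontr)
  assume "\<not> W 0 \<le> 0"
  then have W0: "W 0 > 0" by simp
  have ge: "W t \<ge> W 0" if "t \<ge> 0" for t
  proof (rule stays_above_if_increasing_when_positive[of W W'])
    fix t assume "t \<ge> 0" "W t > 0"
    then have "W' t \<ge> \<mu> * W t" "\<mu> * W t > 0" using grow mu by auto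
    then show "W' t \<ge> 0" by simp
  qed (use der W0 that in auto)
  define t where "t = (\<bar>B\<bar> + 1) / (\<mu> * W 0)"
  have t0: "t > 0" using mu W0 by (auto simp: t_def)
  obtain \<xi> where xi: "0 < \<xi>" "\<xi> < t" "W t - W 0 = (t - 0) * W' \<xi>" using mvt_within_half_line[of W W' 0 t] t0 by (auto intro: der)
  have "W' \<xi> \<ge> \<mu> * W \<xi>" using grow[of \<xi>] ge[of \<xi>] xi W0 by auto
  also have "\<mu> * W \<xi> \<ge> \<mu> * W 0" using ge[of \<xi>] xi mu by auto
  finally have "t * W' \<xi> \<ge> t * (\<mu> * W 0)" using t0 by auto
  also have "t * (\<mu> * W 0) = \<bar>B\<bar> + 1" using mu W0 by (auto simp: t_def)
  finally have "W t > B" using xi W0 by simp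
  then show False using bdd[of t] t0 by simp
qed

text \<open>The inequality is asked for on the open interval because the lemma is later used up to a
  first exit time, where the condition that yields the inequality fails.\<close>

lemma gronwall_open:
  fixes u u' :: "real \<Rightarrow> real"
  assumes der: "\<And>t. t \<in> {a..b} \<Longrightarrow> (u has_real_derivative u' t) (at t within {a..b})"
    and le: "\<And>t. t \<in> {a<..<b} \<Longrightarrow> u' t \<le> k * u t" and t: "t \<in> {a..b}"
  shows "u t \<le> u a * exp (k * (t - a))"
proof -
  define w where "w = (\<lambda>t. u t * exp (- k * (t - a)))"
  have "w t \<le> w a"
  proof (rule DERIV_nonpos_imp_decreasing_open[of a t w])
    show "a \<le> t" using t by auto
    have "continuous_on {a..b} u"
      by (rule DERIV_continuous_on) (rule der)
    then have "continuous_on {a..t} u" by (rule continuous_on_subset) (use t in auto)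
    then show "continuous_on {a..t} w"
      unfolding w_def by (rule continuous_on_mult) (auto intro!: continuous_intros)
    fix x assume x: "a < x" "x < t"
    have "at x within {a..b} = at x" using x t by (intro at_within_interior) auto
    then have "(u has_real_derivative u' x) (at x)" using der[of x] x t by auto
    then have "(w has_real_derivative (u' x - k * u x) * exp (- k * (x - a))) (at x)"
      unfolding w_def by (auto intro!: derivative_eq_intros simp: algebra_simps)
    moreover have "(u' x - k * u x) * exp (- k * (x - a)) \<le> 0"
      using le[of x] x t by (intro mult_nonpos_nonneg) auto
    ultimately show "\<exists>y. (w has_real_derivative y) (at x) \<and> y \<le> 0" by blast
  qed
  then have "u t * exp (- k * (t - a)) * exp (k * (t - a)) \<le> u a * exp (k * (t - a))"
    by (intro mult_right_mono) (auto simp: w_def)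
  then show ?thesis by (simp only: mult.assoc exp_add[symmetric]) simp
qed

lemma gronwall_le:
  fixes u u' :: "real \<Rightarrow> real"
  assumes der: "\<And>t. t \<in> {a..b} \<Longrightarrow> (u has_real_derivative u' t) (at t within {a..b})"
    and le: "\<And>t. t \<in> {a..b} \<Longrightarrow> u' t \<le> k * u t" and t: "t \<in> {a..b}"
  shows "u t \<le> u a * exp (k * (t - a))"
proof (rule gronwall_open[where u'=u'])
  fix t assume "t \<in> {a<..<b}"
  then show "u' t \<le> k * u t" by (intro le) simp
qed (use der t in auto)

section \<open>Functions with bounded second differences\<close>

text \<open>
  A substitute for \<open>C\<^sup>1\<close> with Lipschitz derivative that never mentions the derivative and hence
  passes to limits and compositions without differentiation.
\<close>

definition c11_on :: "'a::real_normed_vector set \<Rightarrow> ('a \<Rightarrow> 'b::real_normed_vector) \<Rightarrow> bool" where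
  "c11_on S F \<longleftrightarrow> (\<exists>C\<ge>0. (\<forall>a\<in>S. \<forall>b\<in>S. norm (F a - F b) \<le> C * norm (a - b)) \<and>
     (\<forall>z y. z \<in> S \<longrightarrow> z + y \<in> S \<longrightarrow> z - y \<in> S \<longrightarrow>
        norm (F (z + y) + F (z - y) - 2 *\<^sub>R F z) \<le> C * (norm y)\<^sup>2))"

definition c11_at :: "('a::real_normed_vector \<Rightarrow> 'b::real_normed_vector) \<Rightarrow> 'a \<Rightarrow> bool" where
  "c11_at F x \<longleftrightarrow> (\<exists>r>0. c11_on (ball x r) F)"

lemma c11_onI:
  assumes "\<And>a b. a \<in> S \<Longrightarrow> b \<in> S \<Longrightarrow> norm (F a - F b) \<le> C * norm (a - b)"
    and "\<And>z y. z \<in> S \<Longrightarrow> z + y \<in> S \<Longrightarrow> z - y \<in> S \<Longrightarrow>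
      norm (F (z + y) + F (z - y) - 2 *\<^sub>R F z) \<le> D * (norm y)\<^sup>2"
  shows "c11_on S F"
  unfolding c11_on_def
proof (intro exI[of _ "max 0 (max C D)"] conjI ballI allI impI)
  fix a b assume "a \<in> S" "b \<in> S"
  then show "norm (F a - F b) \<le> max 0 (max C D) * norm (a - b)"
    by (intro order_trans[OF assms(1)] mult_right_mono) auto
next
  fix z y assume "z \<in> S" "z + y \<in> S" "z - y \<in> S"
  then show "norm (F (z + y) + F (z - y) - 2 *\<^sub>R F z) \<le> max 0 (max C D) * (norm y)\<^sup>2"
    by (intro order_trans[OF assms(2)] mult_right_mono) auto
qed auto

lemma c11_onE:
  assumes "c11_on S F"
  obtains C where "C \<ge> 0"
    "\<And>a b. a \<in> S \<Longrightarrow> b \<in> S \<Longrightarrow> norm (F a - F b) \<le> C * norm (a - b)"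
    "\<And>z y. z \<in> S \<Longrightarrow> z + y \<in> S \<Longrightarrow> z - y \<in> S \<Longrightarrow>
      norm (F (z + y) + F (z - y) - 2 *\<^sub>R F z) \<le> C * (norm y)\<^sup>2"
  using assms unfolding c11_on_def by blast

lemma c11_on_subset: "c11_on T F \<Longrightarrow> S \<subseteq> T \<Longrightarrow> c11_on S F"
  unfolding c11_on_def by (meson subsetD)

lemma c11_on_imp_continuous_on: 
  assumes "c11_on S F" shows "continuous_on S F"
proof -
  obtain C where "C \<ge> 0" "\<And>a b. a \<in> S \<Longrightarrow> b \<in> S \<Longrightarrow> norm (F a - F b) \<le> C * norm (a - b)"
    by (rule c11_onE[OF assms]) blast
  then have "C-lipschitz_on S F" by (auto simp: lipschitz_on_def dist_norm)
  then show ?thesis by (rule lipschitz_on_continuous_on)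
qed

lemma c11_on_bounded:
  assumes "c11_on S F" "bounded S" shows "bounded (F ` S)"
proof (cases "S = {}")
  case False
  then obtain a where a: "a \<in> S" by auto
  obtain C where C: "C \<ge> 0" "\<And>a b. a \<in> S \<Longrightarrow> b \<in> S \<Longrightarrow> norm (F a - F b) \<le> C * norm (a - b)"
    using assms by (auto elim: c11_onE)
  obtain B where B: "\<And>b. b \<in> S \<Longrightarrow> norm (b - a) \<le> B"
    using assms(2) by (metis bounded_any_center dist_norm norm_minus_commute)
  have "norm (F b) \<le> norm (F a) + C * B" if "b \<in> S" for b
  proof -
    have "norm (F b) \<le> norm (F a) + norm (F b - F a)" by norm
    also have "norm (F b - F a) \<le> C * norm (b - a)" using C(2) that a by auto
    also have "\<dots> \<le> C * B" using B that C by (intro mult_left_mono) auto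
    finally show ?thesis by simp
  qed
  then show ?thesis by (auto simp: bounded_iff)
qed simp

lemma c11_on_bounded_linear: 
  assumes "bounded_linear f" shows "c11_on S f"
proof -
  interpret bounded_linear f by fact
  obtain K where K: "\<And>x. norm (f x) \<le> norm x * K" using bounded by blast
  show ?thesis
  proof (rule c11_onI[of S f K 0])
    fix a b show "norm (f a - f b) \<le> K * norm (a - b)"
      using K[of "a - b"] by (simp add: diff mult.commute)
  next
    fix z y show "norm (f (z + y) + f (z - y) - 2 *\<^sub>R f z) \<le> 0 * (norm y)\<^sup>2"
      by (simp add: add diff scaleR_2)
  qed
qed

lemma c11_on_const: "c11_on S (\<lambda>x. c)"
  by (rule c11_onI[of _ _ 0 0]) (auto simp: scaleR_2)

lemma c11_on_add:
  assumes "c11_on S F" "c11_on S G" shows "c11_on S (\<lambda>x. F x + G x)"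
proof -
  obtain C where C: "\<And>a b. a \<in> S \<Longrightarrow> b \<in> S \<Longrightarrow> norm (F a - F b) \<le> C * norm (a - b)"
    "\<And>z y. z \<in> S \<Longrightarrow> z + y \<in> S \<Longrightarrow> z - y \<in> S \<Longrightarrow>
      norm (F (z + y) + F (z - y) - 2 *\<^sub>R F z) \<le> C * (norm y)\<^sup>2"
    by (rule c11_onE[OF assms(1)]) blast
  obtain D where D: "\<And>a b. a \<in> S \<Longrightarrow> b \<in> S \<Longrightarrow> norm (G a - G b) \<le> D * norm (a - b)"
    "\<And>z y. z \<in> S \<Longrightarrow> z + y \<in> S \<Longrightarrow> z - y \<in> S \<Longrightarrow>
      norm (G (z + y) + G (z - y) - 2 *\<^sub>R G z) \<le> D * (norm y)\<^sup>2"
    by (rule c11_onE[OF assms(2)]) blast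
  show ?thesis
  proof (rule c11_onI[of S _ "C + D" "C + D"])
    fix a b assume "a \<in> S" "b \<in> S"
    then have "norm (F a - F b) + norm (G a - G b) \<le> (C + D) * norm (a - b)"
      using C(1)[of a b] D(1)[of a b] by (simp add: algebra_simps)
    moreover have "F a + G a - (F b + G b) = (F a - F b) + (G a - G b)" by simp
    ultimately show "norm (F a + G a - (F b + G b)) \<le> (C + D) * norm (a - b)"
      by (metis norm_triangle_ineq order_trans)
  next
    fix z y assume "z \<in> S" "z + y \<in> S" "z - y \<in> S"
    then have "norm (F (z + y) + F (z - y) - 2 *\<^sub>R F z) + norm (G (z + y) + G (z - y) - 2 *\<^sub>R G z) 
        \<le> (C + D) * (norm y)\<^sup>2"
      using C(2)[of z y] D(2)[of z y] by (simp add: algebra_simps)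
    moreover have "F (z + y) + G (z + y) + (F (z - y) + G (z - y)) - 2 *\<^sub>R (F z + G z) =
      (F (z + y) + F (z - y) - 2 *\<^sub>R F z) + (G (z + y) + G (z - y) - 2 *\<^sub>R G z)"
      by (simp add: algebra_simps)
    ultimately show "norm (F (z + y) + G (z + y) + (F (z - y) + G (z - y)) - 2 *\<^sub>R (F z + G z)) \<le> (C + D) * (norm y)\<^sup>2"
      by (metis norm_triangle_ineq order_trans)
  qed
qed

text \<open>The point \<open>F (z - y)\<close> differs from the reflection of
  \<open>F (z + y)\<close> in \<open>F z\<close> by a second difference of F. The second difference
  of G is taken with this reflected point, which the last assumption keeps in T; the Lipschitz
  constant of G pays for the rest.\<close>

lemma c11_on_compose:
  assumes F: "c11_on S F" and G: "c11_on T G" and FS: "F ` S \<subseteq> T"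
    and refl: "\<And>a b. a \<in> S \<Longrightarrow> b \<in> S \<Longrightarrow> 2 *\<^sub>R F a - F b \<in> T"
  shows "c11_on S (\<lambda>x. G (F x))"
proof -
  obtain C where C: "C \<ge> 0" "\<And>a b. a \<in> S \<Longrightarrow> b \<in> S \<Longrightarrow> norm (F a - F b) \<le> C * norm (a - b)"
    "\<And>z y. z \<in> S \<Longrightarrow> z + y \<in> S \<Longrightarrow> z - y \<in> S \<Longrightarrow>
      norm (F (z + y) + F (z - y) - 2 *\<^sub>R F z) \<le> C * (norm y)\<^sup>2"
    using F by (auto elim: c11_onE)
  obtain D where D: "D \<ge> 0" "\<And>a b. a \<in> T \<Longrightarrow> b \<in> T \<Longrightarrow> norm (G a - G b) \<le> D * norm (a - b)"
    "\<And>z y. z \<in> T \<Longrightarrow> z + y \<in> T \<Longrightarrow> z - y \<in> T \<Longrightarrow>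
      norm (G (z + y) + G (z - y) - 2 *\<^sub>R G z) \<le> D * (norm y)\<^sup>2"
    using G by (auto elim: c11_onE)
  show ?thesis
  proof (rule c11_onI[of S _ "D * C" "D * C\<^sup>2 + D * C"])
    fix a b assume ab: "a \<in> S" "b \<in> S"
    then have "norm (G (F a) - G (F b)) \<le> D * norm (F a - F b)" using FS by (intro D) auto
    also have "\<dots> \<le> D * (C * norm (a - b))" using ab C D by (intro mult_left_mono) auto
    finally show "norm (G (F a) - G (F b)) \<le> D * C * norm (a - b)" by simp
  next
    fix z y assume zy: "z \<in> S" "z + y \<in> S" "z - y \<in> S"
    define d where "d = F (z + y) - F z"
    have 1: "F z - d = 2 *\<^sub>R F z - F (z + y)" by (simp add: d_def scaleR_2)
    have T: "F z \<in> T" "F z + d \<in> T" "F z - d \<in> T" "F (z - y) \<in> T"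
      using FS zy refl by (auto simp: 1) (auto simp: d_def)
    have "norm (G (F z + d) + G (F z - d) - 2 *\<^sub>R G (F z)) \<le> D * (norm d)\<^sup>2" using T by (intro D)
    also have "\<dots> \<le> D * (C * norm y)\<^sup>2"
      using C(2)[of "z + y" z] zy D by (intro mult_left_mono power_mono) (auto simp: d_def)
    finally have a: "norm (G (F z + d) + G (F z - d) - 2 *\<^sub>R G (F z)) \<le> D * C\<^sup>2 * (norm y)\<^sup>2"
      by (simp add: power_mult_distrib)
    have "norm (G (F (z - y)) - G (F z - d)) \<le> D * norm (F (z - y) - (F z - d))" using T by (intro D)
    also have "F (z - y) - (F z - d) = F (z + y) + F (z - y) - 2 *\<^sub>R F z" by (simp add: d_def scaleR_2)
    also have "D * norm \<dots> \<le> D * (C * (norm y)\<^sup>2)" using zy C D by (intro mult_left_mono) auto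
    finally have b: "norm (G (F (z - y)) - G (F z - d)) \<le> D * C * (norm y)\<^sup>2" by simp
    have "G (F (z + y)) + G (F (z - y)) - 2 *\<^sub>R G (F z) =
        (G (F z + d) + G (F z - d) - 2 *\<^sub>R G (F z)) + (G (F (z - y)) - G (F z - d))"
      by (simp add: d_def)
    then show "norm (G (F (z + y)) + G (F (z - y)) - 2 *\<^sub>R G (F z)) \<le> (D * C\<^sup>2 + D * C) * (norm y)\<^sup>2"
      using a b norm_triangle_ineq[of "G (F z + d) + G (F z - d) - 2 *\<^sub>R G (F z)" "G (F (z - y)) - G (F z - d)"]
      by (simp add: algebra_simps)
  qed
qed

lemma c11_on_scaleR:
  assumes f: "c11_on S f" and G: "c11_on S G" and bf: "bounded (f ` S)" and bG: "bounded (G ` S)"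
  shows "c11_on S (\<lambda>x. f x *\<^sub>R G x)"
proof -
  obtain C where C: "C \<ge> 0" "\<And>a b. a \<in> S \<Longrightarrow> b \<in> S \<Longrightarrow> norm (f a - f b) \<le> C * norm (a - b)"
    "\<And>z y. z \<in> S \<Longrightarrow> z + y \<in> S \<Longrightarrow> z - y \<in> S \<Longrightarrow>
      norm (f (z + y) + f (z - y) - 2 *\<^sub>R f z) \<le> C * (norm y)\<^sup>2"
    using f by (auto elim: c11_onE)
  obtain D where D: "D \<ge> 0" "\<And>a b. a \<in> S \<Longrightarrow> b \<in> S \<Longrightarrow> norm (G a - G b) \<le> D * norm (a - b)"
    "\<And>z y. z \<in> S \<Longrightarrow> z + y \<in> S \<Longrightarrow> z - y \<in> S \<Longrightarrow>
      norm (G (z + y) + G (z - y) - 2 *\<^sub>R G z) \<le> D * (norm y)\<^sup>2"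
    using G by (auto elim: c11_onE)
  obtain M where M: "M > 0" "\<And>a. a \<in> S \<Longrightarrow> norm (f a) \<le> M" using bf by (auto simp: bounded_pos)
  obtain N where N: "N > 0" "\<And>a. a \<in> S \<Longrightarrow> norm (G a) \<le> N" using bG by (auto simp: bounded_pos)
  show ?thesis
  proof (rule c11_onI[of S _ "M * D + C * N" "M * D + C * N + 2 * C * D"])
    fix a b assume ab: "a \<in> S" "b \<in> S"
    have "f a *\<^sub>R G a - f b *\<^sub>R G b = f a *\<^sub>R (G a - G b) + (f a - f b) *\<^sub>R G b" by (simp add: algebra_simps)
    then have "norm (f a *\<^sub>R G a - f b *\<^sub>R G b) \<le> norm (f a) * norm (G a - G b) + norm (f a - f b) * norm (G b)"
      by (metis norm_scaleR norm_triangle_ineq real_norm_def)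
    also have "\<dots> \<le> M * (D * norm (a - b)) + (C * norm (a - b)) * N"
      using ab C D M N by (intro add_mono mult_mono) auto
    finally show "norm (f a *\<^sub>R G a - f b *\<^sub>R G b) \<le> (M * D + C * N) * norm (a - b)" by (simp add: algebra_simps)
  next
    fix z y assume zy: "z \<in> S" "z + y \<in> S" "z - y \<in> S"
    let ?p = "z + y" and ?m = "z - y"
    \<comment> \<open>The Leibniz rule for second differences. The last two terms are products of
      first differences and hence quadratic in y.\<close>
    have eq: "f ?p *\<^sub>R G ?p + f ?m *\<^sub>R G ?m - 2 *\<^sub>R (f z *\<^sub>R G z) =
      f z *\<^sub>R (G ?p + G ?m - 2 *\<^sub>R G z) + (f ?p + f ?m - 2 *\<^sub>R f z) *\<^sub>R G z
      + (f ?p - f z) *\<^sub>R (G ?p - G z) + (f ?m - f z) *\<^sub>R (G ?m - G z)"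
      by (simp add: algebra_simps scaleR_2)
    have n4: "norm (a + b + c + d) \<le> norm a + norm b + norm c + norm d" for a b c d :: 'b by norm
    have "norm (f ?p *\<^sub>R G ?p + f ?m *\<^sub>R G ?m - 2 *\<^sub>R (f z *\<^sub>R G z)) \<le>
      norm (f z) * norm (G ?p + G ?m - 2 *\<^sub>R G z) + norm (f ?p + f ?m - 2 *\<^sub>R f z) * norm (G z)
      + norm (f ?p - f z) * norm (G ?p - G z) + norm (f ?m - f z) * norm (G ?m - G z)"
      unfolding eq using n4[of "f z *\<^sub>R (G ?p + G ?m - 2 *\<^sub>R G z)" "(f ?p + f ?m - 2 *\<^sub>R f z) *\<^sub>R G z"
          "(f ?p - f z) *\<^sub>R (G ?p - G z)" "(f ?m - f z) *\<^sub>R (G ?m - G z)"] by simp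
    also have "\<dots> \<le> M * (D * (norm y)\<^sup>2) + (C * (norm y)\<^sup>2) * N
       + (C * norm y) * (D * norm y) + (C * norm y) * (D * norm y)"
      using zy C(2)[of ?p z] C(2)[of ?m z] D(2)[of ?p z] D(2)[of ?m z] C(1) D(1)
      by (intro add_mono mult_mono M C N D) (use M N in auto)
    finally show "norm (f ?p *\<^sub>R G ?p + f ?m *\<^sub>R G ?m - 2 *\<^sub>R (f z *\<^sub>R G z)) 
       \<le> (M * D + C * N + 2 * C * D) * (norm y)\<^sup>2" by (simp add: algebra_simps power2_eq_square)
  qed
qed

lemma c11_at_common_ball:
  assumes "c11_at F x" "c11_at G x"
  obtains r where "r > 0" "c11_on (ball x r) F" "c11_on (ball x r) G"
proof -
  obtain r s where "r > 0" "c11_on (ball x r) F" "s > 0" "c11_on (ball x s) G"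
    using assms unfolding c11_at_def by blast
  then show ?thesis
    by (intro that[of "min r s"]) (auto elim!: c11_on_subset)
qed

lemma c11_at_const: "c11_at (\<lambda>x. c) x"
  unfolding c11_at_def by (intro exI[of _ 1]) (auto intro: c11_on_const)

lemma c11_at_bounded_linear: "bounded_linear f \<Longrightarrow> c11_at f x"
  unfolding c11_at_def by (intro exI[of _ 1]) (auto intro: c11_on_bounded_linear)

lemma c11_at_add: "c11_at F x \<Longrightarrow> c11_at G x \<Longrightarrow> c11_at (\<lambda>x. F x + G x) x"
  by (erule c11_at_common_ball, assumption) (auto simp: c11_at_def intro: c11_on_add)

lemma c11_at_scaleR: "c11_at f x \<Longrightarrow> c11_at G x \<Longrightarrow> c11_at (\<lambda>x. f x *\<^sub>R G x) x"
  by (erule c11_at_common_ball, assumption)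
    (auto simp: c11_at_def intro!: c11_on_scaleR intro: c11_on_bounded)

lemma c11_at_imp_isCont: "c11_at F x \<Longrightarrow> isCont F x"
  unfolding c11_at_def
  by (meson c11_on_imp_continuous_on centre_in_ball continuous_on_eq_continuous_at open_ball)

lemma c11_at_compose:
  assumes F: "c11_at F x" and G: "c11_at G (F x)"
  shows "c11_at (\<lambda>x. G (F x)) x"
proof -
  obtain R where R: "R > 0" "c11_on (ball (F x) R) G" using G by (auto simp: c11_at_def)
  obtain r where r: "r > 0" "c11_on (ball x r) F" using F by (auto simp: c11_at_def)
  have "isCont F x" using F by (rule c11_at_imp_isCont)
  \<comment> \<open>Points within R/3 of \<open>F x\<close> have reflections in each other within
    2R/3 + R/3 of it.\<close>
  then obtain d where d: "d > 0" "\<And>y. dist y x < d \<Longrightarrow> dist (F y) (F x) < R / 3"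
    using R unfolding continuous_at_eps_delta by (meson divide_pos_pos zero_less_numeral)
  have "c11_on (ball x (min r d)) (\<lambda>x. G (F x))"
  proof (rule c11_on_compose[OF _ R(2)])
    show "c11_on (ball x (min r d)) F" using r(2) by (rule c11_on_subset) auto
    show "F ` ball x (min r d) \<subseteq> ball (F x) R"
      using d(2) R(1) by (force simp: dist_commute)
    fix a b assume "a \<in> ball x (min r d)" "b \<in> ball x (min r d)"
    then have "dist (F a) (F x) < R / 3" "dist (F b) (F x) < R / 3"
      using d(2) by (auto simp: dist_commute)
    then have "norm (2 *\<^sub>R (F a - F x) - (F b - F x)) < R"
      using norm_triangle_ineq4[of "2 *\<^sub>R (F a - F x)" "F b - F x"] by (simp add: dist_norm)
    moreover have "2 *\<^sub>R (F a - F x) - (F b - F x) = 2 *\<^sub>R F a - F b - F x" by (simp add: algebra_simps scaleR_2)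
    ultimately show "2 *\<^sub>R F a - F b \<in> ball (F x) R" by (simp add: dist_norm norm_minus_commute)
  qed
  then show ?thesis unfolding c11_at_def using r d by (intro exI[of _ "min r d"]) auto
qed

lemma c11_at_mult: "c11_at f x \<Longrightarrow> c11_at g x \<Longrightarrow> c11_at (\<lambda>x. f x * g x :: real) x"
  using c11_at_scaleR[of f x g] by simp

lemma c11_at_uminus: "c11_at f x \<Longrightarrow> c11_at (\<lambda>x. - f x) x"
  using c11_at_scaleR[OF c11_at_const[of "-1"], of f x] by simp

lemma c11_at_diff: "c11_at f x \<Longrightarrow> c11_at g x \<Longrightarrow> c11_at (\<lambda>x. f x - g x) x"
  using c11_at_add[OF _ c11_at_uminus[of g x], of f] by simp

lemma c11_at_Pair: 
  assumes "c11_at F x" "c11_at G x" shows "c11_at (\<lambda>x. (F x, G x)) x"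
proof -
  have "c11_at (\<lambda>x. (\<lambda>a. (a, 0)) (F x) + (\<lambda>b. (0, b)) (G x)) x"
    by (intro c11_at_add c11_at_compose[OF assms(1)] c11_at_compose[OF assms(2)] c11_at_bounded_linear
        bounded_linear_intros)
  then show ?thesis by simp
qed

lemma c11_at_fst: "c11_at F x \<Longrightarrow> c11_at (\<lambda>x. fst (F x)) x"
  by (rule c11_at_compose[where G=fst]) (auto intro: c11_at_bounded_linear bounded_linear_fst)

lemma c11_at_snd: "c11_at F x \<Longrightarrow> c11_at (\<lambda>x. snd (F x)) x"
  by (rule c11_at_compose[where G=snd]) (auto intro: c11_at_bounded_linear bounded_linear_snd)

lemma c11_at_id: "c11_at (\<lambda>x. x) x"
  by (intro c11_at_bounded_linear bounded_linear_intros)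

lemma c11_at_cong:
  assumes "c11_at F x" "open U" "x \<in> U" "\<And>y. y \<in> U \<Longrightarrow> F y = G y"
  shows "c11_at G x"
proof -
  obtain r where r: "r > 0" "c11_on (ball x r) F" using assms by (auto simp: c11_at_def)
  obtain s where s: "s > 0" "ball x s \<subseteq> U" using assms(2,3) open_contains_ball by blast
  have "c11_on (ball x (min r s)) F" using r(2) by (rule c11_on_subset) auto
  then have "c11_on (ball x (min r s)) G"
    using assms(4) s by (auto simp: c11_on_def subset_iff)
  then show ?thesis unfolding c11_at_def using r s by (intro exI[of _ "min r s"]) auto
qed

lemma c11_at_inner:
  fixes F :: "'a::real_normed_vector \<Rightarrow> 'b::euclidean_space"
  assumes "c11_at F x" "c11_at G x" shows "c11_at (\<lambda>x. F x \<bullet> G x) x"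
proof -
  have "c11_at (\<lambda>x. \<Sum>b\<in>B. (F x \<bullet> b) * (G x \<bullet> b)) x" if "finite B" for B
    using that
  proof (induction B)
    case (insert b B)
    have "c11_at (\<lambda>x. F x \<bullet> b) x" "c11_at (\<lambda>x. G x \<bullet> b) x"
      using c11_at_compose[OF assms(1), of "\<lambda>a. a \<bullet> b"] c11_at_compose[OF assms(2), of "\<lambda>a. a \<bullet> b"]
      by (auto intro: c11_at_bounded_linear bounded_linear_inner_left)
    with insert show ?case by (simp add: c11_at_add c11_at_mult)
  qed (simp add: c11_at_const)
  from this[OF finite_Basis] show ?thesis by (simp add: euclidean_inner[of "F _" "G _"])
qed

lemma c11_at_sum:
  assumes "finite A" "\<And>i. i \<in> A \<Longrightarrow> c11_at (f i) x" shows "c11_at (\<lambda>x. \<Sum>i\<in>A. f i x) x"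
  using assms by (induction A) (auto intro: c11_at_const c11_at_add)

text \<open>With f'' bounded by B near x, the even function \<open>f (z + t) + f (z - t)\<close> of
  t has derivative at most \<open>2 * B * \<bar>t\<bar>\<close> in modulus, so its increment from 0
  to y is at most \<open>2 * B * y\<^sup>2\<close>.\<close>

lemma c11_at_real_C2:
  fixes f f' f'' :: "real \<Rightarrow> real"
  assumes U: "open U" "x \<in> U"
    and f: "\<And>y. y \<in> U \<Longrightarrow> (f has_real_derivative f' y) (at y)"
    and f': "\<And>y. y \<in> U \<Longrightarrow> (f' has_real_derivative f'' y) (at y)"
    and f'': "isCont f'' x"
  shows "c11_at f x"
proof -
  obtain d where d: "d > 0" "\<And>y. dist y x < d \<Longrightarrow> dist (f'' y) (f'' x) < 1"
    using f'' unfolding continuous_at_eps_delta by (meson zero_less_one)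
  obtain e where e: "e > 0" "ball x e \<subseteq> U" using U open_contains_ball by blast
  define r where "r = min d e"
  define B where "B = \<bar>f'' x\<bar> + 1"
  have r: "r > 0" using d e by (simp add: r_def)
  have inU: "y \<in> U" if "y \<in> ball x r" for y using that e by (auto simp: r_def)
  have B: "norm (f'' y) \<le> B" if "y \<in> ball x r" for y
    using d(2)[of y] that by (auto simp: r_def B_def dist_real_def abs_minus_commute)
  have lip': "norm (f' a - f' b) \<le> B * norm (a - b)" if "a \<in> ball x r" "b \<in> ball x r" for a b
    using that by (intro field_differentiable_bound[OF convex_ball, of x r f' f''])
      (auto intro!: has_field_derivative_at_within f' inU B[unfolded real_norm_def] simp del: mem_ball)
  define B' where "B' = \<bar>f' x\<bar> + B * r"
  have B': "norm (f' y) \<le> B'" if "y \<in> ball x r" for y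
  proof -
    have "B * norm (y - x) \<le> B * r" using that by (intro mult_left_mono) (auto simp: B_def dist_real_def)
    then show ?thesis using lip'[OF that, of x] r by (auto simp: B'_def)
  qed
  have "c11_on (ball x r) f"
  proof (rule c11_onI[of _ _ B' "2 * B"])
    fix a b assume "a \<in> ball x r" "b \<in> ball x r"
    then show "norm (f a - f b) \<le> B' * norm (a - b)"
      by (intro field_differentiable_bound[OF convex_ball, of x r f f'])
        (auto intro!: has_field_derivative_at_within f inU B'[unfolded real_norm_def] simp del: mem_ball)
  next
    fix z y assume zy: "z \<in> ball x r" "z + y \<in> ball x r" "z - y \<in> ball x r"
    define g where "g = (\<lambda>t. f (z + t) + f (z - t))"
    have mem: "z + t \<in> ball x r \<and> z - t \<in> ball x r" if "t \<in> cball 0 \<bar>y\<bar>" for t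
      using that zy by (auto simp: dist_real_def)
    have "norm (g y - g 0) \<le> (2 * B * \<bar>y\<bar>) * norm (y - 0)"
    proof (rule field_differentiable_bound[OF convex_cball, of 0 "\<bar>y\<bar>" g "\<lambda>t. f' (z + t) - f' (z - t)"])
      fix t :: real assume t: "t \<in> cball 0 \<bar>y\<bar>"
      have "(f has_real_derivative f' (z + t)) (at (z + t))" "(f has_real_derivative f' (z - t)) (at (z - t))"
        using mem[OF t] by (blast intro: f inU)+
      then have "(g has_real_derivative (f' (z + t) - f' (z - t))) (at t)"
        unfolding g_def by (auto intro!: derivative_eq_intros DERIV_chain2[of f "f' (z + t)"] DERIV_chain2[of f "f' (z - t)"])
      then show "(g has_real_derivative (f' (z + t) - f' (z - t))) (at t within cball 0 \<bar>y\<bar>)"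
        by (rule has_field_derivative_at_within)
      have "norm (f' (z + t) - f' (z - t)) \<le> B * norm ((z + t) - (z - t))"
        using mem[OF t] by (intro lip') auto
      also have "\<dots> = 2 * B * \<bar>t\<bar>" by (simp add: abs_mult)
      also have "\<dots> \<le> 2 * B * \<bar>y\<bar>" using t by (intro mult_left_mono) (auto simp: B_def)
      finally show "norm (f' (z + t) - f' (z - t)) \<le> 2 * B * \<bar>y\<bar>" .
    qed auto
    then show "norm (f (z + y) + f (z - y) - 2 *\<^sub>R f z) \<le> 2 * B * (norm y)\<^sup>2"
      by (simp add: g_def power2_eq_square mult.assoc)
  qed
  then show ?thesis using r by (auto simp: c11_at_def)
qed

lemma c11_at_sin: "c11_at f x \<Longrightarrow> c11_at (\<lambda>x. sin (f x :: real)) x"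
  by (erule c11_at_compose, rule c11_at_real_C2[where U=UNIV and f'=cos and f''="\<lambda>x. - sin x"])
    (auto intro!: derivative_eq_intros continuous_intros)

lemma c11_at_cos: "c11_at f x \<Longrightarrow> c11_at (\<lambda>x. cos (f x :: real)) x"
  by (erule c11_at_compose, rule c11_at_real_C2[where U=UNIV and f'="\<lambda>x. - sin x" and f''="\<lambda>x. - cos x"])
    (auto intro!: derivative_eq_intros continuous_intros)

lemma c11_at_inverse: "c11_at f x \<Longrightarrow> f x \<noteq> 0 \<Longrightarrow> c11_at (\<lambda>x. inverse (f x :: real)) x"
  by (erule c11_at_compose, rule c11_at_real_C2[where U="-{0}" and f'="\<lambda>x. - inverse (x\<^sup>2)" and f''="\<lambda>x. 2 * inverse (x^3)"])
    (auto intro!: derivative_eq_intros continuous_intros simp: field_simps power2_eq_square power3_eq_cube)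

lemma c11_at_arccos:
  assumes "c11_at f x" "- 1 < f x" "f x < 1" shows "c11_at (\<lambda>x. arccos (f x)) x"
proof (rule c11_at_compose[OF assms(1)], rule c11_at_real_C2[where U="{-1<..<1}"])
  fix y :: real assume y: "y \<in> {-1<..<1}"
  then show "(arccos has_real_derivative inverse (- sqrt (1 - y\<^sup>2))) (at y)"
    using DERIV_arccos[of y] by simp
  have "y\<^sup>2 < 1" using y by (simp add: abs_square_less_1 abs_less_iff)
  then show "((\<lambda>y. inverse (- sqrt (1 - y\<^sup>2))) has_real_derivative
      - y * (inverse (sqrt (1 - y\<^sup>2)))^3) (at y)"
    by (auto intro!: derivative_eq_intros simp: field_simps power2_eq_square power3_eq_cube)
next
  have "(f x)\<^sup>2 < 1" using assms by (simp add: abs_square_less_1 abs_less_iff)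
  then show "isCont (\<lambda>y. - y * (inverse (sqrt (1 - y\<^sup>2)))^3) (f x)"
    by (auto intro!: continuous_intros)
qed (use assms in auto)

text \<open>The squared positive part has a Lipschitz derivative although it is not twice
  differentiable at 0. All cutoffs come from it: it joins a nonzero function to 0 within the
  class.\<close>

lemma c11_at_max0_square:
  assumes "c11_at f x" shows "c11_at (\<lambda>x. (max 0 (f x :: real))\<^sup>2) x"
proof (rule c11_at_compose[OF assms, of "\<lambda>s. (max 0 s)\<^sup>2"])
  have sq: "(max 0 (z + y))\<^sup>2 + (max 0 (z - y))\<^sup>2 - 2 * (max 0 z)\<^sup>2 \<le> 4 * y\<^sup>2 \<and>
      - (4 * y\<^sup>2) \<le> (max 0 (z + y))\<^sup>2 + (max 0 (z - y))\<^sup>2 - 2 * (max 0 z)\<^sup>2"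
    if y: "y \<ge> 0" for z y :: real
  proof -
    consider "z \<ge> y" | "0 \<le> z" "z < y" | "z < 0" "- y \<le> z" | "z < - y" by linarith
    then show ?thesis
    proof cases
      case 1
      then show ?thesis using y by (simp add: max_def) (auto simp: power2_eq_square algebra_simps)
    next
      case 2
      then have "(z + y)\<^sup>2 \<le> (2 * y)\<^sup>2" "z\<^sup>2 \<le> y\<^sup>2" using y by (intro power_mono; simp)+
      moreover have "(2 * y)\<^sup>2 = 4 * y\<^sup>2" by (simp add: power_mult_distrib)
      moreover have e: "max 0 (z + y) = z + y" "max 0 (z - y) = 0" "max 0 z = z" using 2 y by auto
      ultimately show ?thesis unfolding e power_zero_numeral
        using zero_le_power2[of z] zero_le_power2[of "z + y"] zero_le_power2[of y] by linarith
    next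
      case 3
      then have "(z + y)\<^sup>2 \<le> y\<^sup>2" using y by (intro power_mono) auto
      moreover have e: "max 0 (z + y) = z + y" "max 0 (z - y) = 0" "max 0 z = 0" using 3 y by auto
      ultimately show ?thesis unfolding e power_zero_numeral
        using zero_le_power2[of "z + y"] zero_le_power2[of y] by linarith
    qed (use y in \<open>auto simp: max_def\<close>)
  qed
  have "c11_on (ball (f x) 1) (\<lambda>s. (max 0 s)\<^sup>2)"
  proof (rule c11_onI[of _ _ "2 * (\<bar>f x\<bar> + 1)" 4])
    fix a b assume ab: "a \<in> ball (f x) 1" "b \<in> ball (f x) 1"
    have "(max 0 a)\<^sup>2 - (max 0 b)\<^sup>2 = (max 0 a + max 0 b) * (max 0 a - max 0 b)"
      by (simp add: algebra_simps power2_eq_square)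
    then have "norm ((max 0 a)\<^sup>2 - (max 0 b)\<^sup>2) = \<bar>max 0 a + max 0 b\<bar> * \<bar>max 0 a - max 0 b\<bar>"
      by (simp add: abs_mult)
    also have "\<dots> \<le> (2 * (\<bar>f x\<bar> + 1)) * \<bar>a - b\<bar>"
      using ab by (intro mult_mono) (auto simp: dist_real_def)
    finally show "norm ((max 0 a)\<^sup>2 - (max 0 b)\<^sup>2) \<le> 2 * (\<bar>f x\<bar> + 1) * norm (a - b)" by simp
  next
    fix z y :: real
    show "norm ((max 0 (z + y))\<^sup>2 + (max 0 (z - y))\<^sup>2 - 2 *\<^sub>R (max 0 z)\<^sup>2) \<le> 4 * (norm y)\<^sup>2"
      using sq[of y z] sq[of "-y" z] by (cases "y \<ge> 0") (auto simp: abs_le_iff algebra_simps)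
  qed
  then show "c11_at (\<lambda>s. (max 0 s)\<^sup>2) (f x)" unfolding c11_at_def by (intro exI[of _ 1]) auto
qed

lemmas c11_at_intros = c11_at_const c11_at_id c11_at_add c11_at_diff c11_at_uminus c11_at_mult
  c11_at_scaleR c11_at_Pair c11_at_fst c11_at_snd c11_at_inner c11_at_sin c11_at_cos c11_at_max0_square

text \<open>A Lebesgue number \<delta> of a finite cover separates two cases. Shorter increments
  stay in one ball of the cover, where the local constants apply; for longer ones the bound M on F
  suffices, since then \<open>1 \<le> norm y / \<delta>\<close>.\<close>

theorem c11_on_UNIV_compact_support:
  fixes F :: "'a::euclidean_space \<Rightarrow> 'b::real_normed_vector"
  assumes F: "\<And>x. c11_at F x" and S: "compact S" and zero: "\<And>x. x \<notin> S \<Longrightarrow> F x = 0"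
  shows "c11_on UNIV F" "bounded (range F)"
proof -
  \<comment> \<open>The closed unit neighbourhood of S: from a point outside it, increments of
    length at most 1 never reach S, so F vanishes at all points involved.\<close>
  define S' where "S' = {x + y |x y. x \<in> S \<and> y \<in> cball 0 1}"
  have S': "compact S'" unfolding S'_def by (rule compact_sums[OF S compact_cball])
  have near: "x + y \<notin> S \<and> x - y \<notin> S \<and> x \<notin> S" if "x \<notin> S'" "norm y \<le> 1" for x y
  proof -
    have "x + v \<notin> S" if "norm v \<le> 1" for v
    proof
      assume "x + v \<in> S"
      then have "(x + v) + (- v) \<in> S'" unfolding S'_def using \<open>norm v \<le> 1\<close> by (blast intro: mem_cball_0[THEN iffD2] norm_minus_cancel[THEN ord_eq_le_trans])
      then show False using \<open>x \<notin> S'\<close> by simp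
    qed
    from this[of y] this[of "-y"] this[of 0] that show ?thesis by simp
  qed
  obtain r C where r: "\<And>x. r x > 0"
    and C: "\<And>x. C x \<ge> (0::real)" "\<And>x a b. a \<in> ball x (r x) \<Longrightarrow> b \<in> ball x (r x) \<Longrightarrow> norm (F a - F b) \<le> C x * norm (a - b)"
    "\<And>x z y. z \<in> ball x (r x) \<Longrightarrow> z + y \<in> ball x (r x) \<Longrightarrow> z - y \<in> ball x (r x) \<Longrightarrow>
      norm (F (z + y) + F (z - y) - 2 *\<^sub>R F z) \<le> C x * (norm y)\<^sup>2"
    using F unfolding c11_at_def c11_on_def by metis
  obtain T where T: "T \<subseteq> S'" "finite T" "S' \<subseteq> (\<Union>x\<in>T. ball x (r x))"
    by (rule compactE_image[OF S', of S' "\<lambda>x. ball x (r x)"]) (use r in auto)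
  obtain \<delta>' where \<delta>': "0 < \<delta>'" "\<And>x. x \<in> S' \<Longrightarrow> \<exists>G\<in>(\<lambda>x. ball x (r x)) ` T. ball x \<delta>' \<subseteq> G"
    by (rule Heine_Borel_lemma[OF S' T(3)]) auto
  define \<delta> where "\<delta> = min \<delta>' 1"
  have \<delta>: "\<delta> > 0" "\<delta> \<le> 1" "\<And>x. x \<in> S' \<Longrightarrow> \<exists>u\<in>T. ball x \<delta> \<subseteq> ball u (r u)"
    using \<delta>' by (auto simp: \<delta>_def subset_iff) (metis)
  define D where "D = (\<Sum>x\<in>T. C x)"
  have CD: "C x \<le> D" if "x \<in> T" for x unfolding D_def using that T C by (intro member_le_sum) auto
  have D0: "D \<ge> 0" unfolding D_def by (intro sum_nonneg C)
  have cont: "continuous_on UNIV F" using F by (auto simp: continuous_on_eq_continuous_at intro: c11_at_imp_isCont)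
  have "bounded (F ` S)" by (intro compact_imp_bounded compact_continuous_image S continuous_on_subset[OF cont]) auto
  then obtain M where M: "M > 0" "\<And>x. x \<in> S \<Longrightarrow> norm (F x) \<le> M" by (auto simp: bounded_pos)
  then have M': "norm (F x) \<le> M" for x using zero by (cases "x \<in> S") auto
  then show "bounded (range F)" by (auto simp: bounded_iff)
  have lip: "norm (F a - F b) \<le> (D + 2 * M / \<delta>) * norm (a - b)" if aS: "a \<in> S'" for a b
  proof (cases "dist a b < \<delta>")
    case True
    obtain u where u: "u \<in> T" "ball a \<delta> \<subseteq> ball u (r u)" using \<delta> aS by blast
    have "norm (F a - F b) \<le> C u * norm (a - b)" using True \<delta> by (intro C(2) subsetD[OF u(2)]) auto
    also have "\<dots> \<le> (D + 2 * M / \<delta>) * norm (a - b)"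
      using CD[OF u(1)] M \<delta> by (intro mult_right_mono) (auto intro: add_increasing2)
    finally show ?thesis .
  next
    case False
    have "norm (F a - F b) \<le> 2 * M" using M'[of a] M'[of b] norm_triangle_ineq4[of "F a" "F b"] by simp
    also have "\<dots> \<le> 2 * M / \<delta> * norm (a - b)" using False M \<delta> by (simp add: field_simps dist_norm)
    also have "\<dots> \<le> (D + 2 * M / \<delta>) * norm (a - b)" using D0 by (intro mult_right_mono) auto
    finally show ?thesis .
  qed
  have SS': "x \<in> S'" if "x \<in> S" for x using near[of x 0] that by auto
  show "c11_on UNIV F"
  proof (rule c11_onI[of _ _ "D + 2 * M / \<delta>" "D + 4 * M / \<delta>\<^sup>2"])
    fix a b
    show "norm (F a - F b) \<le> (D + 2 * M / \<delta>) * norm (a - b)"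
    proof (cases "a \<in> S' \<or> b \<in> S'")
      case True
      then show ?thesis using lip[of a b] lip[of b a] by (auto simp: norm_minus_commute)
    next
      case False
      then have "F a = 0" "F b = 0" using SS' zero by blast+
      then show ?thesis using D0 M \<delta> by simp
    qed
  next
    fix z y
    show "norm (F (z + y) + F (z - y) - 2 *\<^sub>R F z) \<le> (D + 4 * M / \<delta>\<^sup>2) * (norm y)\<^sup>2"
    proof (cases "norm y < \<delta>")
      case True
      show ?thesis
      proof (cases "z \<in> S'")
        case z: True
        obtain u where u: "u \<in> T" "ball z \<delta> \<subseteq> ball u (r u)" using \<delta> z by blast
        have "norm (F (z + y) + F (z - y) - 2 *\<^sub>R F z) \<le> C u * (norm y)\<^sup>2"
          using True \<delta> by (intro C(3) subsetD[OF u(2)]) (auto simp: dist_norm)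
        also have "\<dots> \<le> (D + 4 * M / \<delta>\<^sup>2) * (norm y)\<^sup>2"
          using CD[OF u(1)] M \<delta> by (intro mult_right_mono) (auto intro: add_increasing2)
        finally show ?thesis .
      next
        case False
        then have "F z = 0" "F (z + y) = 0" "F (z - y) = 0" using near[of z y] True \<delta> zero by auto
        then show ?thesis using D0 M \<delta> by simp
      qed
    next
      case False
      have "norm (F (z + y) + F (z - y) - 2 *\<^sub>R F z) \<le> norm (F (z + y)) + norm (F (z - y)) + norm (2 *\<^sub>R F z)"
        by (rule order_trans[OF norm_triangle_ineq4 add_right_mono[OF norm_triangle_ineq]])
      also have "\<dots> \<le> 4 * M" using M'[of "z + y"] M'[of "z - y"] M'[of z] by simp
      also have "\<dots> \<le> 4 * M / \<delta>\<^sup>2 * (norm y)\<^sup>2"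
      proof -
        have "\<delta>\<^sup>2 \<le> (norm y)\<^sup>2" using False \<delta> by (intro power_mono) auto
        then have "4 * M * \<delta>\<^sup>2 \<le> 4 * M * (norm y)\<^sup>2" using M by (intro mult_left_mono) auto
        then show ?thesis using \<delta> by (simp add: field_simps)
      qed
      also have "\<dots> \<le> (D + 4 * M / \<delta>\<^sup>2) * (norm y)\<^sup>2" using D0 by (intro mult_right_mono) auto
      finally show ?thesis .
    qed
  qed
qed

section \<open>Cutoff functions\<close>

definition smooth_step :: "real \<Rightarrow> real" where "smooth_step s = 1 - (max 0 (1 - s))\<^sup>2"

lemma smooth_step_simps: "smooth_step 0 = 0" "s \<ge> 1 \<Longrightarrow> smooth_step s = 1" "s \<ge> 0 \<Longrightarrow> 0 \<le> smooth_step s" "smooth_step s \<le> 1"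
  by (auto simp: smooth_step_def max_def abs_square_le_1)

lemma smooth_step_mono: "s \<le> t \<Longrightarrow> smooth_step s \<le> smooth_step t"
  unfolding smooth_step_def by (intro diff_left_mono power_mono max.mono) auto

lemma c11_at_smooth_step: "c11_at f x \<Longrightarrow> c11_at (\<lambda>x. smooth_step (f x)) x"
  unfolding smooth_step_def by (intro c11_at_intros)

text \<open>The sum B of squared paraboloid caps over a finite cover is positive on K, hence at
  least some m > 0 there. Applying \<open>smooth_step\<close> to \<open>2 / m * B\<close> flattens
  it to 1 on the open set where B exceeds m / 2, a neighbourhood of K.\<close>

theorem c11_bump:
  fixes K :: "'a::euclidean_space set"
  assumes K: "compact K" and U: "open U" "K \<subseteq> U"
  obtains \<beta> :: "'a \<Rightarrow> real" and O' S where "\<And>x. c11_at \<beta> x" "\<And>x. 0 \<le> \<beta> x" "\<And>x. \<beta> x \<le> 1"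
    "open O'" "K \<subseteq> O'" "\<And>x. x \<in> O' \<Longrightarrow> \<beta> x = 1" "compact S" "S \<subseteq> U" "\<And>x. x \<notin> S \<Longrightarrow> \<beta> x = 0"
proof -
  obtain e where e: "e > 0" "(\<Union>x\<in>K. ball x e) \<subseteq> U" by (rule compact_subset_open_imp_ball_epsilon_subset[OF K U])
  define r where "r = e / 2"
  have r: "r > 0" using e by (simp add: r_def)
  obtain T where T: "T \<subseteq> K" "finite T" "K \<subseteq> (\<Union>x\<in>T. ball x r)"
    by (rule compactE_image[OF K, of K "\<lambda>x. ball x r"]) (use r in auto)
  define b :: "'a \<Rightarrow> 'a \<Rightarrow> real" where "b = (\<lambda>c x. (max 0 (r\<^sup>2 - (x - c) \<bullet> (x - c)))\<^sup>2)"
  define B where "B = (\<lambda>x. \<Sum>c\<in>T. b c x)"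
  have cB: "c11_at B x" for x
    unfolding B_def b_def by (intro c11_at_sum T c11_at_intros)
  have b0: "b c x \<ge> 0" for c x by (simp add: b_def)
  have bpos: "b c x > 0 \<longleftrightarrow> x \<in> ball c r" for c x
  proof -
    have "(x - c) \<bullet> (x - c) = (dist c x)\<^sup>2" by (metis dist_commute dist_norm power2_norm_eq_inner)
    moreover have "(dist c x)\<^sup>2 < r\<^sup>2 \<longleftrightarrow> dist c x < r"
      using r by (auto intro: power_less_imp_less_base power_strict_mono)
    ultimately show ?thesis by (auto simp: b_def max_def)
  qed
  have contB: "continuous_on UNIV B" using cB by (auto simp: continuous_on_eq_continuous_at intro: c11_at_imp_isCont)
  have Bpos: "B x > 0" if xK: "x \<in> K" for x
  proof -
    obtain c where "c \<in> T" "x \<in> ball c r" using T xK by blast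
    then show ?thesis unfolding B_def using bpos by (intro sum_pos2[OF T(2)]) (auto intro: b0)
  qed
  obtain m where m: "m > 0" "\<And>x. x \<in> K \<Longrightarrow> B x \<ge> m"
  proof (cases "K = {}")
    case False
    obtain x where "x \<in> K" "\<And>y. y \<in> K \<Longrightarrow> B x \<le> B y"
      using continuous_attains_inf[OF K False continuous_on_subset[OF contB subset_UNIV]] by blast
    then show ?thesis using Bpos that[of "B x"] by auto
  qed (use that[of 1] in auto)
  have B0: "B x \<ge> 0" for x unfolding B_def by (intro sum_nonneg b0)
  show ?thesis
  proof (rule that[of "\<lambda>x. smooth_step (2 / m * B x)" "{x. m / 2 < B x}" "\<Union>c\<in>T. cball c r"])
    show "c11_at (\<lambda>x. smooth_step (2 / m * B x)) x" for x by (intro c11_at_smooth_step c11_at_intros cB)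
    show "0 \<le> smooth_step (2 / m * B x)" for x using B0[of x] m by (intro smooth_step_simps) auto
    show "smooth_step (2 / m * B x) \<le> 1" for x by (rule smooth_step_simps)
    show "open {x. m / 2 < B x}" by (intro open_Collect_less continuous_intros contB)
    show "K \<subseteq> {x. m / 2 < B x}" using m by force
    show "smooth_step (2 / m * B x) = 1" if "x \<in> {x. m / 2 < B x}" for x
      using that m by (intro smooth_step_simps) (auto simp: field_simps)
    show "compact (\<Union>c\<in>T. cball c r)" using T by (intro compact_UN) auto
    show "(\<Union>c\<in>T. cball c r) \<subseteq> U" using e T unfolding r_def by (fastforce simp: subset_iff)
    show "smooth_step (2 / m * B x) = 0" if "x \<notin> (\<Union>c\<in>T. cball c r)" for x
    proof -
      have "b c x = 0" if "c \<in> T" for c using bpos[of c x] b0[of c x] that \<open>x \<notin> _\<close> by force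
      then show ?thesis by (simp add: B_def smooth_step_simps)
    qed
  qed
qed

section \<open>Gradients from bounded second differences\<close>

lemma bounded_additive_homogeneous:
  fixes f :: "'a::real_normed_vector \<Rightarrow> real"
  assumes add: "\<And>x y. f (x + y) = f x + f y" and bd: "\<And>x. \<bar>f x\<bar> \<le> k * norm x" 
  shows "f (c *\<^sub>R y) = c * f y"
proof -
  \<comment> \<open>The defect g of homogeneity along y is additive and vanishes on the integers, so
    its values are those on fractional parts and it is bounded. Since
    \<open>g (n * c) = n * g c\<close> for natural n, it must be zero.\<close>
  define g where "g = (\<lambda>c. f (c *\<^sub>R y) - c * f y)"
  have gadd: "g (a + b) = g a + g b" for a b by (simp add: g_def scaleR_add_left add algebra_simps)
  have gnat: "g (of_nat n * a) = of_nat n * g a" for n a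
  proof (induction n)
    case 0
    then show ?case using gadd[of 0 0] by simp
  next
    case (Suc n)
    then show ?case using gadd[of a "of_nat n * a"] by (simp add: algebra_simps)
  qed
  have g1: "g 1 = 0" by (simp add: g_def)
  have gneg: "g (- a) = - g a" for a using gadd[of a "-a"] gadd[of 0 0] by simp
  have gint: "g (of_int m) = 0" for m
    using gnat[of _ 1] g1 gneg by (cases m rule: int_cases2) auto
  have gb: "\<bar>g a\<bar> \<le> 2 * \<bar>k\<bar> * norm y" for a
  proof -
    have "g a = g (frac a)" using gadd[of "of_int \<lfloor>a\<rfloor>" "frac a"] gint by (simp add: frac_def)
    moreover have "\<bar>f (frac a *\<^sub>R y)\<bar> \<le> \<bar>k\<bar> * norm y"
    proof -
      have "\<bar>f (frac a *\<^sub>R y)\<bar> \<le> k * (frac a * norm y)" using bd[of "frac a *\<^sub>R y"] by (simp add: frac_ge_0)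
      also have "\<dots> \<le> \<bar>k\<bar> * (1 * norm y)"
        using frac_lt_1[of a] by (intro mult_mono mult_right_mono) (auto simp: frac_ge_0)
      finally show ?thesis by simp
    qed
    moreover have "\<bar>frac a * f y\<bar> \<le> 1 * (\<bar>k\<bar> * norm y)"
    proof -
      have "\<bar>f y\<bar> \<le> \<bar>k\<bar> * norm y" using bd[of y] by (rule order_trans) (auto intro: mult_right_mono)
      then show ?thesis unfolding abs_mult using frac_lt_1[of a] frac_ge_0[of a] by (intro mult_mono) auto
    qed
    ultimately show ?thesis unfolding g_def by linarith
  qed
  have "g c = 0"
  proof (rule ccontr)
    assume ne: "g c \<noteq> 0"
    obtain n :: nat where "2 * \<bar>k\<bar> * norm y / \<bar>g c\<bar> < of_nat n" using reals_Archimedean2 by blast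
    then have "2 * \<bar>k\<bar> * norm y < of_nat n * \<bar>g c\<bar>" using ne by (simp add: field_simps)
    then show False using gb[of "of_nat n * c"] by (simp add: gnat abs_mult)
  qed
  then show ?thesis by (simp add: g_def)
qed

text \<open>The dyadic difference quotients form a Cauchy sequence because consecutive ones differ by a
  second difference.\<close>

theorem gradient_from_second_difference:
  fixes V :: "'a::euclidean_space \<Rightarrow> real"
  assumes lip: "\<And>a b. \<bar>V a - V b\<bar> \<le> k * norm (a - b)"
    and sd: "\<And>z y. \<bar>V (z + y) + V (z - y) - 2 * V z\<bar> \<le> C * (norm y)\<^sup>2"
  obtains p where "\<And>x. GDERIV V x :> p x" "\<And>x. norm (p x) \<le> k" "continuous_on UNIV p"
proof -
  have C: "C * (norm (y::'a))\<^sup>2 \<ge> 0" for y using sd[of 0 y] by linarith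
  have C0: "C \<ge> 0" using C[of "SOME b. b \<in> Basis"] by (metis SOME_Basis norm_Basis mult.right_neutral power_one)
  \<comment> \<open>Both diagonals of the parallelogram have the midpoint m, with halves w and w'.
    Subtracting the two second differences at m cancels \<open>V m\<close>, and the parallelogram
    law evaluates the error.\<close>
  have four: "\<bar>V (x + (y + z)) + V x - V (x + y) - V (x + z)\<bar> \<le> C * ((norm y)\<^sup>2 + (norm z)\<^sup>2)" for x y z
  proof -
    define m w w' where "m = x + (1/2) *\<^sub>R (y + z)" and "w = (1/2) *\<^sub>R (y + z)" and "w' = (1/2) *\<^sub>R (y - z)"
    have half: "(1/2) *\<^sub>R a + (1/2) *\<^sub>R a = a" for a :: 'a by (metis scaleR_half_double scaleR_add_right)
    have e: "m + w = x + (y + z)" "m - w = x" "m + w' = x + y" "m - w' = x + z"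
      unfolding m_def w_def w'_def using half[of y] half[of z] by (auto simp: algebra_simps)
    have n: "(norm w)\<^sup>2 + (norm w')\<^sup>2 = ((norm y)\<^sup>2 + (norm z)\<^sup>2) / 2"
      unfolding w_def w'_def by (simp add: power2_norm_eq_inner algebra_simps inner_commute)
    have "\<bar>(V (m + w) + V (m - w) - 2 * V m) - (V (m + w') + V (m - w') - 2 * V m)\<bar> \<le> C * (norm w)\<^sup>2 + C * (norm w')\<^sup>2"
      using sd[of m w] sd[of m w'] by linarith
    also have "\<dots> = C * (((norm y)\<^sup>2 + (norm z)\<^sup>2) / 2)" by (simp add: n flip: distrib_left)
    also have "\<dots> \<le> C * ((norm y)\<^sup>2 + (norm z)\<^sup>2)" using C0 by (intro mult_left_mono) auto
    finally show ?thesis unfolding e by (simp add: algebra_simps)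
  qed
  define d :: "nat \<Rightarrow> real" where "d = (\<lambda>n. (1/2)^n)"
  define q where "q = (\<lambda>x y n. (V (x + d n *\<^sub>R y) - V x) / d n)"
  have d: "d n > 0" "d (Suc n) = d n / 2" "d 0 = 1" for n by (auto simp: d_def)
  have dlim: "d \<longlonglongrightarrow> 0" unfolding d_def by (rule LIMSEQ_realpow_zero) auto
  have step: "\<bar>q x y (Suc n) - q x y n\<bar> \<le> C * (norm y)\<^sup>2 * (d (Suc n))" for x y n
  proof -
    let ?e = "d n / 2"
    have "q x y (Suc n) - q x y n = - (V ((x + ?e *\<^sub>R y) + ?e *\<^sub>R y) + V ((x + ?e *\<^sub>R y) - ?e *\<^sub>R y) - 2 * V (x + ?e *\<^sub>R y)) / d n"
      using d(1)[of n] by (simp add: q_def d(2) field_simps flip: scaleR_add_left)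
    then have "\<bar>q x y (Suc n) - q x y n\<bar> \<le> C * (norm (?e *\<^sub>R y))\<^sup>2 / d n"
      using sd[of "x + ?e *\<^sub>R y" "?e *\<^sub>R y"] d(1)[of n] by (simp add: divide_right_mono)
    also have "\<dots> = C * (norm y)\<^sup>2 * (d n / 4)" using d(1)[of n] by (simp add: power2_eq_square field_simps)
    also have "\<dots> \<le> C * (norm y)\<^sup>2 * (d (Suc n))" using d(1)[of n] C[of y] unfolding d(2) by (intro mult_left_mono) auto
    finally show ?thesis .
  qed
  have sumd: "(\<lambda>n. C * (norm y)\<^sup>2 * d (Suc n)) sums (C * (norm y)\<^sup>2 * 1)" for y :: 'a
    unfolding d_def by (intro sums_mult power_half_series)
  define L where "L = (\<lambda>x y. lim (q x y))"
  have conv: "summable (\<lambda>n. q x y (Suc n) - q x y n)" for x y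
    by (rule summable_comparison_test'[OF sums_summable[OF sumd], of 0]) (use step in auto)
  have qL: "q x y \<longlonglongrightarrow> L x y" for x y
    unfolding L_def using conv[of x y] telescope_summable' convergent_LIMSEQ_iff
  proof -
    have "(\<lambda>n. \<Sum>i<n. q x y (Suc i) - q x y i) \<longlonglongrightarrow> (\<Sum>i. q x y (Suc i) - q x y i)"
      using conv by (rule summable_LIMSEQ)
    then have "(\<lambda>n. (q x y n - q x y 0) + q x y 0) \<longlonglongrightarrow> (\<Sum>i. q x y (Suc i) - q x y i) + q x y 0"
      by (intro tendsto_add tendsto_const) (simp add: sum_lessThan_telescope)
    then show "q x y \<longlonglongrightarrow> lim (q x y)" by (simp add: convergent_def convergent_LIMSEQ_iff[symmetric]) blast
  qed
  \<comment> \<open>Summing the telescoping series from index 0, where \<open>d 0 = 1\<close>,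
    compares \<open>L x y\<close> with the undivided difference \<open>V (x + y) - V x\<close>: a
    Taylor estimate with quadratic remainder.\<close>
  have quad: "\<bar>V (x + y) - V x - L x y\<bar> \<le> C * (norm y)\<^sup>2" for x y
  proof -
    have "\<bar>q x y n - q x y 0\<bar> \<le> C * (norm y)\<^sup>2" for n
    proof -
      have "\<bar>q x y n - q x y 0\<bar> = \<bar>\<Sum>i<n. q x y (Suc i) - q x y i\<bar>" by (simp add: sum_lessThan_telescope)
      also have "\<dots> \<le> (\<Sum>i<n. C * (norm y)\<^sup>2 * d (Suc i))" by (intro order_trans[OF sum_abs] sum_mono step)
      also have "\<dots> \<le> C * (norm y)\<^sup>2 * 1"
        using C[of y] d(1) by (intro sum_le_suminf[OF sums_summable[OF sumd], unfolded sums_unique[OF sumd, symmetric]]) (auto simp: less_imp_le)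
      finally show ?thesis by simp
    qed
    then have "\<bar>L x y - q x y 0\<bar> \<le> C * (norm y)\<^sup>2"
      by (intro tendsto_upperbound[OF tendsto_rabs[OF tendsto_diff[OF qL tendsto_const]]]) auto
    then show ?thesis by (simp add: q_def d abs_minus_commute)
  qed
  have Lbd: "\<bar>L x y\<bar> \<le> k * norm y" for x y
  proof (rule tendsto_upperbound[OF tendsto_rabs[OF qL]])
    have "\<bar>q x y n\<bar> \<le> k * norm y" for n
      using lip[of "x + d n *\<^sub>R y" x] d(1)[of n] by (simp add: q_def field_simps)
    then show "\<forall>\<^sub>F n in sequentially. \<bar>q x y n\<bar> \<le> k * norm y" by simp
  qed auto
  have Ladd: "L x (y + z) = L x y + L x z" for x y z
  proof -
    have "(\<lambda>n. q x (y + z) n - q x y n - q x z n) \<longlonglongrightarrow> L x (y + z) - L x y - L x z"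
      by (intro tendsto_diff qL)
    moreover have "(\<lambda>n. q x (y + z) n - q x y n - q x z n) \<longlonglongrightarrow> 0"
    proof (rule Lim_null_comparison)
      show "\<forall>\<^sub>F n in sequentially. norm (q x (y + z) n - q x y n - q x z n) \<le> C * ((norm y)\<^sup>2 + (norm z)\<^sup>2) * d n"
      proof (rule always_eventually, rule allI)
        fix n
        have "q x (y + z) n - q x y n - q x z n =
          (V (x + (d n *\<^sub>R y + d n *\<^sub>R z)) + V x - V (x + d n *\<^sub>R y) - V (x + d n *\<^sub>R z)) / d n"
          using d(1)[of n] by (simp add: q_def field_simps scaleR_add_right)
        then have "norm (q x (y + z) n - q x y n - q x z n) \<le> C * ((norm (d n *\<^sub>R y))\<^sup>2 + (norm (d n *\<^sub>R z))\<^sup>2) / d n"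
          using four[of x "d n *\<^sub>R y" "d n *\<^sub>R z"] d(1)[of n] by (simp add: divide_right_mono)
        also have "\<dots> = C * ((norm y)\<^sup>2 + (norm z)\<^sup>2) * d n"
          using d(1)[of n] by (simp add: power2_eq_square field_simps)
        finally show "norm (q x (y + z) n - q x y n - q x z n) \<le> C * ((norm y)\<^sup>2 + (norm z)\<^sup>2) * d n" .
      qed
      show "(\<lambda>n. C * ((norm y)\<^sup>2 + (norm z)\<^sup>2) * d n) \<longlonglongrightarrow> 0" using dlim by (rule tendsto_mult_right_zero)
    qed
    ultimately show ?thesis using LIMSEQ_unique by fastforce
  qed
  have lin: "linear (L x)" for x
    by (rule linearI) (auto simp: Ladd bounded_additive_homogeneous[of "L x", OF Ladd Lbd])
  define p where "p = (\<lambda>x. \<Sum>b\<in>Basis. L x b *\<^sub>R b)"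
  have Lp: "L x y = y \<bullet> p x" for x y
  proof -
    have "L x y = L x (\<Sum>b\<in>Basis. (y \<bullet> b) *\<^sub>R b)" by (simp add: euclidean_representation)
    also have "\<dots> = (\<Sum>b\<in>Basis. (y \<bullet> b) * L x b)"
      by (simp only: linear_sum[OF lin] linear_cmul[OF lin] real_scaleR_def)
    also have "\<dots> = y \<bullet> p x" by (simp add: p_def inner_sum_right mult.commute)
    finally show ?thesis .
  qed
  have 1: "GDERIV V x :> p x" for x
    unfolding gderiv_def has_derivative_at_alt
  proof (intro conjI allI impI)
    show "bounded_linear (\<lambda>h. h \<bullet> p x)" by (rule bounded_linear_inner_left)
    fix e :: real assume e: "0 < e"
    show "\<exists>dd>0. \<forall>y. norm (y - x) < dd \<longrightarrow> norm (V y - V x - (y - x) \<bullet> p x) \<le> e * norm (y - x)"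
    proof (intro exI[of _ "e / (C + 1)"] conjI allI impI)
      show "e / (C + 1) > 0" using e C0 by simp
      fix y assume y: "norm (y - x) < e / (C + 1)"
      have "norm (V y - V x - (y - x) \<bullet> p x) \<le> C * (norm (y - x))\<^sup>2"
        using quad[of x "y - x"] by (simp add: Lp)
      also have "\<dots> \<le> (C + 1) * norm (y - x) * norm (y - x)" by (simp add: power2_eq_square algebra_simps)
      also have "\<dots> \<le> e * norm (y - x)" using y C0 by (intro mult_right_mono) (auto simp: field_simps)
      finally show "norm (V y - V x - (y - x) \<bullet> p x) \<le> e * norm (y - x)" .
    qed
  qed
  have k0: "k \<ge> 0" using lip[of "SOME b. b \<in> Basis" 0] by (simp add: SOME_Basis)
  have 2: "norm (p x) \<le> k" for x
  proof (cases "p x = 0")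
    case False
    have "norm (p x) * norm (p x) \<le> k * norm (p x)"
      using Lbd[of x "p x"] by (simp add: Lp power2_norm_eq_inner[symmetric] power2_eq_square)
    then show ?thesis using False by simp
  qed (use k0 in simp)
  \<comment> \<open>Test the difference of the two linear maps on a vector u parallel to
    \<open>p x - p x'\<close> and as long as \<open>x - x'\<close>. Two Taylor remainders and one
    parallelogram term are then all of order \<open>s\<^sup>2\<close>, and dividing by s gives the
    Lipschitz bound.\<close>
  have "norm (p x - p x') \<le> 4 * C * norm (x - x')" for x x'
  proof (cases "x = x' \<or> p x = p x'")
    case False
    define s where "s = norm (x - x')"
    define u where "u = (s / norm (p x - p x')) *\<^sub>R (p x - p x')"
    have s: "s > 0" using False by (simp add: s_def)
    have u: "norm u = s" using False s by (simp add: u_def)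
    have "\<bar>L x u - L x' u\<bar> \<le> \<bar>V (x + u) - V x - L x u\<bar> + \<bar>V (x' + u) - V x' - L x' u\<bar>
       + \<bar>V (x + ((x' - x) + u)) + V x - V (x + (x' - x)) - V (x + u)\<bar>" by simp
    also have "\<dots> \<le> C * s\<^sup>2 + C * s\<^sup>2 + C * (s\<^sup>2 + s\<^sup>2)"
      using quad[of x u] quad[of x' u] four[of x "x' - x" u] by (simp add: u s_def norm_minus_commute)
    finally have "\<bar>L x u - L x' u\<bar> \<le> 4 * C * s\<^sup>2" by simp
    moreover have "L x u - L x' u = u \<bullet> (p x - p x')" by (simp add: Lp inner_diff_right)
    moreover have "u \<bullet> (p x - p x') = s * norm (p x - p x')"
      using False by (simp add: u_def power2_norm_eq_inner[symmetric] power2_eq_square)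
    ultimately have "s * norm (p x - p x') \<le> s * (4 * C * s)" using s by (simp add: power2_eq_square)
    then show ?thesis using s by (simp add: s_def)
  qed (use C0 in auto)
  then have "(4 * C)-lipschitz_on UNIV p" using C0 by (auto simp: lipschitz_on_def dist_norm)
  then have "continuous_on UNIV p" by (rule lipschitz_on_continuous_on)
  with 1 2 that show ?thesis by blast
qed

section \<open>Invariant graphs of expanding systems\<close>

lemma at_within_shift_half_line:
  fixes z :: "real \<Rightarrow> 'a::real_normed_vector"
  assumes "(z has_vector_derivative D) (at (s + t) within {0..})" "s \<ge> 0" "t \<ge> 0"
  shows "((\<lambda>t. z (s + t)) has_vector_derivative D) (at t within {0..})"
proof -
  have "((z \<circ> (\<lambda>t. s + t)) has_vector_derivative (1 *\<^sub>R D)) (at t within {0..})"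
    using assms by (intro vector_diff_chain_within has_vector_derivative_within_subset[OF assms(1)])
      (auto intro!: derivative_eq_intros)
  then show ?thesis by (simp add: o_def)
qed

lemma has_real_derivative_inner_self:
  fixes y :: "real \<Rightarrow> 'a::real_inner"
  assumes "(y has_vector_derivative y') (at t within S)"
  shows "((\<lambda>t. y t \<bullet> y t) has_real_derivative 2 * (y t \<bullet> y')) (at t within S)"
  using bounded_bilinear.has_vector_derivative[OF bounded_bilinear_inner assms assms]
  by (simp add: has_real_derivative_iff_has_vector_derivative inner_commute)

lemma has_vector_derivative_fst_snd:
  assumes "(z has_vector_derivative (a, b)) (at t within S)"
  shows "((\<lambda>t. fst (z t)) has_vector_derivative a) (at t within S)"
    "((\<lambda>t. snd (z t)) has_vector_derivative b) (at t within S)"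
  using bounded_linear.has_vector_derivative[OF bounded_linear_fst assms]
    bounded_linear.has_vector_derivative[OF bounded_linear_snd assms] by simp_all

text \<open>
  The fast direction \<open>v\<close> expands at rate \<open>c / eps\<close>, and the invariant manifold consists of the
  points whose forward orbit stays near \<open>v = 0\<close>.
\<close>

locale expanding_system =
  fixes P :: "real \<times> 'a::euclidean_space \<Rightarrow> real" and Q :: "real \<times> 'a \<Rightarrow> 'a" and eps c L :: real
  assumes eps: "eps > 0" and c: "c > 0" and L: "L > 0"
    and lipP: "\<And>a b. \<bar>P a - P b\<bar> \<le> L * norm (a - b)"
    and lipQ: "\<And>a b. norm (Q a - Q b) \<le> L * norm (a - b)"
    and sdP: "\<And>z y. \<bar>P (z + y) + P (z - y) - 2 * P z\<bar> \<le> L * (norm y)\<^sup>2"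
    and sdQ: "\<And>z y. norm (Q (z + y) + Q (z - y) - 2 *\<^sub>R Q z) \<le> L * (norm y)\<^sup>2"
    and mono: "\<And>v w x. w \<le> v \<Longrightarrow> P (v, x) - P (w, x) \<ge> c * (v - w)"
    and zero: "\<And>x. \<bar>P (0, x)\<bar> \<le> L * eps"
    and dx: "\<And>v x x'. \<bar>P (v, x) - P (v, x')\<bar> \<le> L * (\<bar>v\<bar> + eps) * norm (x - x')"
    and small1: "eps * (2 * L * (2 * L / c + 1)) \<le> c"
    and small2: "eps * (2 * L * (12 + 8 * L / c)) \<le> c"
begin

definition sol :: "(real \<Rightarrow> real \<times> 'a) \<Rightarrow> bool" where
  "sol z \<longleftrightarrow> (\<forall>t\<ge>0. (z has_vector_derivative (P (z t) / eps, Q (z t))) (at t within {0..}))"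

text \<open>Outside this strip the expansion, at least \<open>c * \<rho> = 2 * L * eps\<close>,
  exceeds the drift \<open>L * eps\<close> of the zero section, so an orbit that has left it never
  returns.\<close>

definition \<rho> :: real where "\<rho> = 2 * L * eps / c"

definition slow_orbit :: "(real \<Rightarrow> real \<times> 'a) \<Rightarrow> bool" where
  "slow_orbit z \<longleftrightarrow> sol z \<and> (\<forall>t\<ge>0. \<bar>fst (z t)\<bar> \<le> \<rho>)"

text \<open>\<open>coupling * eps\<close> equals \<open>L * (\<rho> + eps)\<close>, the Lipschitz
  constant of P in x within the strip. The cone slope \<kappa> is chosen so that, for differences on
  the cone boundary or steeper, this coupling uses up at most half of the expansion c.\<close>

definition coupling :: real where "coupling = L * (2 * L / c + 1)"
definition \<kappa> :: real where "\<kappa> = 2 * coupling / c * eps"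

lemma rho_pos: "\<rho> > 0" and coupling_pos: "coupling > 0" and kappa_pos: "\<kappa> > 0"
  using eps c L by (auto simp: \<rho>_def coupling_def \<kappa>_def intro!: mult_pos_pos add_pos_pos divide_pos_pos)

lemma kappa_le: "\<kappa> \<le> 1"
  using small1 c by (simp add: \<kappa>_def coupling_def field_simps)

lemma expansion_dominates: "8 * L \<le> c / eps" "2 * L * (12 + 8 * L / c) \<le> c / eps"
proof -
  show 2: "2 * L * (12 + 8 * L / c) \<le> c / eps" using small2 eps by (simp add: field_simps)
  have "L * (8 * L / c) \<ge> 0" using L c by simp
  moreover have "2 * L * (12 + 8 * L / c) = 24 * L + 2 * (L * (8 * L / c))" by (simp add: algebra_simps)
  ultimately have "8 * L \<le> 2 * L * (12 + 8 * L / c)" using L by linarith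
  with 2 show "8 * L \<le> c / eps" by linarith
qed

lemma mono_mult: "(v - w) * (P (v, x) - P (w, x)) \<ge> c * (v - w)\<^sup>2"
proof (cases "w \<le> v")
  case True
  then have "(v - w) * (c * (v - w)) \<le> (v - w) * (P (v, x) - P (w, x))"
    by (intro mult_left_mono mono) auto
  then show ?thesis by (simp add: power2_eq_square algebra_simps)
next
  case False
  then have "(w - v) * (c * (w - v)) \<le> (w - v) * (P (w, x) - P (v, x))"
    by (intro mult_left_mono mono) auto
  then show ?thesis by (simp add: power2_eq_square algebra_simps)
qed

lemma sol_fst: "sol z \<Longrightarrow> t \<ge> 0 \<Longrightarrow> ((\<lambda>t. fst (z t)) has_real_derivative P (z t) / eps) (at t within {0..})"
  and sol_snd: "sol z \<Longrightarrow> t \<ge> 0 \<Longrightarrow> ((\<lambda>t. snd (z t)) has_vector_derivative Q (z t)) (at t within {0..})"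
  unfolding sol_def has_real_derivative_iff_has_vector_derivative
  by (blast dest: has_vector_derivative_fst_snd)+

lemma sol_shift: "sol z \<Longrightarrow> s \<ge> 0 \<Longrightarrow> sol (\<lambda>t. z (s + t))"
  unfolding sol_def by (intro allI impI at_within_shift_half_line) auto

lemma slow_orbit_shift: "slow_orbit z \<Longrightarrow> s \<ge> 0 \<Longrightarrow> slow_orbit (\<lambda>t. z (s + t))"
  unfolding slow_orbit_def by (auto intro: sol_shift)

text \<open>
  Where \<open>W = q\<^sup>2 - \<kappa>\<^sup>2 \<bar>y\<bar>\<^sup>2\<close> is positive it grows exponentially, which is impossible for the
  difference \<open>(q, y)\<close> of two orbits with bounded fast component.
\<close>

lemma cone:
  assumes 1: "slow_orbit z" and 2: "slow_orbit w"
  shows "\<bar>fst (z 0) - fst (w 0)\<bar> \<le> \<kappa> * norm (snd (z 0) - snd (w 0))"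
proof -
  define q where "q = (\<lambda>t. fst (z t) - fst (w t))"
  define y where "y = (\<lambda>t. snd (z t) - snd (w t))"
  define q' where "q' = (\<lambda>t. P (z t) / eps - P (w t) / eps)"
  define y' where "y' = (\<lambda>t. Q (z t) - Q (w t))"
  define W where "W = (\<lambda>t. (q t)\<^sup>2 - \<kappa>\<^sup>2 * (y t \<bullet> y t))"
  define W' where "W' = (\<lambda>t. 2 * (q t * q' t) - \<kappa>\<^sup>2 * (2 * (y t \<bullet> y' t)))"
  have s: "sol z" "sol w" using 1 2 by (auto simp: slow_orbit_def)
  have "W 0 \<le> 0"
  proof (rule growth_bounded_nonpos[where W'=W' and \<mu>="c / (2 * eps)"])
    fix t :: real assume t: "t \<ge> 0"
    have dq: "(q has_real_derivative q' t) (at t within {0..})"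
      unfolding q_def q'_def by (intro DERIV_diff sol_fst s t)
    have dy: "(y has_vector_derivative y' t) (at t within {0..})"
      unfolding y_def y'_def by (intro has_vector_derivative_diff sol_snd s t)
    show "(W has_real_derivative W' t) (at t within {0..})"
      unfolding W_def W'_def
      by (auto intro!: derivative_eq_intros dq has_real_derivative_inner_self[OF dy])
    have "\<bar>q t\<bar> \<le> 2 * \<rho>" using 1 2 t unfolding slow_orbit_def q_def by (smt (verit))
    then have "(q t)\<^sup>2 \<le> (2 * \<rho>)\<^sup>2" using power_mono[of "\<bar>q t\<bar>" "2 * \<rho>" 2] by simp
    moreover have "\<kappa>\<^sup>2 * (y t \<bullet> y t) \<ge> 0" by simp
    ultimately show "W t \<le> (2 * \<rho>)\<^sup>2" unfolding W_def by linarith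
    assume "W t > 0"
    \<comment> \<open>Where W is positive the difference is steeper than the cone, so its slow part
      y can be estimated by its fast part q.\<close>
    then have W: "(\<kappa> * norm (y t))\<^sup>2 < (q t)\<^sup>2" by (simp add: W_def power_mult_distrib power2_norm_eq_inner)
    then have "\<bar>\<kappa> * norm (y t)\<bar> \<le> \<bar>q t\<bar>" by (simp only: abs_le_square_iff less_imp_le)
    then have ky: "\<kappa> * norm (y t) \<le> \<bar>q t\<bar>" using kappa_pos by (simp add: abs_mult)
    have ny: "norm (y t) \<le> \<bar>q t\<bar> / \<kappa>" using ky kappa_pos by (simp add: field_simps)
    have zw: "z t = (fst (z t), snd (z t))" "w t = (fst (w t), snd (w t))" by auto
    have "q t * (P (z t) - P (w t)) = q t * (P (fst (z t), snd (z t)) - P (fst (w t), snd (z t)))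
       + q t * (P (fst (w t), snd (z t)) - P (fst (w t), snd (w t)))" by (simp add: algebra_simps)
    also have "\<dots> \<ge> c * (q t)\<^sup>2 - \<bar>q t\<bar> * (coupling * eps * norm (y t))"
    proof -
      have "q t * (P (fst (z t), snd (z t)) - P (fst (w t), snd (z t))) \<ge> c * (q t)\<^sup>2"
        unfolding q_def by (rule mono_mult)
      moreover have "\<bar>P (fst (w t), snd (z t)) - P (fst (w t), snd (w t))\<bar> \<le> coupling * eps * norm (y t)"
      proof -
        have "\<bar>fst (w t)\<bar> \<le> \<rho>" using 2 t by (auto simp: slow_orbit_def)
        then have "L * (\<bar>fst (w t)\<bar> + eps) * norm (y t) \<le> L * (\<rho> + eps) * norm (y t)"
          using L by (intro mult_right_mono mult_left_mono) auto
        also have "L * (\<rho> + eps) = coupling * eps" by (simp add: coupling_def \<rho>_def algebra_simps)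
        finally show ?thesis using dx[of "fst (w t)" "snd (z t)" "snd (w t)"] by (simp add: y_def)
      qed
      then have "\<bar>q t * (P (fst (w t), snd (z t)) - P (fst (w t), snd (w t)))\<bar> \<le> \<bar>q t\<bar> * (coupling * eps * norm (y t))"
        unfolding abs_mult by (intro mult_left_mono) auto
      ultimately show ?thesis by linarith
    qed
    finally have A: "q t * (P (z t) - P (w t)) \<ge> c * (q t)\<^sup>2 - \<bar>q t\<bar> * (coupling * eps * norm (y t))" .
    have "\<bar>q t\<bar> * (coupling * eps * norm (y t)) \<le> \<bar>q t\<bar> * (coupling * eps * (\<bar>q t\<bar> / \<kappa>))"
      using ny coupling_pos eps by (intro mult_left_mono) auto
    also have "\<dots> = c / 2 * (q t)\<^sup>2"
      using coupling_pos eps c by (simp add: \<kappa>_def field_simps power2_eq_square)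
    finally have "q t * (P (z t) - P (w t)) \<ge> c / 2 * (q t)\<^sup>2" using A by linarith
    then have "q t * q' t \<ge> c / (2 * eps) * (q t)\<^sup>2"
      using eps by (simp add: q'_def field_simps)
    \<comment> \<open>One factor \<kappa> goes to \<open>norm (y t)\<close> and one to
      \<open>norm (y' t)\<close>, and \<open>\<kappa> \<le> 1\<close> handles the remaining
      \<open>\<kappa> * \<bar>q t\<bar>\<close>. The slow growth thus costs a multiple of L that
      does not contain 1 / eps.\<close>
    moreover have "\<kappa>\<^sup>2 * (y t \<bullet> y' t) \<le> 2 * L * (q t)\<^sup>2"
    proof -
      have "norm (z t - w t) \<le> \<bar>q t\<bar> + norm (y t)"
        using norm_Pair_le[of "q t" "y t"] by (simp add: q_def y_def flip: minus_prod_def)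
      then have "norm (y' t) \<le> L * (\<bar>q t\<bar> + norm (y t))"
        unfolding y'_def using L by (intro order_trans[OF lipQ] mult_left_mono) auto
      then have "\<kappa> * (\<kappa> * (norm (y t) * norm (y' t))) \<le> \<kappa> * (\<kappa> * (norm (y t) * (L * (\<bar>q t\<bar> + norm (y t)))))"
        using kappa_pos by (intro mult_left_mono) auto
      also have "\<dots> = L * ((\<kappa> * norm (y t)) * (\<kappa> * \<bar>q t\<bar> + \<kappa> * norm (y t)))" by (simp add: algebra_simps)
      also have "\<dots> \<le> L * (\<bar>q t\<bar> * (1 * \<bar>q t\<bar> + \<bar>q t\<bar>))"
        using L ky kappa_le kappa_pos by (intro mult_left_mono mult_mono add_mono) auto
      also have "\<dots> = 2 * L * (q t)\<^sup>2" by (simp add: power2_eq_square)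
      finally have "\<kappa>\<^sup>2 * (norm (y t) * norm (y' t)) \<le> 2 * L * (q t)\<^sup>2" by (simp add: power2_eq_square mult.assoc)
      moreover have "\<kappa>\<^sup>2 * (y t \<bullet> y' t) \<le> \<kappa>\<^sup>2 * (norm (y t) * norm (y' t))"
        by (intro mult_left_mono norm_cauchy_schwarz) auto
      ultimately show ?thesis by linarith
    qed
    moreover have "c / (2 * eps) * (q t)\<^sup>2 = (c / eps * (q t)\<^sup>2) / 2" by simp
    moreover have "(c / eps - 4 * L) * (q t)\<^sup>2 = c / eps * (q t)\<^sup>2 - 2 * (2 * L * (q t)\<^sup>2)"
      by (simp add: algebra_simps)
    ultimately have "W' t \<ge> (c / eps - 4 * L) * (q t)\<^sup>2"
      unfolding W'_def by linarith
    moreover have "(c / eps - 4 * L) * (q t)\<^sup>2 \<ge> c / (2 * eps) * (q t)\<^sup>2"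
      using expansion_dominates(1) by (intro mult_right_mono) auto
    moreover have "c / (2 * eps) * (q t)\<^sup>2 \<ge> c / (2 * eps) * W t"
      using c eps by (intro mult_left_mono) (auto simp: W_def)
    ultimately show "c / (2 * eps) * W t \<le> W' t" by linarith
  qed (use c eps in auto)
  then have "(q 0)\<^sup>2 \<le> (\<kappa> * norm (y 0))\<^sup>2" by (simp add: W_def power_mult_distrib power2_norm_eq_inner)
  then have "\<bar>q 0\<bar> \<le> \<bar>\<kappa> * norm (y 0)\<bar>" by (simp add: abs_le_square_iff)
  then show ?thesis using kappa_pos by (simp add: q_def y_def abs_mult)
qed


lemma field_lipschitz:
  "norm ((P a / eps, Q a) - (P b / eps, Q b)) \<le> (L / eps + L) * norm (a - b)"
proof -
  have "norm ((P a / eps, Q a) - (P b / eps, Q b)) \<le> norm (P a / eps - P b / eps) + norm (Q a - Q b)"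
    using norm_Pair_le[of "P a / eps - P b / eps" "Q a - Q b"] by simp
  also have "norm (P a / eps - P b / eps) = \<bar>P a - P b\<bar> / eps"
    using eps by (simp add: diff_divide_distrib[symmetric])
  also have "\<dots> \<le> L * norm (a - b) / eps" using eps lipP by (intro divide_right_mono) auto
  finally show ?thesis using lipQ[of a b] by (simp add: algebra_simps)
qed

lemma sol_exists: "\<exists>z. sol z \<and> z 0 = z0"
  using lipschitz_ode_global_solution[of "\<lambda>a. (P a / eps, Q a)" "L / eps + L" z0, OF field_lipschitz]
  by (auto simp: sol_def)

text \<open>Gronwall for the squared distance. The bound deteriorates as eps tends to 0, but it
  serves for continuity in the initial value at fixed eps and fixed time.\<close>

lemma sol_dependence:
  assumes z: "sol z" and w: "sol w" and t: "t \<ge> 0"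
  shows "norm (z t - w t) \<le> exp ((L / eps + L) * t) * norm (z 0 - w 0)"
proof -
  define d where "d = (\<lambda>t. z t - w t)"
  define d' where "d' = (\<lambda>t. (P (z t) / eps, Q (z t)) - (P (w t) / eps, Q (w t)))"
  define u where "u = (\<lambda>t. d t \<bullet> d t)"
  have "u t \<le> u 0 * exp (2 * (L / eps + L) * (t - 0))"
  proof (rule gronwall_le[where b=t and u'="\<lambda>t. 2 * (d t \<bullet> d' t)"])
    fix s assume s: "s \<in> {0..t}"
    have "(d has_vector_derivative d' s) (at s within {0..})"
      using z w s unfolding sol_def d_def d'_def by (intro has_vector_derivative_diff) auto
    then have "(d has_vector_derivative d' s) (at s within {0..t})"
      by (rule has_vector_derivative_within_subset) auto
    then show "(u has_real_derivative 2 * (d s \<bullet> d' s)) (at s within {0..t})"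
      unfolding u_def by (rule has_real_derivative_inner_self)
    have "d s \<bullet> d' s \<le> norm (d s) * norm (d' s)" by (rule norm_cauchy_schwarz)
    also have "\<dots> \<le> norm (d s) * ((L / eps + L) * norm (d s))"
      unfolding d'_def using field_lipschitz[of "z s" "w s"] by (intro mult_left_mono) (auto simp: d_def)
    also have "\<dots> = (L / eps + L) * u s" by (simp add: u_def power2_norm_eq_inner[symmetric] power2_eq_square)
    finally show "2 * (d s \<bullet> d' s) \<le> 2 * (L / eps + L) * u s" by linarith
  qed (use t in auto)
  also have "\<dots> = (exp ((L / eps + L) * t) * norm (d 0))\<^sup>2"
    by (simp add: u_def power2_norm_eq_inner[symmetric] power_mult_distrib exp_double[symmetric] algebra_simps)
  finally have "(norm (d t))\<^sup>2 \<le> (exp ((L / eps + L) * t) * norm (d 0))\<^sup>2"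
    by (simp add: u_def power2_norm_eq_inner)
  then show ?thesis by (auto simp: d_def intro: power2_le_imp_le)
qed

text \<open>Above \<rho> monotonicity in v gives
  \<open>P \<ge> c * \<rho> - L * eps = L * eps\<close>, so the fast component keeps increasing and
  the escape is irrevocable.\<close>

lemma escape_up:
  assumes z: "sol z" and s: "s \<ge> 0" "fst (z s) > \<rho>" and t: "t \<ge> s"
  shows "fst (z t) > \<rho>"
proof -
  define w where "w = (\<lambda>t. z (s + t))"
  have w: "sol w" unfolding w_def by (rule sol_shift[OF z s(1)])
  have "fst (w (t - s)) - \<rho> \<ge> fst (w 0) - \<rho>"
  proof (rule stays_above_if_increasing_when_positive[where W="\<lambda>t. fst (w t) - \<rho>" and W'="\<lambda>t. P (w t) / eps"])
    show "((\<lambda>t. fst (w t) - \<rho>) has_real_derivative P (w t) / eps) (at t within {0..})" if "t \<ge> 0" for t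
      using that by (auto intro!: derivative_eq_intros sol_fst w)
    fix t :: real assume t: "t \<ge> 0" "fst (w t) - \<rho> > 0"
    have "P (fst (w t), snd (w t)) - P (0, snd (w t)) \<ge> c * (fst (w t) - 0)"
      using t rho_pos by (intro mono) auto
    moreover have "c * fst (w t) \<ge> c * \<rho>" using t c by (intro mult_left_mono) auto
    moreover have "c * \<rho> = 2 * (L * eps)" using c by (simp add: \<rho>_def)
    moreover have "L * eps > 0" using L eps by simp
    ultimately have "P (fst (w t), snd (w t)) \<ge> 0" using zero[of "snd (w t)"] by auto
    then show "P (w t) / eps \<ge> 0" using eps by simp
  qed (use s t in \<open>auto simp: w_def\<close>)
  then show ?thesis using s by (simp add: w_def)
qed

lemma escape_down:
  assumes z: "sol z" and s: "s \<ge> 0" "fst (z s) < - \<rho>" and t: "t \<ge> s"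
  shows "fst (z t) < - \<rho>"
proof -
  define w where "w = (\<lambda>t. z (s + t))"
  have w: "sol w" unfolding w_def by (rule sol_shift[OF z s(1)])
  have "- fst (w (t - s)) - \<rho> \<ge> - fst (w 0) - \<rho>"
  proof (rule stays_above_if_increasing_when_positive[where W="\<lambda>t. - fst (w t) - \<rho>" and W'="\<lambda>t. - P (w t) / eps"])
    show "((\<lambda>t. - fst (w t) - \<rho>) has_real_derivative - P (w t) / eps) (at t within {0..})" if "t \<ge> 0" for t
      using that by (auto intro!: derivative_eq_intros sol_fst w)
    fix t :: real assume t: "t \<ge> 0" "- fst (w t) - \<rho> > 0"
    have "P (0, snd (w t)) - P (fst (w t), snd (w t)) \<ge> c * (0 - fst (w t))"
      using t rho_pos by (intro mono) auto
    moreover have "c * (- fst (w t)) \<ge> c * \<rho>" using t c by (intro mult_left_mono) auto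
    moreover have "c * \<rho> = 2 * (L * eps)" using c by (simp add: \<rho>_def)
    moreover have "L * eps > 0" using L eps by simp
    ultimately have "P (fst (w t), snd (w t)) \<le> 0" using zero[of "snd (w t)"] by auto
    then show "- P (w t) / eps \<ge> 0" using eps by (simp add: divide_nonpos_pos)
  qed (use s t in \<open>auto simp: w_def\<close>)
  then show ?thesis using s by (simp add: w_def)
qed

text \<open>A shooting argument on the fibre over x. The initial values whose orbits escape upwards
  and those whose orbits escape downwards form open sets, by continuous dependence, and these are
  disjoint because escape is irrevocable. Each contains an end of the interval from -2\<rho> to
  2\<rho>, so connectedness leaves a value that never escapes.\<close>

lemma slow_orbit_exists: "\<exists>z. slow_orbit z \<and> snd (z 0) = x"
proof -
  obtain Z where Z: "\<And>a. sol (Z a)" "\<And>a. Z a 0 = a" using sol_exists by metis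
  define A where "A = (\<Union>t\<in>{0..}. {v. \<rho> < fst (Z (v, x) t)})"
  define B where "B = (\<Union>t\<in>{0..}. {v. fst (Z (v, x) t) < - \<rho>})"
  have cont: "continuous_on UNIV (\<lambda>v. fst (Z (v, x) t))" if "t \<ge> 0" for t
  proof (rule lipschitz_on_continuous_on[of "exp ((L / eps + L) * t)"], rule lipschitz_onI)
    fix v v' :: real
    have "\<bar>fst (Z (v, x) t) - fst (Z (v', x) t)\<bar> \<le> norm (Z (v, x) t - Z (v', x) t)"
      using dist_fst_le[of "Z (v, x) t" "Z (v', x) t"] by (simp add: dist_norm)
    also have "\<dots> \<le> exp ((L / eps + L) * t) * norm (Z (v, x) 0 - Z (v', x) 0)"
      by (intro sol_dependence Z that)
    finally show "dist (fst (Z (v, x) t)) (fst (Z (v', x) t)) \<le> exp ((L / eps + L) * t) * dist v v'"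
      by (simp add: Z dist_real_def norm_Pair)
  qed simp
  have "open A" "open B" unfolding A_def B_def
    by (auto intro!: open_UN open_Collect_less continuous_on_const cont)
  moreover have "connected {- 2 * \<rho>..2 * \<rho>}" by simp
  moreover have "A \<inter> B = {}"
  proof (rule ccontr)
    assume "A \<inter> B \<noteq> {}"
    then obtain v s t where "s \<ge> 0" "t \<ge> 0" "\<rho> < fst (Z (v, x) s)" "fst (Z (v, x) t) < - \<rho>"
      by (auto simp: A_def B_def)
    then show False using escape_up[OF Z(1), of s "(v, x)" t] escape_down[OF Z(1), of t "(v, x)" s] rho_pos
      by (cases "s \<le> t") auto
  qed
  moreover have "2 * \<rho> \<in> A \<inter> {- 2 * \<rho>..2 * \<rho>}" "- 2 * \<rho> \<in> B \<inter> {- 2 * \<rho>..2 * \<rho>}"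
    using rho_pos by (auto simp: A_def B_def Z intro!: exI[of _ 0] bexI[of _ 0])
  ultimately have "\<not> {- 2 * \<rho>..2 * \<rho>} \<subseteq> A \<union> B"
    unfolding connected_def by blast
  then obtain v where "v \<notin> A" "v \<notin> B" by blast
  then have "slow_orbit (Z (v, x))"
    using Z(1) by (auto simp: slow_orbit_def A_def B_def abs_le_iff not_less minus_le_iff)
  then show ?thesis using Z by (intro exI[of _ "Z (v, x)"]) simp
qed


text \<open>Time shifts of slow orbits are slow orbits, so the cone estimate bounds the fast
  difference by the slow one at all times and Gronwall needs only the slow equation. The resulting
  rate \<open>4 * L\<close> is free of 1 / eps, which lets the expansion \<open>c / eps\<close> beat
  it in the second difference estimate.\<close>

lemma slow_orbit_separation:
  assumes z: "slow_orbit z" and w: "slow_orbit w" and t: "t \<ge> 0"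
  shows "(norm (z t - w t))\<^sup>2 \<le> 2 * (norm (snd (z 0) - snd (w 0)))\<^sup>2 * exp (4 * L * t)"
proof -
  define y where "y = (\<lambda>t. snd (z t) - snd (w t))"
  define y' where "y' = (\<lambda>t. Q (z t) - Q (w t))"
  define u where "u = (\<lambda>t. y t \<bullet> y t)"
  have s: "sol z" "sol w" using z w by (auto simp: slow_orbit_def)
  have q: "\<bar>fst (z t) - fst (w t)\<bar> \<le> norm (y t)" if "t \<ge> 0" for t
  proof -
    have "\<bar>fst (z t) - fst (w t)\<bar> \<le> \<kappa> * norm (y t)"
      using cone[OF slow_orbit_shift[OF z that] slow_orbit_shift[OF w that]] by (simp add: y_def)
    also have "\<dots> \<le> 1 * norm (y t)" using kappa_le by (intro mult_right_mono) auto
    finally show ?thesis by simp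
  qed
  have nd: "(norm (z t - w t))\<^sup>2 = (fst (z t) - fst (w t))\<^sup>2 + u t" for t
    by (simp add: norm_prod_def u_def y_def power2_norm_eq_inner)
  have 2: "(norm (z t - w t))\<^sup>2 \<le> 2 * u t" if "t \<ge> 0" for t
    unfolding nd using power_mono[OF q[OF that], of 2] by (simp add: u_def power2_norm_eq_inner)
  have "u t \<le> u 0 * exp (4 * L * (t - 0))"
  proof (rule gronwall_le[where b=t and u'="\<lambda>t. 2 * (y t \<bullet> y' t)"])
    fix r assume r: "r \<in> {0..t}"
    have "(y has_vector_derivative y' r) (at r within {0..})"
      using r unfolding y_def y'_def by (intro has_vector_derivative_diff sol_snd s) auto
    then have "(y has_vector_derivative y' r) (at r within {0..t})"
      by (rule has_vector_derivative_within_subset) auto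
    then show "(u has_real_derivative 2 * (y r \<bullet> y' r)) (at r within {0..t})"
      unfolding u_def by (rule has_real_derivative_inner_self)
    have "norm (z r - w r) \<le> 2 * norm (y r)"
    proof (rule power2_le_imp_le)
      have "(norm (z r - w r))\<^sup>2 \<le> 2 * u r" using r by (intro 2) auto
      also have "\<dots> \<le> (2 * norm (y r))\<^sup>2" by (simp add: u_def power_mult_distrib power2_norm_eq_inner)
      finally show "(norm (z r - w r))\<^sup>2 \<le> (2 * norm (y r))\<^sup>2" .
    qed simp
    then have "norm (y' r) \<le> L * (2 * norm (y r))"
      unfolding y'_def using L by (intro order_trans[OF lipQ] mult_left_mono) auto
    then have "norm (y r) * norm (y' r) \<le> norm (y r) * (L * (2 * norm (y r)))" by (intro mult_left_mono) auto
    also have "\<dots> = 2 * L * u r" by (simp add: u_def power2_norm_eq_inner[symmetric] power2_eq_square)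
    finally show "2 * (y r \<bullet> y' r) \<le> 4 * L * u r" using norm_cauchy_schwarz[of "y r" "y' r"] by linarith
  qed (use t in auto)
  then show ?thesis using 2[OF t] by (simp add: u_def y_def power2_norm_eq_inner)
qed

text \<open>
  The same argument for the second difference of three slow orbits. The exponentially growing
  term \<open>G\<close> dominates the quadratic errors made in replacing the field by its linear part.
\<close>

lemma second_difference:
  assumes z: "slow_orbit z" and zp: "slow_orbit zp" and zm: "slow_orbit zm"
    and ini: "snd (zp 0) = snd (z 0) + h" "snd (zm 0) = snd (z 0) - h"
  shows "\<bar>fst (zp 0) + fst (zm 0) - 2 * fst (z 0)\<bar> \<le> 8 * L / c * (norm h)\<^sup>2"
proof -
  \<comment> \<open>Chosen so that each of the two error terms \<open>L * G t\<close> and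
    \<open>L * norm (y t)\<close> consumes at most a quarter of the expansion c.\<close>
  define k where "k = 4 * L / c"
  have k: "k > 0" using L c by (simp add: k_def)
  define q where "q = (\<lambda>t. fst (zp t) + fst (zm t) - 2 * fst (z t))"
  define y where "y = (\<lambda>t. snd (zp t) + snd (zm t) - 2 *\<^sub>R snd (z t))"
  define q' where "q' = (\<lambda>t. P (zp t) / eps + P (zm t) / eps - 2 * (P (z t) / eps))"
  define y' where "y' = (\<lambda>t. Q (zp t) + Q (zm t) - 2 *\<^sub>R Q (z t))"
  define G where "G = (\<lambda>t. 2 * (norm h)\<^sup>2 * exp (4 * L * t))"
  define W where "W = (\<lambda>t. (q t)\<^sup>2 - k\<^sup>2 * (y t \<bullet> y t + (G t)\<^sup>2))"
  define W' where "W' = (\<lambda>t. 2 * (q t * q' t) - k\<^sup>2 * (2 * (y t \<bullet> y' t) + 8 * L * (G t)\<^sup>2))"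
  have s: "sol z" "sol zp" "sol zm" using z zp zm by (auto simp: slow_orbit_def)
  have G0: "G t \<ge> 0" for t by (simp add: G_def)
  have "W 0 \<le> 0"
  proof (rule growth_bounded_nonpos[where W'=W' and \<mu>="c / (2 * eps)"])
    fix t :: real assume t: "t \<ge> 0"
    have dq: "(q has_real_derivative q' t) (at t within {0..})"
      unfolding q_def q'_def by (intro DERIV_diff DERIV_add DERIV_cmult sol_fst s t)
    have dy: "(y has_vector_derivative y' t) (at t within {0..})"
      unfolding y_def y'_def
      by (intro has_vector_derivative_diff has_vector_derivative_add sol_snd s t
          bounded_linear.has_vector_derivative[OF bounded_linear_scaleR_right])
    have dG: "(G has_real_derivative 4 * L * G t) (at t within {0..})"
      unfolding G_def by (auto intro!: derivative_eq_intros)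
    show "(W has_real_derivative W' t) (at t within {0..})"
      unfolding W_def W'_def
      by (rule derivative_eq_intros dq dG has_real_derivative_inner_self[OF dy] refl)+
        (simp add: power2_eq_square)
    have "\<bar>q t\<bar> \<le> 4 * \<rho>" using z zp zm t unfolding slow_orbit_def q_def by (smt (verit))
    then have "(q t)\<^sup>2 \<le> (4 * \<rho>)\<^sup>2" using power_mono[of "\<bar>q t\<bar>" "4 * \<rho>" 2] by simp
    moreover have "k\<^sup>2 * (y t \<bullet> y t + (G t)\<^sup>2) \<ge> 0" by simp
    ultimately show "W t \<le> (4 * \<rho>)\<^sup>2" unfolding W_def by linarith
    assume W: "W t > 0"
    have "k\<^sup>2 * (y t \<bullet> y t) \<le> (q t)\<^sup>2" "k\<^sup>2 * (G t)\<^sup>2 \<le> (q t)\<^sup>2"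
      using W mult_nonneg_nonneg[OF zero_le_power2[of k] inner_ge_zero[of "y t"]]
        mult_nonneg_nonneg[OF zero_le_power2[of k] zero_le_power2[of "G t"]]
      unfolding W_def distrib_left by linarith+
    then have "(k * norm (y t))\<^sup>2 \<le> (q t)\<^sup>2" "(k * G t)\<^sup>2 \<le> (q t)\<^sup>2"
      by (auto simp: power_mult_distrib power2_norm_eq_inner)
    then have "\<bar>k * norm (y t)\<bar> \<le> \<bar>q t\<bar>" "\<bar>k * G t\<bar> \<le> \<bar>q t\<bar>" by (simp_all only: abs_le_square_iff)
    then have ky: "k * norm (y t) \<le> \<bar>q t\<bar>" and kG: "k * G t \<le> \<bar>q t\<bar>" using k G0[of t] by (auto simp: abs_mult)
    define \<Delta> where "\<Delta> = zp t - z t"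
    \<comment> \<open>The reflection of \<open>zp t\<close> in \<open>z t\<close>. The orbit
      \<open>zm t\<close> misses it exactly by \<open>(q t, y t)\<close>, so the second difference
      along the three orbits splits into a second difference of the field and a first difference
      between \<open>zm t\<close> and a.\<close>
    define a where "a = z t - \<Delta>"
    have \<Delta>: "(norm \<Delta>)\<^sup>2 \<le> G t"
      using slow_orbit_separation[OF zp z t] ini by (simp add: \<Delta>_def G_def)
    have az: "fst (zm t) = fst a + q t" "snd (zm t) = snd a + y t"
      by (simp_all add: a_def \<Delta>_def q_def y_def scaleR_2)
    have D: "norm (zm t - a) \<le> \<bar>q t\<bar> + norm (y t)"
    proof -
      have "zm t - a = (q t, y t)" using az by (simp add: prod_eq_iff)
      then show ?thesis using norm_Pair_le[of "q t" "y t"] by simp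
    qed
    have P1: "\<bar>P (z t + \<Delta>) + P (z t - \<Delta>) - 2 * P (z t)\<bar> \<le> L * G t"
      using \<Delta> L by (intro order_trans[OF sdP] mult_left_mono) auto
    have P2: "q t * (P (fst a + q t, snd (zm t)) - P (fst a, snd (zm t))) \<ge> c * (q t)\<^sup>2"
      using mono_mult[of "fst a + q t" "fst a" "snd (zm t)"] by simp
    have P3: "\<bar>P (fst a, snd (zm t)) - P a\<bar> \<le> L * norm (y t)"
      using lipP[of "(fst a, snd (zm t))" a] az norm_Pair[of 0 "y t"] by (cases a) (simp add: minus_prod_def)
    have eq: "P (zp t) + P (zm t) - 2 * P (z t) =
        (P (z t + \<Delta>) + P (z t - \<Delta>) - 2 * P (z t)) +
        (P (fst a + q t, snd (zm t)) - P (fst a, snd (zm t))) + (P (fst a, snd (zm t)) - P a)"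
      using az(1)[symmetric] by (simp add: \<Delta>_def a_def)
    have "q t * (P (zp t) + P (zm t) - 2 * P (z t)) \<ge> c * (q t)\<^sup>2 - \<bar>q t\<bar> * (L * G t) - \<bar>q t\<bar> * (L * norm (y t))"
    proof -
      have "\<bar>q t * (P (z t + \<Delta>) + P (z t - \<Delta>) - 2 * P (z t))\<bar> \<le> \<bar>q t\<bar> * (L * G t)"
        unfolding abs_mult using P1 by (intro mult_left_mono) auto
      moreover have "\<bar>q t * (P (fst a, snd (zm t)) - P a)\<bar> \<le> \<bar>q t\<bar> * (L * norm (y t))"
        unfolding abs_mult using P3 by (intro mult_left_mono) auto
      ultimately show ?thesis unfolding eq distrib_left using P2 by linarith
    qed
    moreover have "\<bar>q t\<bar> * (L * G t) \<le> c / 4 * (q t)\<^sup>2"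
    proof -
      have "\<bar>q t\<bar> * (L * G t) = c / 4 * (\<bar>q t\<bar> * (k * G t))" using c by (simp add: k_def)
      also have "\<dots> \<le> c / 4 * (\<bar>q t\<bar> * \<bar>q t\<bar>)" using c kG by (intro mult_left_mono) auto
      finally show ?thesis by (simp add: power2_eq_square)
    qed
    moreover have "\<bar>q t\<bar> * (L * norm (y t)) \<le> c / 4 * (q t)\<^sup>2"
    proof -
      have "\<bar>q t\<bar> * (L * norm (y t)) = c / 4 * (\<bar>q t\<bar> * (k * norm (y t)))" using c by (simp add: k_def)
      also have "\<dots> \<le> c / 4 * (\<bar>q t\<bar> * \<bar>q t\<bar>)" using c ky by (intro mult_left_mono) auto
      finally show ?thesis by (simp add: power2_eq_square)
    qed
    ultimately have "q t * (P (zp t) + P (zm t) - 2 * P (z t)) \<ge> c / 2 * (q t)\<^sup>2" by linarith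
    then have "q t * (P (zp t) + P (zm t) - 2 * P (z t)) / eps \<ge> c / 2 * (q t)\<^sup>2 / eps"
      using eps by (intro divide_right_mono) auto
    then have B1: "2 * (q t * q' t) \<ge> c / eps * (q t)\<^sup>2"
    proof -
      have e: "q' t = (P (zp t) + P (zm t) - 2 * P (z t)) / eps"
        by (simp add: q'_def add_divide_distrib diff_divide_distrib)
      have "c / eps * (q t)\<^sup>2 = 2 * (c / 2 * (q t)\<^sup>2 / eps)" by simp
      also have "\<dots> \<le> 2 * (q t * (P (zp t) + P (zm t) - 2 * P (z t)) / eps)"
        using \<open>c / 2 * (q t)\<^sup>2 / eps \<le> _\<close> by linarith
      finally show ?thesis unfolding e by simp
    qed
    have "norm (y' t) \<le> L * G t + L * (\<bar>q t\<bar> + norm (y t))"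
    proof -
      have "y' t = (Q (z t + \<Delta>) + Q (z t - \<Delta>) - 2 *\<^sub>R Q (z t)) + (Q (zm t) - Q a)"
        by (simp add: y'_def \<Delta>_def a_def)
      then have "norm (y' t) \<le> norm (Q (z t + \<Delta>) + Q (z t - \<Delta>) - 2 *\<^sub>R Q (z t)) + norm (Q (zm t) - Q a)"
        using norm_triangle_ineq by simp
      also have "norm (Q (z t + \<Delta>) + Q (z t - \<Delta>) - 2 *\<^sub>R Q (z t)) \<le> L * G t"
        using \<Delta> L by (intro order_trans[OF sdQ] mult_left_mono) auto
      also have "norm (Q (zm t) - Q a) \<le> L * (\<bar>q t\<bar> + norm (y t))"
        using D L by (intro order_trans[OF lipQ] mult_left_mono) auto
      finally show ?thesis by simp
    qed
    then have "k * (k * (norm (y t) * norm (y' t))) \<le> k * (k * (norm (y t) * (L * G t + L * (\<bar>q t\<bar> + norm (y t)))))"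
      using k by (intro mult_left_mono) auto
    also have "\<dots> = L * ((k * norm (y t)) * (k * G t + k * \<bar>q t\<bar> + k * norm (y t)))" by (simp add: algebra_simps)
    also have "\<dots> \<le> L * (\<bar>q t\<bar> * (\<bar>q t\<bar> + k * \<bar>q t\<bar> + \<bar>q t\<bar>))"
      using L ky kG k G0[of t] by (intro mult_left_mono mult_mono add_mono) auto
    also have "\<dots> = L * (2 + k) * (q t)\<^sup>2" by (simp add: power2_eq_square algebra_simps)
    finally have "k\<^sup>2 * (norm (y t) * norm (y' t)) \<le> L * (2 + k) * (q t)\<^sup>2" by (simp add: power2_eq_square mult.assoc)
    moreover have "k\<^sup>2 * (y t \<bullet> y' t) \<le> k\<^sup>2 * (norm (y t) * norm (y' t))"
      by (intro mult_left_mono norm_cauchy_schwarz) auto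
    ultimately have B2: "k\<^sup>2 * (y t \<bullet> y' t) \<le> L * (2 + k) * (q t)\<^sup>2" by linarith
    have "L * (k\<^sup>2 * (G t)\<^sup>2) \<le> L * (q t)\<^sup>2"
      using \<open>(k * G t)\<^sup>2 \<le> (q t)\<^sup>2\<close> L by (intro mult_left_mono) (auto simp: power_mult_distrib)
    then have B3: "k\<^sup>2 * (8 * L * (G t)\<^sup>2) \<le> 8 * L * (q t)\<^sup>2" by (simp add: algebra_simps)
    have "W' t \<ge> c / eps * (q t)\<^sup>2 - 2 * (L * (2 + k) * (q t)\<^sup>2) - 8 * L * (q t)\<^sup>2"
      using B1 B2 B3 unfolding W'_def distrib_left by linarith
    also have "c / eps * (q t)\<^sup>2 - 2 * (L * (2 + k) * (q t)\<^sup>2) - 8 * L * (q t)\<^sup>2 = (c / eps - L * (12 + 2 * k)) * (q t)\<^sup>2"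
      by (simp add: algebra_simps)
    finally have "W' t \<ge> (c / eps - L * (12 + 2 * k)) * (q t)\<^sup>2" .
    moreover have "c / eps - L * (12 + 2 * k) \<ge> c / (2 * eps)"
    proof -
      have "c / (2 * eps) = (c / eps) / 2" by simp
      moreover have "2 * L * (12 + 8 * L / c) = 2 * (L * (12 + 2 * k))" by (simp add: k_def)
      ultimately show ?thesis using expansion_dominates(2) by linarith
    qed
    then have "(c / eps - L * (12 + 2 * k)) * (q t)\<^sup>2 \<ge> c / (2 * eps) * (q t)\<^sup>2"
      by (intro mult_right_mono) auto
    moreover have "c / (2 * eps) * (q t)\<^sup>2 \<ge> c / (2 * eps) * W t"
      using c eps by (intro mult_left_mono) (auto simp: W_def)
    ultimately show "c / (2 * eps) * W t \<le> W' t" by linarith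
  qed (use c eps in auto)
  \<comment> \<open>The slow second difference vanishes initially, so \<open>W 0 \<le> 0\<close>
    bounds \<open>\<bar>q 0\<bar>\<close> by \<open>k * G 0\<close>, where
    \<open>G 0 = 2 * (norm h)\<^sup>2\<close>.\<close>
  moreover have "y 0 = 0" using ini by (simp add: y_def scaleR_2)
  ultimately have "(q 0)\<^sup>2 \<le> (k * G 0)\<^sup>2" by (simp add: W_def power_mult_distrib)
  then have "\<bar>q 0\<bar> \<le> k * G 0" using k G0[of 0] by (metis abs_le_square_iff abs_of_nonneg mult_nonneg_nonneg less_imp_le)
  then show ?thesis by (simp add: q_def k_def G_def)
qed

text \<open>By the cone estimate two slow orbits starting over the same x have the same fast
  component, so V is well defined and, by time shifts, every slow orbit stays on its graph.
  Differentiating \<open>fst (z t) = V (snd (z t))\<close> at time 0 gives the equation.\<close>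

theorem invariant_graph:
  obtains V p where "\<And>x. \<bar>V x\<bar> \<le> \<rho>" "\<And>x. GDERIV V x :> p x" "\<And>x. norm (p x) \<le> \<kappa>"
    "continuous_on UNIV p" "\<And>x. P (V x, x) = eps * (Q (V x, x) \<bullet> p x)"
proof -
  obtain Z where Z: "\<And>x. slow_orbit (Z x)" "\<And>x. snd (Z x 0) = x" using slow_orbit_exists by metis
  define V where "V = (\<lambda>x. fst (Z x 0))"
  have on: "fst (z 0) = V (snd (z 0))" if "slow_orbit z" for z
    using cone[OF that Z(1)[of "snd (z 0)"]] by (simp add: V_def Z)
  have lip: "\<bar>V a - V b\<bar> \<le> \<kappa> * norm (a - b)" for a b
    unfolding V_def using cone[OF Z(1)[of a] Z(1)[of b]] by (simp add: Z)
  have sd: "\<bar>V (x + y) + V (x - y) - 2 * V x\<bar> \<le> 8 * L / c * (norm y)\<^sup>2" for x y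
    unfolding V_def by (rule second_difference[OF Z(1) Z(1) Z(1)]) (auto simp: Z)
  obtain p where p: "\<And>x. GDERIV V x :> p x" "\<And>x. norm (p x) \<le> \<kappa>" "continuous_on UNIV p"
    using gradient_from_second_difference[of V \<kappa> "8 * L / c", OF lip sd] by blast
  have "P (V x, x) = eps * (Q (V x, x) \<bullet> p x)" for x
  proof -
    define z where "z = Z x"
    have z: "slow_orbit z" "sol z" using Z by (auto simp: z_def slow_orbit_def)
    have z0: "z 0 = (V x, x)" by (simp add: prod_eq_iff z_def V_def Z)
    have inv: "fst (z t) = V (snd (z t))" if "t \<ge> 0" for t
      using on[OF slow_orbit_shift[OF z(1) that]] by simp
    have 1: "((\<lambda>t. fst (z t)) has_vector_derivative P (z 0) / eps) (at 0 within {0..})"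
      using sol_fst[OF z(2), of 0] by (simp add: has_real_derivative_iff_has_vector_derivative)
    have "((V \<circ> (\<lambda>t. snd (z t))) has_vector_derivative (Q (z 0) \<bullet> p x)) (at 0 within {0..})"
      using sol_snd[OF z(2), of 0] has_derivative_at_withinI[OF p(1)[of x, unfolded gderiv_def]]
      by (intro vector_derivative_diff_chain_within) (auto simp: z0)
    then have 2: "((\<lambda>t. fst (z t)) has_vector_derivative (Q (z 0) \<bullet> p x)) (at 0 within {0..})"
      by (rule has_vector_derivative_transform[rotated 2]) (auto simp: inv)
    have "at (0::real) within {0..} \<noteq> bot" by (simp add: at_within_Ici_at_right)
    then have "P (z 0) / eps = Q (z 0) \<bullet> p x"
      using vector_derivative_unique_within[OF _ 1 2] by simp
    then show ?thesis using eps by (simp add: z0 field_simps)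
  qed
  moreover have "\<bar>V x\<bar> \<le> \<rho>" for x using Z(1)[of x] by (auto simp: slow_orbit_def V_def)
  ultimately show ?thesis using p that by blast
qed

end

section \<open>Cutoff of the fast field and existence of slow graphs\<close>

lemma cutoff_slope_nonneg:
  fixes \<psi> \<zeta> :: "real \<Rightarrow> real"
  assumes slope: "\<And>v w. \<lbrakk>- r \<le> w; w \<le> v; v \<le> r\<rbrakk> \<Longrightarrow> 0 \<le> \<psi> v - \<psi> w \<and> \<psi> v - \<psi> w \<le> D * (v - w)"
    and \<psi>0: "\<psi> 0 = 0" and r: "r > 0" and D: "D \<ge> 0"
    and z: "\<And>v. 0 \<le> \<zeta> v" "\<And>v. \<zeta> v \<le> 1" "\<And>v. \<bar>v\<bar> \<ge> r \<Longrightarrow> \<zeta> v = 0"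
      "\<And>v w. \<bar>v\<bar> \<le> \<bar>w\<bar> \<Longrightarrow> \<zeta> w \<le> \<zeta> v"
    and wv: "0 \<le> w" "w \<le> v"
  shows "\<zeta> v * \<psi> v - \<zeta> w * \<psi> w \<le> D * (v - w)"
proof -
  have Dvw: "D * (v - w) \<ge> 0" using D wv by simp
  have w0: "\<psi> w \<ge> 0" if "w \<le> r" using slope[of 0 w] that r wv \<psi>0 by auto
  consider "w \<ge> r" | "w < r" "v \<ge> r" | "v < r" by linarith
  then show ?thesis
  proof cases
    case 1
    then show ?thesis using z(3)[of v] z(3)[of w] wv Dvw by simp
  next
    case 2
    then have "\<zeta> w * \<psi> w \<ge> 0" using w0 z by simp
    then show ?thesis using z(3)[of v] 2 Dvw by simp
  next
    case 3
    have "0 \<le> \<psi> v" using slope[of 0 v] 3 r wv \<psi>0 by auto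
    \<comment> \<open>On the positive side \<psi> is nonnegative, so the decrease of \<zeta> only
      lowers the product and the slope of \<psi> remains as an upper bound.\<close>
    then have "\<zeta> v * \<psi> v \<le> \<zeta> w * \<psi> v" using z(4)[of w v] wv by (intro mult_right_mono) auto
    then have "\<zeta> v * \<psi> v - \<zeta> w * \<psi> w \<le> \<zeta> w * (\<psi> v - \<psi> w)" by (simp add: algebra_simps)
    also have "\<dots> \<le> 1 * (\<psi> v - \<psi> w)" using slope[of w v] 3 r wv z by (intro mult_right_mono) auto
    also have "\<dots> \<le> D * (v - w)" using slope[of w v] 3 r wv by auto
    finally show ?thesis .
  qed
qed

text \<open>
  Used for \<open>\<psi> v = A v - \<sigma> \<phi>(v, x)\<close>: since \<open>\<psi>\<close> increases, cutting it off outside a neighbourhood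
  of \<open>0\<close> leaves the slope of \<open>A v - \<zeta> v \<psi> v\<close> bounded below by that of \<open>\<sigma> \<phi>\<close>.
\<close>

lemma cutoff_slope:
  fixes \<psi> \<zeta> :: "real \<Rightarrow> real"
  assumes slope: "\<And>v w. \<lbrakk>- r \<le> w; w \<le> v; v \<le> r\<rbrakk> \<Longrightarrow> 0 \<le> \<psi> v - \<psi> w \<and> \<psi> v - \<psi> w \<le> D * (v - w)"
    and \<psi>0: "\<psi> 0 = 0" and r: "r > 0" and D: "D \<ge> 0"
    and z: "\<And>v. 0 \<le> \<zeta> v" "\<And>v. \<zeta> v \<le> 1" "\<And>v. \<bar>v\<bar> \<ge> r \<Longrightarrow> \<zeta> v = 0"
      "\<And>v w. \<bar>v\<bar> \<le> \<bar>w\<bar> \<Longrightarrow> \<zeta> w \<le> \<zeta> v"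
    and wv: "w \<le> v"
  shows "\<zeta> v * \<psi> v - \<zeta> w * \<psi> w \<le> D * (v - w)"
proof -
  have pos: "\<zeta> b * \<psi> b - \<zeta> a * \<psi> a \<le> D * (b - a)" if "0 \<le> a" "a \<le> b" for a b
    by (rule cutoff_slope_nonneg[OF slope \<psi>0 r D z that])
  have neg: "\<zeta> (- b) * (- \<psi> (- b)) - \<zeta> (- a) * (- \<psi> (- a)) \<le> D * (b - a)" if "0 \<le> a" "a \<le> b" for a b
  proof (rule cutoff_slope_nonneg[where \<psi>="\<lambda>v. - \<psi> (- v)" and \<zeta>="\<lambda>v. \<zeta> (- v)", OF _ _ r D _ _ _ _ that])
    fix v w assume "- r \<le> w" "w \<le> v" "v \<le> r"
    then show "0 \<le> - \<psi> (- v) - - \<psi> (- w) \<and> - \<psi> (- v) - - \<psi> (- w) \<le> D * (v - w)"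
      using slope[of "-v" "-w"] by auto
  qed (use \<psi>0 z in auto)
  consider "0 \<le> w" | "w < 0" "0 < v" | "v \<le> 0" by linarith
  then show ?thesis
  proof cases
    case 1
    then show ?thesis using pos wv by simp
  next
    case 2
    then have "\<zeta> v * \<psi> v \<le> D * v" "- (\<zeta> w * \<psi> w) \<le> D * (- w)" using pos[of 0 v] neg[of 0 "-w"] \<psi>0 by auto
    then show ?thesis by (simp add: algebra_simps)
  next
    case 3
    then show ?thesis using neg[of "-v" "-w"] wv by (simp add: algebra_simps)
  qed
qed

lemma c11_on_weaken:
  assumes "c11_on UNIV F"
  obtains C where "C \<ge> 0" "\<And>a b. norm (F a - F b) \<le> C * norm (a - b)"
    "\<And>z y. norm (F (z + y) + F (z - y) - 2 *\<^sub>R F z) \<le> C * (norm y)\<^sup>2"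
  by (rule c11_onE[OF assms]) simp

text \<open>In the application v is \<open>\<omega> - h0 x\<close>, \<phi> the fast component, g the
  slow field and k the derivative of h0 along g, so that \<open>h0 + V\<close> solves the invariance
  equation. Writing \<phi> as a sum of products whose factors \<open>T i\<close> are at most
  \<open>2 * \<bar>v\<bar>\<close> makes its Lipschitz constant in x proportional to |v|; this is
  the source of the O(eps) gradient.\<close>

theorem slow_graph_exists:
  fixes \<phi> k :: "real \<times> 'a::euclidean_space \<Rightarrow> real" and g :: "real \<times> 'a \<Rightarrow> 'a"
    and T :: "'i \<Rightarrow> real \<Rightarrow> real" and m :: "'i \<Rightarrow> 'a \<Rightarrow> real"
  assumes K: "compact K" and U: "open U" "K \<subseteq> U"
    and k: "\<And>v x. x \<in> U \<Longrightarrow> c11_at k (v, x)" and g: "\<And>v x. x \<in> U \<Longrightarrow> c11_at g (v, x)"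
    and fin: "finite J" and \<phi>: "\<And>v x. x \<in> U \<Longrightarrow> \<phi> (v, x) = (\<Sum>i\<in>J. T i v * m i x)"
    and T: "\<And>i v. i \<in> J \<Longrightarrow> c11_at (T i) v" "\<And>i v. i \<in> J \<Longrightarrow> \<bar>T i v\<bar> \<le> 2 * \<bar>v\<bar>"
    and m: "\<And>i x. i \<in> J \<Longrightarrow> x \<in> U \<Longrightarrow> c11_at (m i) x"
    and \<sigma>: "\<sigma> = 1 \<or> \<sigma> = (- 1::real)" and c: "c > 0" and r: "r > 0"
    and slope: "\<And>v w x. \<lbrakk>x \<in> U; - r \<le> w; w \<le> v; v \<le> r\<rbrakk> \<Longrightarrow>
       c * (v - w) \<le> \<sigma> * (\<phi> (v, x) - \<phi> (w, x)) \<and> \<sigma> * (\<phi> (v, x) - \<phi> (w, x)) \<le> A * (v - w)"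
  obtains e0 C O' where "e0 > 0" "C \<ge> 0" "open O'" "K \<subseteq> O'"
    "\<And>eps. eps \<in> {0<..<e0} \<Longrightarrow> \<exists>V p. continuous_on UNIV p \<and>
       (\<forall>x. GDERIV V x :> p x \<and> \<bar>V x\<bar> \<le> C * eps \<and> norm (p x) \<le> C * eps) \<and>
       (\<forall>x\<in>O'. \<phi> (V x, x) = eps * (k (V x, x) + g (V x, x) \<bullet> p x))"
proof (cases "K = {}")
  case True
  have "\<exists>V p. continuous_on UNIV p \<and>
       (\<forall>x. GDERIV V x :> p x \<and> \<bar>V x\<bar> \<le> 0 * eps \<and> norm (p x) \<le> 0 * eps) \<and>
       (\<forall>x\<in>{}. \<phi> (V x, x) = eps * (k (V x, x) + g (V x, x) \<bullet> p x))" for eps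
    by (intro exI[of _ "\<lambda>x. 0"]) (auto simp: GDERIV_const)
  then show ?thesis using True by (intro that[of 1 0 "{}"]) auto
next
  case False
  obtain \<beta> :: "'a \<Rightarrow> real" and O1 S where \<beta>: "\<And>x. c11_at \<beta> x" "\<And>x. 0 \<le> \<beta> x" "\<And>x. \<beta> x \<le> 1"
    and O1: "open O1" "K \<subseteq> O1" "\<And>x. x \<in> O1 \<Longrightarrow> \<beta> x = 1"
    and S: "compact S" "S \<subseteq> U" "\<And>x. x \<notin> S \<Longrightarrow> \<beta> x = 0"
    using c11_bump[OF K U] by blast
  \<comment> \<open>An even cutoff, nonincreasing in |v|: it is 0 where |v| is at least r, and 1
    where |v| is at most r / 2 because \<open>2 * (3 / 4)\<^sup>2 = 9 / 8\<close> exceeds 1.\<close>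
  define \<zeta> where "\<zeta> = (\<lambda>v::real. smooth_step (2 * (max 0 (1 - (v / r) * (v / r)))\<^sup>2))"
  have z01: "0 \<le> \<zeta> v" "\<zeta> v \<le> 1" for v unfolding \<zeta>_def by (intro smooth_step_simps; simp)+
  have z0: "\<zeta> v = 0" if "\<bar>v\<bar> \<ge> r" for v
  proof -
    have "1 \<le> \<bar>v / r\<bar>" using that r by simp
    then have "1 \<le> \<bar>v / r\<bar> * \<bar>v / r\<bar>" by (metis mult_mono' mult_1 zero_le_one)
    then have "1 - (v / r) * (v / r) \<le> 0" by (simp add: abs_mult[symmetric])
    then show ?thesis by (simp add: \<zeta>_def smooth_step_simps max_def)
  qed
  have zmono: "\<zeta> w \<le> \<zeta> v" if "\<bar>v\<bar> \<le> \<bar>w\<bar>" for v w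
  proof -
    have "\<bar>v / r\<bar> \<le> \<bar>w / r\<bar>" using that r by (simp add: divide_right_mono)
    then have "\<bar>v / r\<bar> * \<bar>v / r\<bar> \<le> \<bar>w / r\<bar> * \<bar>w / r\<bar>" by (intro mult_mono) auto
    then have "(v / r) * (v / r) \<le> (w / r) * (w / r)" by (simp add: abs_mult[symmetric])
    then show ?thesis unfolding \<zeta>_def by (intro smooth_step_mono mult_left_mono power_mono max.mono) auto
  qed
  have z1: "\<zeta> v = 1" if "\<bar>v\<bar> \<le> r / 2" for v
  proof -
    have "\<bar>v / r\<bar> \<le> 1 / 2" using that r by (simp add: field_simps)
    then have "\<bar>v / r\<bar> * \<bar>v / r\<bar> \<le> 1 / 2 * (1 / 2)" by (intro mult_mono) auto
    then have "(v / r) * (v / r) \<le> 1 / 4" by (simp only: abs_mult_self_eq)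
    then have "3 / 4 \<le> max 0 (1 - (v / r) * (v / r))" by linarith
    then have "(3 / 4)\<^sup>2 \<le> (max 0 (1 - (v / r) * (v / r)))\<^sup>2" by (rule power_mono) simp
    moreover have "(3 / 4 :: real)\<^sup>2 = 9 / 16" by (simp add: power2_eq_square)
    ultimately have "1 \<le> 2 * (max 0 (1 - (v / r) * (v / r)))\<^sup>2" by linarith
    then show ?thesis unfolding \<zeta>_def by (rule smooth_step_simps(2))
  qed
  have zc: "c11_at \<zeta> v" for v
    unfolding \<zeta>_def divide_inverse by (intro c11_at_smooth_step c11_at_intros)
  define b where "b = (\<lambda>p. \<beta> (snd p) * \<zeta> (fst p))"
  have bc: "c11_at b p" for p :: "real \<times> 'a"
    unfolding b_def by (intro c11_at_mult c11_at_compose[OF c11_at_snd[OF c11_at_id] \<beta>(1)] c11_at_compose[OF c11_at_fst[OF c11_at_id] zc])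
  have bsupp: "b p = 0" if "p \<notin> {-r..r} \<times> S" for p
  proof -
    have "snd p \<notin> S \<or> r \<le> \<bar>fst p\<bar>" using that by (cases p) auto
    then show ?thesis using S(3)[of "snd p"] z0[of "fst p"] by (auto simp: b_def)
  qed
  have cut: "c11_on UNIV (\<lambda>p. b p *\<^sub>R F p)" "bounded (range (\<lambda>p. b p *\<^sub>R F p))"
    if F: "\<And>v x. x \<in> U \<Longrightarrow> c11_at F (v, x)" for F :: "real \<times> 'a \<Rightarrow> 'c::real_normed_vector"
  proof -
    have cS: "compact ({-r..r} \<times> S)" by (intro compact_Times S) auto
    have at: "c11_at (\<lambda>p. b p *\<^sub>R F p) p" for p
    proof (cases "snd p \<in> U")
      case True
      then show ?thesis using F[of "snd p" "fst p"] by (intro c11_at_scaleR bc) auto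
    next
      case False
      have "c11_at (\<lambda>p. 0 :: 'c) p" by (rule c11_at_const)
      then show ?thesis
      proof (rule c11_at_cong)
        show "open (- ({-r..r} \<times> S))" using cS by (auto intro: compact_imp_closed)
        show "p \<in> - ({-r..r} \<times> S)" using False S by (cases p) auto
      qed (simp add: bsupp)
    qed
    show "c11_on UNIV (\<lambda>p. b p *\<^sub>R F p)" "bounded (range (\<lambda>p. b p *\<^sub>R F p))"
      by (rule c11_on_UNIV_compact_support[OF at cS]; simp add: bsupp)+
  qed
  have \<phi>c: "c11_at \<phi> (v, x)" if x: "x \<in> U" for v x
  proof (rule c11_at_cong[where U="UNIV \<times> U"])
    show "c11_at (\<lambda>p. \<Sum>i\<in>J. T i (fst p) * m i (snd p)) (v, x)"
      using x by (intro c11_at_sum fin c11_at_mult c11_at_compose[OF c11_at_snd[OF c11_at_id]]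
          c11_at_compose[OF c11_at_fst[OF c11_at_id]] T m) auto
  qed (use x U \<phi> in \<open>auto intro: open_Times\<close>)
  \<comment> \<open>The field \<open>A * v + N1\<close> equals \<open>\<sigma> * \<phi>\<close> near
    the branch and the linear field \<open>A * v\<close> far away; in between its slope in v is
    still at least c by \<open>cutoff_slope\<close>. The sign \<sigma> reverses time on attracting
    branches.\<close>
  define N1 where "N1 = (\<lambda>p. b p *\<^sub>R (\<sigma> * \<phi> p - A * fst p))"
  define N2 where "N2 = (\<lambda>p. b p *\<^sub>R k p)"
  define N3 where "N3 = (\<lambda>p. b p *\<^sub>R g p)"
  have "c11_on UNIV N1" unfolding N1_def
    by (intro cut c11_at_diff c11_at_mult c11_at_const \<phi>c c11_at_fst c11_at_id)
  then obtain L1 where L1: "L1 \<ge> 0" "\<And>a b. norm (N1 a - N1 b) \<le> L1 * norm (a - b)"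
    "\<And>z y. norm (N1 (z + y) + N1 (z - y) - 2 *\<^sub>R N1 z) \<le> L1 * (norm y)\<^sup>2"
    by (rule c11_on_weaken) blast
  have "c11_on UNIV N2" unfolding N2_def by (intro cut k)
  then obtain L2 where L2: "L2 \<ge> 0" "\<And>a b. norm (N2 a - N2 b) \<le> L2 * norm (a - b)"
    "\<And>z y. norm (N2 (z + y) + N2 (z - y) - 2 *\<^sub>R N2 z) \<le> L2 * (norm y)\<^sup>2"
    by (rule c11_on_weaken) blast
  have "c11_on UNIV N3" unfolding N3_def by (intro cut g)
  then obtain L3 where L3: "L3 \<ge> 0" "\<And>a b. norm (N3 a - N3 b) \<le> L3 * norm (a - b)"
    "\<And>z y. norm (N3 (z + y) + N3 (z - y) - 2 *\<^sub>R N3 z) \<le> L3 * (norm y)\<^sup>2"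
    by (rule c11_on_weaken) blast
  have "bounded (range N2)" unfolding N2_def by (intro cut k)
  then obtain M2 where M2: "M2 > 0" "\<And>p. \<bar>N2 p\<bar> \<le> M2" by (auto simp: bounded_pos)
  have slowcut: "\<exists>M\<ge>0. \<forall>x y. \<bar>\<beta> x * f x - \<beta> y * f y\<bar> \<le> M * norm (x - y)"
    if f: "\<And>x. x \<in> U \<Longrightarrow> c11_at f x" for f
  proof -
    have at: "c11_at (\<lambda>x. \<beta> x * f x) x" for x
    proof (cases "x \<in> U")
      case False
      have "c11_at (\<lambda>p. 0 :: real) x" by (rule c11_at_const)
      then show ?thesis
        by (rule c11_at_cong[where U="- S"]) (use False S in \<open>auto intro: compact_imp_closed\<close>)
    qed (intro c11_at_mult \<beta> f)
    have "c11_on UNIV (\<lambda>x. \<beta> x * f x)"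
      by (rule c11_on_UNIV_compact_support[OF at S(1)]) (simp add: S)
    then show ?thesis by (rule c11_on_weaken) auto
  qed
  have "\<forall>i\<in>J. \<exists>M\<ge>0. \<forall>x y. \<bar>\<beta> x * m i x - \<beta> y * m i y\<bar> \<le> M * norm (x - y)"
    by (intro ballI slowcut m)
  then obtain M where M: "\<And>i. i \<in> J \<Longrightarrow> M i \<ge> 0"
    "\<And>i x y. i \<in> J \<Longrightarrow> \<bar>\<beta> x * m i x - \<beta> y * m i y\<bar> \<le> M i * norm (x - y)"
    by metis
  obtain M0 where M0: "M0 \<ge> 0" "\<And>x y. \<bar>\<beta> x - \<beta> y\<bar> \<le> M0 * norm (x - y)"
    using slowcut[of "\<lambda>x. 1"] by (auto intro: c11_at_const)
  obtain x0 where x0: "x0 \<in> U" using False U by blast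
  have A: "A \<ge> c" 
  proof -
    have "c * (r - 0) \<le> \<sigma> * (\<phi> (r, x0) - \<phi> (0, x0)) \<and> \<sigma> * (\<phi> (r, x0) - \<phi> (0, x0)) \<le> A * (r - 0)"
      by (rule slope[OF x0]) (use r in auto)
    then have "c * r \<le> A * r" by (metis diff_zero order_trans)
    then show ?thesis by (rule mult_right_le_imp_le) (rule r)
  qed
  define H where "H = (\<Sum>i\<in>J. 2 * M i) + A * M0"
  have H: "H \<ge> 0" unfolding H_def using M M0 A c by (intro add_nonneg_nonneg sum_nonneg) auto
  have \<sigma>abs: "\<bar>\<sigma>\<bar> = 1" "\<sigma> * \<sigma> = 1" using \<sigma> by auto
  \<comment> \<open>Besides the bounded factor \<open>\<zeta> v\<close>, the factors
    \<open>T i v\<close> and \<open>A * v\<close> are O(|v|), and what they multiply is Lipschitz in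
    x. This becomes the locale assumption on x-differences, whose constant vanishes with v and
    eps.\<close>
  have N1x: "\<bar>N1 (v, x) - N1 (v, x')\<bar> \<le> H * \<bar>v\<bar> * norm (x - x')" for v x x'
  proof -
    have \<beta>\<phi>: "\<beta> x * \<phi> (v, x) = (\<Sum>i\<in>J. T i v * (\<beta> x * m i x))" for x
    proof (cases "x \<in> U")
      case True
      then show ?thesis by (simp add: \<phi> sum_distrib_left mult_ac)
    next
      case False
      then have "\<beta> x = 0" using S by blast
      then show ?thesis by simp
    qed
    have "N1 (v, x) - N1 (v, x') = \<zeta> v * (\<sigma> * (\<beta> x * \<phi> (v, x) - \<beta> x' * \<phi> (v, x')) - A * v * (\<beta> x - \<beta> x'))"
      by (simp add: N1_def b_def algebra_simps)
    also have "\<beta> x * \<phi> (v, x) - \<beta> x' * \<phi> (v, x') = (\<Sum>i\<in>J. T i v * (\<beta> x * m i x - \<beta> x' * m i x'))"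
      unfolding \<beta>\<phi> by (simp add: sum_subtractf right_diff_distrib)
    finally have "\<bar>N1 (v, x) - N1 (v, x')\<bar> =
        \<bar>\<zeta> v\<bar> * \<bar>\<sigma> * (\<Sum>i\<in>J. T i v * (\<beta> x * m i x - \<beta> x' * m i x')) - A * v * (\<beta> x - \<beta> x')\<bar>"
      by (simp add: abs_mult)
    also have "\<dots> \<le> 1 * \<bar>\<sigma> * (\<Sum>i\<in>J. T i v * (\<beta> x * m i x - \<beta> x' * m i x')) - A * v * (\<beta> x - \<beta> x')\<bar>"
      using z01 by (intro mult_right_mono) auto
    also have "\<dots> \<le> \<bar>\<Sum>i\<in>J. T i v * (\<beta> x * m i x - \<beta> x' * m i x')\<bar> + \<bar>A * v * (\<beta> x - \<beta> x')\<bar>"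
      using \<sigma> by auto
    also have "\<dots> \<le> (\<Sum>i\<in>J. (2 * \<bar>v\<bar>) * (M i * norm (x - x'))) + (A * \<bar>v\<bar>) * (M0 * norm (x - x'))"
    proof (intro add_mono)
      show "\<bar>\<Sum>i\<in>J. T i v * (\<beta> x * m i x - \<beta> x' * m i x')\<bar> \<le> (\<Sum>i\<in>J. (2 * \<bar>v\<bar>) * (M i * norm (x - x')))"
        by (intro order_trans[OF sum_abs] sum_mono) (auto simp: abs_mult intro!: mult_mono T M)
      show "\<bar>A * v * (\<beta> x - \<beta> x')\<bar> \<le> (A * \<bar>v\<bar>) * (M0 * norm (x - x'))"
        using A c M0 by (auto simp: abs_mult intro!: mult_mono)
    qed
    also have "\<dots> = H * \<bar>v\<bar> * norm (x - x')"
      by (simp add: H_def sum_distrib_right sum_distrib_left algebra_simps)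
    finally show ?thesis .
  qed
  define L where "L = A + L1 + L2 + L3 + M2 + H + 1"
  have L: "L > 0" "A + L1 + L2 \<le> L" "L1 + L2 \<le> L" "L3 \<le> L" "M2 \<le> L" "H \<le> L" "L2 \<le> L"
    using A c L1(1) L2(1) L3(1) M2(1) H by (auto simp: L_def)
  \<comment> \<open>Half of the rate c is reserved for the perturbation \<open>eps * N2\<close>,
    whose slope in v is at most \<open>eps * L\<close>.\<close>
  define c' where "c' = c / 2"
  have c': "c' > 0" using c by (simp add: c'_def)
  \<comment> \<open>The bounds make, in turn, eps at most 1, the slope \<open>eps * L\<close> of the
    perturbation at most c', the two smallness conditions of the locale true, and the strip width
    \<rho> at most r / 2, where \<zeta> is 1.\<close>
  define e0 where "e0 = Min {1, c' / L, c' / (2 * L * (2 * L / c' + 1)), c' / (2 * L * (12 + 8 * L / c')), r * c' / (4 * L)}"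
  have pos: "2 * L * (2 * L / c' + 1) > 0" "2 * L * (12 + 8 * L / c') > 0"
    using L c' by (auto intro!: mult_pos_pos add_pos_pos divide_pos_pos)
  have e0: "e0 > 0" unfolding e0_def using L c' r pos by simp
  have le: "eps \<le> 1" "eps * L \<le> c'" "eps * (2 * L * (2 * L / c' + 1)) \<le> c'"
    "eps * (2 * L * (12 + 8 * L / c')) \<le> c'" "2 * L * eps / c' \<le> r / 2" if "eps < e0" for eps
  proof -
    have *: "eps \<le> 1" "eps \<le> c' / L" "eps \<le> c' / (2 * L * (2 * L / c' + 1))"
       "eps \<le> c' / (2 * L * (12 + 8 * L / c'))" "eps \<le> r * c' / (4 * L)"
      using that unfolding e0_def by auto
    show "eps \<le> 1" "eps * L \<le> c'" using * L by (auto simp: field_simps)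
    show "eps * (2 * L * (2 * L / c' + 1)) \<le> c'" "eps * (2 * L * (12 + 8 * L / c')) \<le> c'"
      using *(3,4) pos by (simp_all only: pos_le_divide_eq)
    show "2 * L * eps / c' \<le> r / 2" using *(5) L c' by (simp add: field_simps)
  qed
  define C where "C = 2 * L / c' + 2 * (L * (2 * L / c' + 1)) / c'"
  have C: "C \<ge> 0" "2 * L / c' \<le> C" "2 * (L * (2 * L / c' + 1)) / c' \<le> C"
    using L c' by (auto simp: C_def)
  show ?thesis
  proof (rule that[OF e0 C(1) O1(1,2)])
    fix eps assume "eps \<in> {0<..<e0}"
    then have eps': "eps > 0" "eps < e0" by auto
    define P where "P = (\<lambda>p. A * fst p + N1 p - \<sigma> * eps * N2 p)"
    define Q where "Q = (\<lambda>p. \<sigma> *\<^sub>R N3 p)"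
    have eN2: "\<bar>\<sigma> * eps * d\<bar> \<le> \<bar>d\<bar>" for d
      using le(1)[OF eps'(2)] eps' \<sigma>abs by (simp add: abs_mult mult_left_le_one_le)
    interpret expanding_system P Q eps c' L
    proof
      show "\<bar>P p - P q\<bar> \<le> L * norm (p - q)" for p q
      proof -
        have "P p - P q = A * (fst p - fst q) + (N1 p - N1 q) - \<sigma> * eps * (N2 p - N2 q)"
          by (simp add: P_def algebra_simps)
        then have "\<bar>P p - P q\<bar> \<le> \<bar>A * (fst p - fst q)\<bar> + \<bar>N1 p - N1 q\<bar> + \<bar>N2 p - N2 q\<bar>"
          using eN2[of "N2 p - N2 q"] by linarith
        also have "\<dots> \<le> A * norm (p - q) + L1 * norm (p - q) + L2 * norm (p - q)"
          using L1(2)[of p q] L2(2)[of p q] dist_fst_le[of p q] A c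
          by (intro add_mono) (auto simp: abs_mult dist_norm intro!: mult_left_mono)
        also have "\<dots> = (A + L1 + L2) * norm (p - q)" by (simp add: algebra_simps)
        also have "\<dots> \<le> L * norm (p - q)" using L by (intro mult_right_mono) auto
        finally show ?thesis .
      qed
      show "\<bar>P (z + y) + P (z - y) - 2 * P z\<bar> \<le> L * (norm y)\<^sup>2" for z y
      proof -
        have "P (z + y) + P (z - y) - 2 * P z = (N1 (z + y) + N1 (z - y) - 2 * N1 z)
           - \<sigma> * eps * (N2 (z + y) + N2 (z - y) - 2 * N2 z)"
          by (simp add: P_def algebra_simps)
        then have "\<bar>P (z + y) + P (z - y) - 2 * P z\<bar> \<le> \<bar>N1 (z + y) + N1 (z - y) - 2 * N1 z\<bar>
           + \<bar>N2 (z + y) + N2 (z - y) - 2 * N2 z\<bar>"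
          using eN2[of "N2 (z + y) + N2 (z - y) - 2 * N2 z"] by linarith
        also have "\<dots> \<le> (L1 + L2) * (norm y)\<^sup>2"
          using L1(3)[of z y] L2(3)[of z y] by (simp add: algebra_simps)
        also have "\<dots> \<le> L * (norm y)\<^sup>2" using L by (intro mult_right_mono) auto
        finally show ?thesis .
      qed
      show "norm (Q p - Q q) \<le> L * norm (p - q)" for p q
      proof -
        have "norm (Q p - Q q) = norm (N3 p - N3 q)"
          using \<sigma>abs by (simp add: Q_def flip: scaleR_diff_right)
        also have "\<dots> \<le> L3 * norm (p - q)" by (rule L3)
        also have "\<dots> \<le> L * norm (p - q)" using L by (intro mult_right_mono) auto
        finally show ?thesis .
      qed
      show "norm (Q (z + y) + Q (z - y) - 2 *\<^sub>R Q z) \<le> L * (norm y)\<^sup>2" for z y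
      proof -
        have "Q (z + y) + Q (z - y) - 2 *\<^sub>R Q z = \<sigma> *\<^sub>R (N3 (z + y) + N3 (z - y) - 2 *\<^sub>R N3 z)"
          by (simp add: Q_def algebra_simps)
        then have "norm (Q (z + y) + Q (z - y) - 2 *\<^sub>R Q z) = norm (N3 (z + y) + N3 (z - y) - 2 *\<^sub>R N3 z)"
          using \<sigma>abs by simp
        also have "\<dots> \<le> L3 * (norm y)\<^sup>2" by (rule L3)
        also have "\<dots> \<le> L * (norm y)\<^sup>2" using L by (intro mult_right_mono) auto
        finally show ?thesis .
      qed
      show "c' * (v - w) \<le> P (v, x) - P (w, x)" if wv: "w \<le> v" for v w x
      proof -
        have N1': "A * (v - w) + N1 (v, x) - N1 (w, x) \<ge> c * (v - w)"
        proof (cases "x \<in> U")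
          case True
          define \<psi> where "\<psi> = (\<lambda>v. A * v - \<sigma> * \<phi> (v, x))"
          have \<phi>0: "\<phi> (0, x) = 0" using T(2)[of _ 0] by (simp add: \<phi>[OF True])
          have cs: "\<zeta> v * \<psi> v - \<zeta> w * \<psi> w \<le> (A - c) * (v - w)"
          proof (rule cutoff_slope[where r=r])
            fix v w assume "- r \<le> w" "w \<le> v" "v \<le> r"
            from slope[OF True this] show "0 \<le> \<psi> v - \<psi> w \<and> \<psi> v - \<psi> w \<le> (A - c) * (v - w)"
              by (simp add: \<psi>_def algebra_simps)
          qed (use A r z01 z0 zmono wv \<phi>0 in \<open>auto simp: \<psi>_def\<close>)
          have "\<beta> x * (\<zeta> v * \<psi> v - \<zeta> w * \<psi> w) \<le> \<beta> x * ((A - c) * (v - w))"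
            using cs \<beta> by (intro mult_left_mono) auto
          also have "\<dots> \<le> 1 * ((A - c) * (v - w))" using \<beta> A wv by (intro mult_right_mono) auto
          finally have 1: "\<beta> x * (\<zeta> v * \<psi> v - \<zeta> w * \<psi> w) \<le> (A - c) * (v - w)" by simp
          have "N1 (v, x) - N1 (w, x) = - (\<beta> x * (\<zeta> v * \<psi> v - \<zeta> w * \<psi> w))"
            by (simp add: N1_def b_def \<psi>_def algebra_simps)
          with 1 have "N1 (v, x) - N1 (w, x) \<ge> - ((A - c) * (v - w))" by linarith
          then show ?thesis by (simp add: algebra_simps)
        next
          case False
          then have "\<beta> x = 0" using S by blast
          then show ?thesis using A wv by (simp add: N1_def b_def mult_right_mono)
        qed
        have "\<bar>N2 (v, x) - N2 (w, x)\<bar> \<le> L2 * (v - w)"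
          using L2(2)[of "(v, x)" "(w, x)"] wv by (simp add: norm_Pair)
        also have "\<dots> \<le> L * (v - w)" using L wv by (intro mult_right_mono) auto
        finally have "\<bar>\<sigma> * eps * (N2 (v, x) - N2 (w, x))\<bar> \<le> eps * (L * (v - w))"
          using eps' \<sigma>abs by (simp add: abs_mult mult_left_mono)
        also have "\<dots> = (eps * L) * (v - w)" by simp
        also have "\<dots> \<le> c' * (v - w)" using le(2)[OF eps'(2)] wv by (intro mult_right_mono) auto
        finally have 2: "\<bar>\<sigma> * eps * (N2 (v, x) - N2 (w, x))\<bar> \<le> c' * (v - w)" .
        have "P (v, x) - P (w, x) = (A * (v - w) + N1 (v, x) - N1 (w, x)) - \<sigma> * eps * (N2 (v, x) - N2 (w, x))"
          by (simp add: P_def algebra_simps)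
        moreover have "c * (v - w) = c' * (v - w) + c' * (v - w)" by (simp add: c'_def)
        ultimately show ?thesis using N1' 2 by linarith
      qed
      show "\<bar>P (0, x)\<bar> \<le> L * eps" for x
      proof -
        have "b (0, x) * \<phi> (0, x) = 0"
          using T(2)[of _ 0] \<phi>[of x 0] S by (cases "x \<in> U") (auto simp: b_def)
        then have "P (0, x) = - (\<sigma> * eps * N2 (0, x))" by (auto simp: P_def N1_def)
        then have "\<bar>P (0, x)\<bar> = eps * \<bar>N2 (0, x)\<bar>" using eps' \<sigma>abs by (simp add: abs_mult)
        also have "\<dots> \<le> eps * L" using M2(2)[of "(0, x)"] L eps' by (intro mult_left_mono) auto
        finally show ?thesis by (simp add: mult.commute)
      qed
      show "\<bar>P (v, x) - P (v, x')\<bar> \<le> L * (\<bar>v\<bar> + eps) * norm (x - x')" for v x x'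
      proof -
        have "P (v, x) - P (v, x') = (N1 (v, x) - N1 (v, x')) - \<sigma> * eps * (N2 (v, x) - N2 (v, x'))"
          by (simp add: P_def algebra_simps)
        then have "\<bar>P (v, x) - P (v, x')\<bar> \<le> \<bar>N1 (v, x) - N1 (v, x')\<bar> + \<bar>\<sigma> * eps * (N2 (v, x) - N2 (v, x'))\<bar>"
          by linarith
        also have "\<bar>\<sigma> * eps * (N2 (v, x) - N2 (v, x'))\<bar> = eps * \<bar>N2 (v, x) - N2 (v, x')\<bar>"
          using eps' \<sigma>abs by (simp add: abs_mult)
        also have "\<dots> \<le> eps * (L2 * norm (x - x'))"
          using L2(2)[of "(v, x)" "(v, x')"] eps' by (intro mult_left_mono) (auto simp: norm_Pair)
        also have "\<bar>N1 (v, x) - N1 (v, x')\<bar> \<le> H * \<bar>v\<bar> * norm (x - x')" by (rule N1x)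
        also have "H * \<bar>v\<bar> * norm (x - x') + eps * (L2 * norm (x - x')) \<le>
            L * \<bar>v\<bar> * norm (x - x') + eps * (L * norm (x - x'))"
          using L eps' by (intro add_mono mult_right_mono mult_left_mono) auto
        finally show ?thesis by (simp add: algebra_simps)
      qed
    qed (use eps' c' L le in auto)
    obtain V p where V: "\<And>x. \<bar>V x\<bar> \<le> \<rho>" "\<And>x. GDERIV V x :> p x" "\<And>x. norm (p x) \<le> \<kappa>"
      "continuous_on UNIV p" "\<And>x. P (V x, x) = eps * (Q (V x, x) \<bullet> p x)"
      using invariant_graph by blast
    have r': "\<rho> \<le> C * eps" "\<kappa> \<le> C * eps"
      using C eps' unfolding \<rho>_def \<kappa>_def coupling_def
      by (auto simp: mult_right_mono simp flip: times_divide_eq_left)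
    have "\<phi> (V x, x) = eps * (k (V x, x) + g (V x, x) \<bullet> p x)" if x: "x \<in> O1" for x
    proof -
      have "\<bar>V x\<bar> \<le> r / 2" using V(1)[of x] le(5)[OF eps'(2)] by (simp add: \<rho>_def)
      then have "b (V x, x) = 1" using z1 O1(3)[OF x] by (simp add: b_def)
      then have "\<sigma> * \<phi> (V x, x) - \<sigma> * eps * k (V x, x) = eps * (\<sigma> * (g (V x, x) \<bullet> p x))"
        using V(5)[of x] by (simp add: P_def Q_def N1_def N2_def N3_def)
      then have "\<sigma> * \<phi> (V x, x) = \<sigma> * (eps * (k (V x, x) + g (V x, x) \<bullet> p x))"
        by (simp add: algebra_simps)
      then show ?thesis using \<sigma> by auto
    qed
    then show "\<exists>V p. continuous_on UNIV p \<and>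
       (\<forall>x. GDERIV V x :> p x \<and> \<bar>V x\<bar> \<le> C * eps \<and> norm (p x) \<le> C * eps) \<and>
       (\<forall>x\<in>O1. \<phi> (V x, x) = eps * (k (V x, x) + g (V x, x) \<bullet> p x))"
    proof (intro exI[of _ V] exI[of _ p] conjI allI ballI V)
      show "\<bar>V x\<bar> \<le> C * eps" "norm (p x) \<le> C * eps" for x using V(1,3)[of x] r' by linarith+
    qed auto
  qed
qed

section \<open>Branches of the critical set\<close>

lemma fast_rhs_eq:
  "fast_rhs I (w, x) = - sin (fst x + w) * (I (snd (snd x)) - fst (snd x) * cos (fst x + w))"
  by (cases x) auto

lemma slow_rhs_eq:
  "slow_rhs I lam eta (w, x) =
    (lam * w, eta * cos (fst x + w) * (I (snd (snd x)) - fst (snd x) * cos (fst x + w)), 1)"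
  by (cases x) auto

text \<open>The derivative of the fast component in \<omega>, as a function of the phase
  \<open>u = \<Omega> + \<omega>\<close>.\<close>

definition fast_slope :: "(real \<Rightarrow> real) \<Rightarrow> real \<Rightarrow> slow \<Rightarrow> real" where
  "fast_slope I u x = - cos u * (I (snd (snd x)) - fst (snd x) * cos u) - fst (snd x) * (sin u)\<^sup>2"

lemma fast_rhs_has_derivative:
  "((\<lambda>w. fast_rhs I (w, x)) has_real_derivative fast_slope I (fst x + w) x) (at w)"
  unfolding fast_rhs_eq fast_slope_def
  by (auto intro!: derivative_eq_intros simp: power2_eq_square algebra_simps)

lemma smooth_derivs:
  assumes "smooth I"
  shows "(I has_real_derivative deriv I x) (at x)"
    "(deriv I has_real_derivative deriv (deriv I) x) (at x)"
    "(deriv (deriv I) has_real_derivative deriv (deriv (deriv I)) x) (at x)"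
    "isCont I x" "isCont (deriv (deriv I)) x" "isCont (deriv (deriv (deriv I))) x"
proof -
  have d: "(deriv ^^ n) I differentiable (at x)" for n x using assms by (simp add: smooth_def)
  have *: "I differentiable (at x)" "deriv I differentiable (at x)" "deriv (deriv I) differentiable (at x)"
    "deriv (deriv (deriv I)) differentiable (at x)"
    using d[of 0 x] d[of 1 x] d[of 2 x] d[of 3 x] by (simp_all add: numeral_2_eq_2 numeral_3_eq_3)
  then show "(I has_real_derivative deriv I x) (at x)"
    "(deriv I has_real_derivative deriv (deriv I) x) (at x)"
    "(deriv (deriv I) has_real_derivative deriv (deriv (deriv I)) x) (at x)"
    by (simp_all add: DERIV_deriv_iff_real_differentiable)
  show "isCont I x" "isCont (deriv (deriv I)) x" "isCont (deriv (deriv (deriv I))) x"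
    using * by (auto intro: differentiable_imp_continuous_within)
qed

text \<open>The derivative of I is included because it enters the gradient of the branches on which
  \<open>\<alpha> * cos u = I \<theta>\<close>.\<close>

lemma smooth_c11:
  assumes "smooth I" "c11_at f x"
  shows "c11_at (\<lambda>x. I (f x)) x" "c11_at (\<lambda>x. deriv I (f x)) x"
  by (rule c11_at_compose[OF assms(2)], rule c11_at_real_C2[where U=UNIV]; (rule smooth_derivs[OF assms(1)] open_UNIV UNIV_I))
    (rule c11_at_compose[OF assms(2)], rule c11_at_real_C2[where U=UNIV]; (rule smooth_derivs[OF assms(1)] open_UNIV UNIV_I))

lemma abs_cos_minus_one_le: "\<bar>cos v - 1\<bar> \<le> \<bar>v::real\<bar>"
proof -
  have "cos v = 1 - 2 * (sin (v / 2))\<^sup>2" using cos_double_sin[of "v / 2"] by simp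
  then have "\<bar>cos v - 1\<bar> = 2 * (\<bar>sin (v / 2)\<bar> * \<bar>sin (v / 2)\<bar>)" by (simp add: power2_eq_square abs_mult)
  also have "\<dots> \<le> 2 * (1 * \<bar>v / 2\<bar>)"
    by (intro mult_left_mono mult_mono abs_sin_le_one abs_sin_x_le_abs_x) auto
  finally show ?thesis by simp
qed

lemma c11_at_if: "c11_at F x \<Longrightarrow> c11_at G x \<Longrightarrow> c11_at (\<lambda>x. if b then F x else G x) x"
  by (cases b) simp_all

text \<open>Coefficients of the expansion of the fast component about a branch \<open>u\<close> of its zeros in the
  functions \<open>sin v\<close>, \<open>cos v - 1\<close>, \<open>sin (2 v)\<close>, \<open>cos (2 v) - 1\<close> of the deviation \<open>v\<close>.\<close>

definition trig :: "nat \<Rightarrow> real \<Rightarrow> real" where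
  "trig i v = (if i = 0 then sin v else if i = 1 then cos v - 1 else if i = 2 then sin (2 * v) else cos (2 * v) - 1)"

definition trig_coeff :: "(real \<Rightarrow> real) \<Rightarrow> (slow \<Rightarrow> real) \<Rightarrow> nat \<Rightarrow> slow \<Rightarrow> real" where
  "trig_coeff I u i x = (if i = 0 then - (I (snd (snd x)) * cos (u x)) else if i = 1 then - (I (snd (snd x)) * sin (u x))
     else if i = 2 then (1/2) * fst (snd x) * cos (2 * u x) else (1/2) * fst (snd x) * sin (2 * u x))"

text \<open>The fast component is a combination of the sines of the phase and of twice the phase.
  Subtracting its value 0 at v = 0 and using the addition theorem separates v from x, with every
  factor in v vanishing at v = 0.\<close>

lemma fast_rhs_trig_expansion:
  assumes "fast_rhs I (u x - fst x, x) = 0"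
  shows "fast_rhs I (u x - fst x + v, x) = (\<Sum>i\<in>{..<4}. trig i v * trig_coeff I u i x)"
proof -
  have f: "fast_rhs I (u x - fst x + v, x) = - I (snd (snd x)) * sin (u x + v) + (1/2) * fst (snd x) * sin (2 * u x + 2 * v)" for v
    using sin_double[of "u x + v"] by (simp add: fast_rhs_eq algebra_simps)
  have "fast_rhs I (u x - fst x + v, x) = fast_rhs I (u x - fst x + v, x) - fast_rhs I (u x - fst x + 0, x)"
    using assms by simp
  also have "\<dots> = - I (snd (snd x)) * (sin (u x + v) - sin (u x)) + (1/2) * fst (snd x) * (sin (2 * u x + 2 * v) - sin (2 * u x))"
    unfolding f by (simp add: algebra_simps)
  also have "\<dots> = (\<Sum>i\<in>{..<4}. trig i v * trig_coeff I u i x)"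
    by (simp add: lessThan_nat_numeral lessThan_Suc numeral_eq_Suc trig_def trig_coeff_def sin_add field_simps)
  finally show ?thesis .
qed

lemma GDERIV_coordinates:
  "GDERIV (\<lambda>x::slow. fst x) x :> (1, 0, 0)"
  "GDERIV (\<lambda>x::slow. fst (snd x)) x :> (0, 1, 0)"
  "GDERIV (\<lambda>x::slow. snd (snd x)) x :> (0, 0, 1)"
  unfolding gderiv_def by (auto intro!: derivative_eq_intros simp: inner_prod_def)

text \<open>A branch is given by its phase u, so \<open>h0\<close> is \<open>u - \<Omega>\<close>
  with gradient \<open>gu - (1, 0, 0)\<close>. Compactness extends the sign of the slope on K to
  uniform bounds c and A in a tube around the branch, as the cutoff argument requires.\<close>

theorem slow_pde_solution:
  assumes I: "smooth I" and K: "compact K" and U: "open U" "K \<subseteq> U"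
    and u: "\<And>x. x \<in> U \<Longrightarrow> GDERIV u x :> gu x" "\<And>x. x \<in> U \<Longrightarrow> c11_at u x" "\<And>x. x \<in> U \<Longrightarrow> c11_at gu x"
      "\<And>x. x \<in> U \<Longrightarrow> fast_rhs I (u x - fst x, x) = 0"
    and \<sigma>: "\<sigma> = 1 \<or> \<sigma> = (- 1::real)" and hyp: "\<And>x. x \<in> K \<Longrightarrow> \<sigma> * fast_slope I (u x) x > 0"
  obtains e0 C O' where "e0 > 0" "C \<ge> 0" "open O'" "K \<subseteq> O'"
    "\<And>eps. eps \<in> {0<..<e0} \<Longrightarrow> \<exists>h G. continuous_on O' G \<and>
       (\<forall>x\<in>O'. GDERIV h x :> G x \<and> \<bar>h x - (u x - fst x)\<bar> \<le> C * eps \<and> norm (G x - (gu x - (1, 0, 0))) \<le> C * eps \<and>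
          fast_rhs I (h x, x) = eps * (slow_rhs I lam eta (h x, x) \<bullet> G x))"
proof (cases "K = {}")
  case True
  then show ?thesis by (intro that[of 1 0 "{}"]) auto
next
  case False
  have cu: "continuous_on U u" using u(2) U(1) by (simp add: continuous_on_eq_continuous_at c11_at_imp_isCont)
  have cI: "continuous_on UNIV I" using smooth_derivs(4)[OF I] by (simp add: continuous_on_eq_continuous_at)
  have cs: "continuous_on (UNIV \<times> U) (\<lambda>p. \<sigma> * fast_slope I (u (snd p) + fst p) (snd p))"
    unfolding fast_slope_def
    by (intro continuous_intros continuous_on_compose2[OF cu] continuous_on_compose2[OF cI]) auto
  have csK: "continuous_on K (\<lambda>x. \<sigma> * fast_slope I (u x) x)"
    unfolding fast_slope_def
    by (intro continuous_intros continuous_on_compose2[OF cu] continuous_on_compose2[OF cI]) (use U in auto)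
  obtain a where a: "a \<in> K" "\<And>y. y \<in> K \<Longrightarrow> \<sigma> * fast_slope I (u a) a \<le> \<sigma> * fast_slope I (u y) y"
    using continuous_attains_inf[OF K False csK] by blast
  obtain b where b: "b \<in> K" "\<And>y. y \<in> K \<Longrightarrow> \<sigma> * fast_slope I (u y) y \<le> \<sigma> * fast_slope I (u b) b"
    using continuous_attains_sup[OF K False csK] by blast
  \<comment> \<open>Half the minimum and one more than the maximum of the slope leave room for an
    open neighbourhood of the branch.\<close>
  define c where "c = \<sigma> * fast_slope I (u a) a / 2"
  define A where "A = \<sigma> * fast_slope I (u b) b + 1"
  have c: "c > 0" using hyp a by (simp add: c_def)
  define W where "W = (UNIV \<times> U) \<inter> (\<lambda>p. \<sigma> * fast_slope I (u (snd p) + fst p) (snd p)) -` {c<..<A}"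
  have W: "open W" unfolding W_def
    by (rule continuous_open_preimage[OF cs]) (auto intro: open_Times U)
  have KW: "{0} \<times> K \<subseteq> W"
  proof
    fix p assume "p \<in> {0::real} \<times> K"
    then obtain y where y: "p = (0, y)" "y \<in> K" by auto
    then show "p \<in> W" using a(2)[OF y(2)] b(2)[OF y(2)] hyp[OF a(1)] U by (auto simp: W_def c_def A_def)
  qed
  have cK: "compact ({0::real} \<times> K)" by (intro compact_Times K) auto
  obtain e where e: "e > 0" "(\<Union>p\<in>{0} \<times> K. ball p e) \<subseteq> W"
    by (rule compact_subset_open_imp_ball_epsilon_subset[OF cK W KW])
  define U' where "U' = (\<Union>x\<in>K. ball x (e / 2))"
  \<comment> \<open>Radius e / 2 in x and e / 3 in v add up to less than e, so the tube over U' lies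
    in W.\<close>
  define r where "r = e / 3"
  have r: "r > 0" using e by (simp add: r_def)
  have inW: "(v, x) \<in> W" if x: "x \<in> U'" and v: "\<bar>v\<bar> \<le> r" for v x
  proof -
    obtain y where y: "y \<in> K" "dist y x < e / 2" using x by (auto simp: U'_def)
    have "dist (0, y) (v, x) \<le> dist 0 v + dist y x"
      using norm_Pair_le[of "0 - v" "y - x"] by (simp add: dist_norm)
    also have "\<dots> < e" using y v e by (simp add: r_def)
    finally have "(v, x) \<in> ball (0, y) e" by simp
    then show ?thesis using e(2) y(1) by blast
  qed
  have U'U: "x \<in> U" if "x \<in> U'" for x using inW[OF that, of 0] r by (auto simp: W_def)
  have U': "open U'" "K \<subseteq> U'" using e by (auto simp: U'_def intro!: bexI)
  \<comment> \<open>The vector field in the coordinate v, measured from the branch; k is the part of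
    \<open>slow_rhs \<bullet> G\<close> that comes from the gradient of the branch itself.\<close>
  define \<phi> where "\<phi> = (\<lambda>p. fast_rhs I (u (snd p) - fst (snd p) + fst p, snd p))"
  define g where "g = (\<lambda>p. slow_rhs I lam eta (u (snd p) - fst (snd p) + fst p, snd p))"
  define k where "k = (\<lambda>p. g p \<bullet> (gu (snd p) - (1, 0, 0)))"
  have gc: "c11_at g (v, x)" if "x \<in> U'" for v x
    unfolding g_def slow_rhs_eq
    by (intro c11_at_intros smooth_c11[OF I] c11_at_compose[OF c11_at_snd[OF c11_at_id], of u])
      (use that u U'U in auto)
  obtain e0 C O' where sg: "e0 > 0" "C \<ge> 0" "open O'" "K \<subseteq> O'"
    "\<And>eps. eps \<in> {0<..<e0} \<Longrightarrow> \<exists>V p. continuous_on UNIV p \<and>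
       (\<forall>x. GDERIV V x :> p x \<and> \<bar>V x\<bar> \<le> C * eps \<and> norm (p x) \<le> C * eps) \<and>
       (\<forall>x\<in>O'. \<phi> (V x, x) = eps * (k (V x, x) + g (V x, x) \<bullet> p x))"
  proof (rule slow_graph_exists[OF K U', where \<phi>=\<phi> and k=k and g=g and J="{..<4}" and T=trig and m="trig_coeff I u"
        and \<sigma>=\<sigma> and c=c and r=r and A=A])
    show "c11_at k (v, x)" if "x \<in> U'" for v x
      unfolding k_def
      by (intro c11_at_intros gc that c11_at_compose[OF c11_at_snd[OF c11_at_id], of gu])
        (use that u U'U in auto)
    show "\<phi> (v, x) = (\<Sum>i<4. trig i v * trig_coeff I u i x)" if "x \<in> U'" for v x
      unfolding \<phi>_def using fast_rhs_trig_expansion u(4)[OF U'U[OF that]] by simp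
    show "c11_at (trig i) v" for i v
      unfolding trig_def by (intro c11_at_if c11_at_intros)
    show "\<bar>trig i v\<bar> \<le> 2 * \<bar>v\<bar>" for i v
      using abs_sin_x_le_abs_x[of v] abs_cos_minus_one_le[of v] abs_sin_x_le_abs_x[of "2 * v"] abs_cos_minus_one_le[of "2 * v"]
      unfolding trig_def abs_mult by (simp split: if_split) linarith
    show "c11_at (trig_coeff I u i) x" if "x \<in> U'" for i x
      unfolding trig_coeff_def
      by (intro c11_at_if c11_at_intros smooth_c11[OF I] u(2)[OF U'U[OF that]])
    show "c * (v - w) \<le> \<sigma> * (\<phi> (v, x) - \<phi> (w, x)) \<and> \<sigma> * (\<phi> (v, x) - \<phi> (w, x)) \<le> A * (v - w)"
      if xU: "x \<in> U'" and wv: "- r \<le> w" "w \<le> v" "v \<le> r" for v w x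
    proof (cases "w = v")
      case False
      have "\<exists>z>w. z < v \<and> \<phi> (v, x) - \<phi> (w, x) = (v - w) * fast_slope I (u x + z) x"
      proof (rule MVT2)
        show "((\<lambda>v. \<phi> (v, x)) has_real_derivative fast_slope I (u x + z) x) (at z)" for z
        proof -
          have "((\<lambda>v. u x - fst x + v) has_real_derivative 1) (at z)" by (auto intro!: derivative_eq_intros)
          from DERIV_chain'[OF this fast_rhs_has_derivative[of I x]]
          show ?thesis by (simp add: \<phi>_def)
        qed
      qed (use False wv in simp)
      then obtain z where z: "w < z" "z < v" "\<phi> (v, x) - \<phi> (w, x) = (v - w) * fast_slope I (u x + z) x" by blast
      have "(z, x) \<in> W" using z wv by (intro inW xU) auto
      then have s: "c \<le> \<sigma> * fast_slope I (u x + z) x" "\<sigma> * fast_slope I (u x + z) x \<le> A" by (auto simp: W_def)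
      have "\<sigma> * (\<phi> (v, x) - \<phi> (w, x)) = (\<sigma> * fast_slope I (u x + z) x) * (v - w)" by (simp add: z(3))
      then show ?thesis using s wv by (simp only: mult_right_mono diff_ge_0_iff_ge)
    qed simp
  qed (use gc \<sigma> c r in auto)
  show ?thesis
  proof (rule that[of e0 C "O' \<inter> U'"])
    fix eps assume "eps \<in> {0<..<e0}"
    then obtain V p where V: "continuous_on UNIV p" "\<And>x. GDERIV V x :> p x" "\<And>x. \<bar>V x\<bar> \<le> C * eps" "\<And>x. norm (p x) \<le> C * eps"
      "\<And>x. x \<in> O' \<Longrightarrow> \<phi> (V x, x) = eps * (k (V x, x) + g (V x, x) \<bullet> p x)"
      using sg(5) by metis
    have "continuous_on U gu" using u(3) U(1) by (simp add: continuous_on_eq_continuous_at c11_at_imp_isCont)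
    then have "continuous_on (O' \<inter> U') (\<lambda>x. gu x - (1, 0, 0) + p x)"
      using V(1) U'U by (intro continuous_intros) (auto intro: continuous_on_subset)
    moreover have "GDERIV (\<lambda>x. u x - fst x + V x) x :> gu x - (1, 0, 0) + p x" if "x \<in> U'" for x
      by (intro GDERIV_add GDERIV_diff u V GDERIV_coordinates U'U that)
    moreover have "fast_rhs I (u x - fst x + V x, x) = eps * (slow_rhs I lam eta (u x - fst x + V x, x) \<bullet> (gu x - (1, 0, 0) + p x))"
      if "x \<in> O'" for x
      using V(5)[OF that] by (simp add: \<phi>_def k_def g_def inner_add_right)
    ultimately show "\<exists>h G. continuous_on (O' \<inter> U') G \<and>
       (\<forall>x\<in>O' \<inter> U'. GDERIV h x :> G x \<and> \<bar>h x - (u x - fst x)\<bar> \<le> C * eps \<and> norm (G x - (gu x - (1, 0, 0))) \<le> C * eps \<and>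
          fast_rhs I (h x, x) = eps * (slow_rhs I lam eta (h x, x) \<bullet> G x))"
      using V(3,4) by (intro exI[of _ "\<lambda>x. u x - fst x + V x"] exI[of _ "\<lambda>x. gu x - (1, 0, 0) + p x"]) auto
  qed (use sg U' in auto)
qed

section \<open>Classification of the normally hyperbolic branches\<close>

lemma normally_hyperbolic_zero_iff:
  "normally_hyperbolic_zero I (w, x) \<longleftrightarrow> fast_rhs I (w, x) = 0 \<and> fast_slope I (fst x + w) x \<noteq> 0"
  using DERIV_imp_deriv[OF fast_rhs_has_derivative[of I x w]] by (simp add: normally_hyperbolic_zero_def)

lemma minus_one_powi: "(- 1 :: real) powi k = (if even k then 1 else - 1)"
  by (simp add: power_int_minus_left)

lemma cos_int_pi: "cos (of_int k * pi) = (- 1 :: real) powi k"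
  and sin_int_pi: "sin (of_int k * pi) = (0 :: real)"
  using cos_npi_int[of k] sin_npi_int[of k] by (simp_all add: minus_one_powi mult.commute)

lemma fast_slope_pi: "fast_slope I (of_int k * pi) x = - ((- 1) powi k * I (snd (snd x)) - fst (snd x))"
  by (simp add: fast_slope_def cos_int_pi sin_int_pi minus_one_powi)

lemma fast_slope_F:
  "fst (snd x) * cos u = I (snd (snd x)) \<Longrightarrow> fast_slope I u x = - (fst (snd x) * (sin u)\<^sup>2)"
  by (simp add: fast_slope_def)

text \<open>The solution u of \<open>\<alpha> * cos u = I \<theta>\<close> between m pi and (m + 1)
  pi: a shift by m pi multiplies the cosine by \<open>(- 1) powi m\<close>. One formula thus covers
  every branch on which the sine does not vanish.\<close>

definition arccos_branch :: "(real \<Rightarrow> real) \<Rightarrow> int \<Rightarrow> slow \<Rightarrow> real" where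
  "arccos_branch I m x = of_int m * pi + arccos ((- 1) powi m * (I (snd (snd x)) * inverse (fst (snd x))))"

definition arccos_domain :: "(real \<Rightarrow> real) \<Rightarrow> slow set" where
  "arccos_domain I = {x. fst (snd x) \<noteq> 0 \<and> \<bar>I (snd (snd x)) * inverse (fst (snd x))\<bar> < 1}"

lemma arccos_branch_cos_sin:
  assumes "x \<in> arccos_domain I"
  shows "fst (snd x) * cos (arccos_branch I m x) = I (snd (snd x))" "sin (arccos_branch I m x) \<noteq> 0"
proof -
  let ?z = "(- 1) powi m * (I (snd (snd x)) * inverse (fst (snd x)))"
  have a: "\<bar>?z\<bar> < 1" "fst (snd x) \<noteq> 0" using assms by (auto simp: arccos_domain_def minus_one_powi)
  then have "cos (arccos ?z) = ?z" "sin (arccos ?z) > 0"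
    by (auto simp: sin_arccos_nonzero abs_less_iff intro: order.strict_implies_order) (auto intro!: sin_gt_zero arccos_lt_bounded simp: arccos_lt_bounded)
  then show "fst (snd x) * cos (arccos_branch I m x) = I (snd (snd x))" "sin (arccos_branch I m x) \<noteq> 0"
    using a unfolding arccos_branch_def by (auto simp: cos_add sin_add cos_int_pi sin_int_pi minus_one_powi)
qed

lemma arccos_branch_smooth:
  assumes I: "smooth I"
  shows "open (arccos_domain I)"
    "\<exists>gu. \<forall>x\<in>arccos_domain I. GDERIV (arccos_branch I m) x :> gu x \<and> c11_at (arccos_branch I m) x \<and> c11_at gu x"
proof -
  have cI: "continuous_on UNIV I" using smooth_derivs(4)[OF I] by (simp add: continuous_on_eq_continuous_at)
  have "arccos_domain I = {x. \<bar>I (snd (snd x))\<bar> < \<bar>fst (snd x)\<bar>}"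
    by (auto simp: arccos_domain_def abs_mult field_simps)
  then show "open (arccos_domain I)"
    by (auto intro!: open_Collect_less continuous_intros continuous_on_compose2[OF cI])
  define s where "s = (- 1 :: real) powi m"
  have s: "\<bar>s\<bar> = 1" by (simp add: s_def minus_one_powi)
  define z where "z = (\<lambda>x::slow. s * (I (snd (snd x)) * inverse (fst (snd x))))"
  define gz where "gz = (\<lambda>x::slow. s *\<^sub>R (I (snd (snd x)) *\<^sub>R (- (inverse (fst (snd x)) * inverse (fst (snd x))) *\<^sub>R (0, 1, 0))
      + inverse (fst (snd x)) *\<^sub>R (deriv I (snd (snd x)) *\<^sub>R ((0, 0, 1) :: slow))))"
  \<comment> \<open>The derivative of arccos at z is written with \<open>sin (arccos z)\<close> in
    place of a square root, so that gu is composed of functions already known to have bounded second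
    differences.\<close>
  define gu where "gu = (\<lambda>x::slow. (- inverse (sin (arccos (z x)))) *\<^sub>R gz x)"
  have "GDERIV (arccos_branch I m) x :> gu x \<and> c11_at (arccos_branch I m) x \<and> c11_at gu x"
    if x: "x \<in> arccos_domain I" for x
  proof -
    have a: "fst (snd x) \<noteq> 0" and zx: "\<bar>z x\<bar> < 1"
      using x s by (auto simp: arccos_domain_def z_def abs_mult)
    have sz: "sin (arccos (z x)) \<noteq> 0" using zx by (auto simp: sin_arccos_nonzero abs_less_iff)
    have 1: "GDERIV (\<lambda>x::slow. I (snd (snd x))) x :> deriv I (snd (snd x)) *\<^sub>R (0, 0, 1)"
      by (rule GDERIV_DERIV_compose[OF GDERIV_coordinates(3) smooth_derivs(1)[OF I]])
    have 2: "GDERIV (\<lambda>x::slow. inverse (fst (snd x))) x :> - (inverse (fst (snd x)) * inverse (fst (snd x))) *\<^sub>R (0, 1, 0)"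
      using GDERIV_inverse[OF GDERIV_coordinates(2)[of x] a] by (simp add: power2_eq_square)
    have "GDERIV z x :> gz x"
      unfolding z_def gz_def using GDERIV_mult[OF GDERIV_const[of s x] GDERIV_mult[OF 1 2]] by simp
    moreover have "(arccos has_real_derivative - inverse (sin (arccos (z x)))) (at (z x))"
      using DERIV_arccos[of "z x"] zx sin_arccos[of "z x"] by (auto simp: abs_less_iff)
    ultimately have "GDERIV (\<lambda>x. arccos (z x)) x :> gu x"
      unfolding gu_def by (rule GDERIV_DERIV_compose)
    then have "GDERIV (\<lambda>x. of_int m * pi + arccos (z x)) x :> 0 + gu x"
      by (intro GDERIV_add GDERIV_const)
    then have g: "GDERIV (arccos_branch I m) x :> gu x"
      by (simp add: arccos_branch_def[abs_def] z_def s_def)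
    have cz: "c11_at z x"
      unfolding z_def by (intro c11_at_intros smooth_c11[OF I] c11_at_inverse a)
    have ca: "c11_at (\<lambda>x. arccos (z x)) x" using zx by (intro c11_at_arccos cz) auto
    have "c11_at (\<lambda>x. of_int m * pi + arccos (z x)) x" by (intro c11_at_intros ca)
    then have "c11_at (arccos_branch I m) x"
      by (simp add: arccos_branch_def[abs_def] z_def s_def)
    moreover have "c11_at gu x"
      unfolding gu_def gz_def by (intro c11_at_intros ca c11_at_inverse sz a smooth_c11[OF I])
    ultimately show ?thesis using g by blast
  qed
  then show "\<exists>gu. \<forall>x\<in>arccos_domain I. GDERIV (arccos_branch I m) x :> gu x \<and> c11_at (arccos_branch I m) x \<and> c11_at gu x"
    by blast
qed

lemma connected_ivt_real:
  fixes f :: "'a::topological_space \<Rightarrow> real"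
  assumes "connected K" "continuous_on K f" "x \<in> K" "y \<in> K" "f x \<le> c" "c \<le> f y"
  shows "\<exists>z\<in>K. f z = c"
proof -
  have "connected (f ` K)" using assms by (intro connected_continuous_image)
  then have "c \<in> f ` K" using assms connectedD_interval[of "f ` K" "f x" "f y" c] by auto
  then show ?thesis by auto
qed

lemma connected_nonzero_sign:
  fixes f :: "'a::topological_space \<Rightarrow> real"
  assumes "connected K" "continuous_on K f" "\<And>x. x \<in> K \<Longrightarrow> f x \<noteq> 0"
  shows "(\<forall>x\<in>K. f x > 0) \<or> (\<forall>x\<in>K. f x < 0)"
proof (rule ccontr)
  assume "\<not> ?thesis"
  then obtain x y where "x \<in> K" "y \<in> K" "f x \<le> 0" "0 \<le> f y" by (auto simp: not_less)
  from connected_ivt_real[OF assms(1,2) this] assms(3) show False by auto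
qed

text \<open>At a normally hyperbolic zero exactly one of the factors \<open>sin u\<close> and
  \<open>J\<close> vanishes. Hence \<open>(sin u)\<^sup>2 - J\<^sup>2\<close> has no zero on the
  connected set K, and its sign selects the same factor everywhere. If it is positive, u avoids the
  multiples of pi and stays between two consecutive ones; if it is negative, u takes only multiples
  of pi as values and is constant.\<close>

lemma critical_branch_cases:
  assumes K: "connected K" "K \<noteq> {}" and h0: "continuous_on K h0" and cI: "continuous_on UNIV I"
    and nh: "\<forall>x\<in>K. normally_hyperbolic_zero I (h0 x, x)"
  obtains (minus) k where "\<And>x. x \<in> K \<Longrightarrow> h0 x = of_int k * pi - fst x"
      "\<And>x. x \<in> K \<Longrightarrow> fst (snd x) < (- 1) powi k * I (snd (snd x))"
  | (plus) k where "\<And>x. x \<in> K \<Longrightarrow> h0 x = of_int k * pi - fst x"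
      "\<And>x. x \<in> K \<Longrightarrow> fst (snd x) > (- 1) powi k * I (snd (snd x))"
  | (F) m where "\<And>x. x \<in> K \<Longrightarrow> h0 x = arccos_branch I m x - fst x" "K \<subseteq> arccos_domain I"
      "(\<forall>x\<in>K. fst (snd x) > 0) \<or> (\<forall>x\<in>K. fst (snd x) < 0)"
proof -
  define u where "u = (\<lambda>x. fst x + h0 x)"
  define J where "J = (\<lambda>x. I (snd (snd x)) - fst (snd x) * cos (u x))"
  have cu: "continuous_on K u" unfolding u_def by (intro continuous_intros h0)
  have cIK: "continuous_on K (\<lambda>x. I (snd (snd x)))" by (intro continuous_on_compose2[OF cI] continuous_intros) auto
  have cJ: "continuous_on K J" unfolding J_def by (intro continuous_intros cu cIK)
  have zero: "sin (u x) * J x = 0" and ne: "fast_slope I (u x) x \<noteq> 0" if "x \<in> K" for x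
    using bspec[OF nh that] unfolding normally_hyperbolic_zero_iff fast_rhs_eq by (auto simp: u_def J_def)
  have nb: "\<not> (sin (u x) = 0 \<and> J x = 0)" if "x \<in> K" for x
    using ne[OF that] by (auto simp: fast_slope_def J_def)
  have "(\<forall>x\<in>K. (sin (u x))\<^sup>2 - (J x)\<^sup>2 > 0) \<or> (\<forall>x\<in>K. (sin (u x))\<^sup>2 - (J x)\<^sup>2 < 0)"
  proof (rule connected_nonzero_sign[OF K(1)])
    show "continuous_on K (\<lambda>x. (sin (u x))\<^sup>2 - (J x)\<^sup>2)" by (intro continuous_intros cu cJ)
    show "(sin (u x))\<^sup>2 - (J x)\<^sup>2 \<noteq> 0" if "x \<in> K" for x using zero[OF that] nb[OF that] by auto
  qed
  then show ?thesis
  proof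
    assume "\<forall>x\<in>K. (sin (u x))\<^sup>2 - (J x)\<^sup>2 > 0"
    then have sn: "sin (u x) \<noteq> 0" and J0: "J x = 0" if "x \<in> K" for x
      using zero[OF that] that by (auto simp: not_less[symmetric])
    have aI: "fst (snd x) * cos (u x) = I (snd (snd x))" if "x \<in> K" for x using J0[OF that] by (simp add: J_def)
    have a0: "fst (snd x) \<noteq> 0" if "x \<in> K" for x
      using ne[OF that] J0[OF that] by (auto simp: fast_slope_def J_def)
    obtain x0 where x0: "x0 \<in> K" using K by blast
    define m where "m = \<lfloor>u x0 / pi\<rfloor>"
    have ne_int: "u x \<noteq> of_int j * pi" if "x \<in> K" for x j using sn[OF that] sin_int_pi[of j] by auto
    have "of_int m \<le> u x0 / pi" "u x0 / pi < of_int (m + 1)"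
      using floor_correct[of "u x0 / pi"] unfolding m_def by auto
    then have m0: "of_int m * pi \<le> u x0" "u x0 < of_int (m + 1) * pi"
      by (simp_all only: pos_le_divide_eq[OF pi_gt_zero] pos_divide_less_eq[OF pi_gt_zero])
    have bds: "of_int m * pi < u x" "u x < of_int (m + 1) * pi" if x: "x \<in> K" for x
      using connected_ivt_real[OF K(1) cu x x0, of "of_int m * pi"] connected_ivt_real[OF K(1) cu x0 x, of "of_int (m + 1) * pi"]
        m0 ne_int by (auto simp: not_less[symmetric] simp del: of_int_add)
    show ?thesis
    proof (rule F[of m])
      show "K \<subseteq> arccos_domain I"
      proof
        fix x assume x: "x \<in> K"
        have "(cos (u x))\<^sup>2 < 1" using sn[OF x] sin_cos_squared_add[of "u x"] by (smt (verit) zero_less_power2)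
        then have "\<bar>cos (u x)\<bar> < 1" by (simp add: abs_square_less_1)
        moreover have "I (snd (snd x)) * inverse (fst (snd x)) = cos (u x)"
          using aI[OF x] a0[OF x] by (simp add: field_simps)
        ultimately show "x \<in> arccos_domain I" using a0[OF x] by (simp add: arccos_domain_def)
      qed
      show "h0 x = arccos_branch I m x - fst x" if x: "x \<in> K" for x
      proof -
        have "I (snd (snd x)) * inverse (fst (snd x)) = cos (u x)"
          using aI[OF x] a0[OF x] by (simp add: field_simps)
        moreover have "cos (u x - of_int m * pi) = (- 1) powi m * cos (u x)"
          by (simp add: cos_diff cos_int_pi sin_int_pi)
        moreover have "arccos (cos (u x - of_int m * pi)) = u x - of_int m * pi"
          using bds[OF x] by (intro arccos_cos) (auto simp: algebra_simps)
        ultimately show ?thesis by (simp add: arccos_branch_def u_def)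
      qed
      show "(\<forall>x\<in>K. fst (snd x) > 0) \<or> (\<forall>x\<in>K. fst (snd x) < 0)"
        by (rule connected_nonzero_sign[OF K(1)]) (auto intro!: continuous_intros a0)
    qed
  next
    assume "\<forall>x\<in>K. (sin (u x))\<^sup>2 - (J x)\<^sup>2 < 0"
    then have sn: "sin (u x) = 0" if "x \<in> K" for x
      using zero[OF that] that by (auto simp: not_less[symmetric])
    obtain x0 where x0: "x0 \<in> K" using K by blast
    obtain k where k: "u x0 = of_int k * pi" using sn[OF x0] by (auto simp: sin_zero_iff_int2)
    have uk: "u x = of_int k * pi" if x: "x \<in> K" for x
    proof (rule ccontr)
      assume n: "u x \<noteq> of_int k * pi"
      obtain l where l: "u x = of_int l * pi" using sn[OF x] by (auto simp: sin_zero_iff_int2)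
      \<comment> \<open>Two different multiples of pi as values would force u to pass through an odd
        multiple of pi / 2, where the sine is not 0.\<close>
      have half: "sin ((of_int j + 1/2) * pi) \<noteq> 0" for j :: int
      proof -
        have "sin ((of_int j + 1/2) * pi) = (- 1) powi j"
          by (simp add: distrib_right sin_add cos_int_pi sin_int_pi)
        then show ?thesis by (simp add: minus_one_powi)
      qed
      have lk: "l < k \<or> k < l" using n l by auto
      then show False
      proof
        assume "l < k"
        then have "of_int l + 1/2 \<le> (of_int k :: real)" by linarith
        then have "u x \<le> (of_int l + 1/2) * pi" "(of_int l + 1/2) * pi \<le> u x0"
          unfolding l k by (auto intro!: mult_right_mono simp del: mult_le_cancel_right_pos)
        from connected_ivt_real[OF K(1) cu x x0 this] show False using sn half[of l] by metis
      next
        assume "k < l"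
        then have "of_int k + 1/2 \<le> (of_int l :: real)" by linarith
        then have "u x0 \<le> (of_int k + 1/2) * pi" "(of_int k + 1/2) * pi \<le> u x"
          unfolding l k by (auto intro!: mult_right_mono simp del: mult_le_cancel_right_pos)
        from connected_ivt_real[OF K(1) cu x0 x this] show False using sn half[of k] by metis
      qed
    qed
    have hk: "h0 x = of_int k * pi - fst x" if "x \<in> K" for x using uk[OF that] by (simp add: u_def)
    have "(\<forall>x\<in>K. (- 1) powi k * I (snd (snd x)) - fst (snd x) > 0) \<or> (\<forall>x\<in>K. (- 1) powi k * I (snd (snd x)) - fst (snd x) < 0)"
    proof (rule connected_nonzero_sign[OF K(1)])
      show "continuous_on K (\<lambda>x. (- 1) powi k * I (snd (snd x)) - fst (snd x))" by (intro continuous_intros cIK)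
      show "(- 1) powi k * I (snd (snd x)) - fst (snd x) \<noteq> 0" if "x \<in> K" for x
        using ne[OF that] unfolding uk[OF that] fast_slope_pi by linarith
    qed
    then show ?thesis using minus[of k] plus[of k] hk by auto
  qed
qed

text \<open>The analytic counterpart of a slow invariant manifold over K, with the invariance
  equation in place of local invariance. Existence, expansion and stability are proved for such
  families; the link with local invariance is established separately in both directions.\<close>

definition slow_pde_family ::
  "(real \<Rightarrow> real) \<Rightarrow> real \<Rightarrow> real \<Rightarrow> real \<Rightarrow> slow set \<Rightarrow> (slow \<Rightarrow> real) \<Rightarrow> (slow \<Rightarrow> slow) \<Rightarrow>
     (real \<Rightarrow> slow \<Rightarrow> real) \<Rightarrow> (real \<Rightarrow> slow \<Rightarrow> slow) \<Rightarrow> real \<Rightarrow> bool" where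
  "slow_pde_family I lam eta e0 K h0 G0 h G C \<longleftrightarrow> C1_with_gradient h0 G0 K \<and>
     (\<forall>eps\<in>{0<..<e0}. C1_with_gradient (h eps) (G eps) K \<and>
        (\<forall>x\<in>K. \<bar>h eps x - h0 x\<bar> \<le> C * eps \<and> norm (G eps x - G0 x) \<le> C * eps \<and>
           fast_rhs I (h eps x, x) = eps * (slow_rhs I lam eta (h eps x, x) \<bullet> G eps x)))"

lemma slow_pde_family_from_branch:
  assumes I: "smooth I" and K: "compact K" and U: "open U" "K \<subseteq> U"
    and u: "\<And>x. x \<in> U \<Longrightarrow> GDERIV u x :> gu x" "\<And>x. x \<in> U \<Longrightarrow> c11_at u x" "\<And>x. x \<in> U \<Longrightarrow> c11_at gu x"
      "\<And>x. x \<in> U \<Longrightarrow> fast_rhs I (u x - fst x, x) = 0"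
    and \<sigma>: "\<sigma> = 1 \<or> \<sigma> = (- 1::real)" and hyp: "\<And>x. x \<in> K \<Longrightarrow> \<sigma> * fast_slope I (u x) x > 0"
  shows "\<exists>e0>0. \<exists>h G C. slow_pde_family I lam eta e0 K (\<lambda>x. u x - fst x) (\<lambda>x. gu x - (1, 0, 0)) h G C"
proof -
  obtain e0 C O' where *: "e0 > 0" "open O'" "K \<subseteq> O'"
    "\<And>eps. eps \<in> {0<..<e0} \<Longrightarrow> \<exists>h G. continuous_on O' G \<and>
       (\<forall>x\<in>O'. GDERIV h x :> G x \<and> \<bar>h x - (u x - fst x)\<bar> \<le> C * eps \<and> norm (G x - (gu x - (1, 0, 0))) \<le> C * eps \<and>
          fast_rhs I (h x, x) = eps * (slow_rhs I lam eta (h x, x) \<bullet> G x))"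
    using slow_pde_solution[OF I K U u \<sigma> hyp] by metis
  then obtain h G where hG: "\<And>eps. eps \<in> {0<..<e0} \<Longrightarrow> continuous_on O' (G eps) \<and>
       (\<forall>x\<in>O'. GDERIV (h eps) x :> G eps x \<and> \<bar>h eps x - (u x - fst x)\<bar> \<le> C * eps \<and> norm (G eps x - (gu x - (1, 0, 0))) \<le> C * eps \<and>
          fast_rhs I (h eps x, x) = eps * (slow_rhs I lam eta (h eps x, x) \<bullet> G eps x))"
    by metis
  have "continuous_on U gu" using u(3) U(1) by (simp add: continuous_on_eq_continuous_at c11_at_imp_isCont)
  then have "C1_with_gradient (\<lambda>x. u x - fst x) (\<lambda>x. gu x - (1, 0, 0)) K"
    unfolding C1_with_gradient_def using U u(1)
    by (intro exI[of _ U]) (auto intro!: GDERIV_diff GDERIV_coordinates continuous_intros)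
  moreover have "C1_with_gradient (h eps) (G eps) K" if "eps \<in> {0<..<e0}" for eps
    unfolding C1_with_gradient_def using * hG[OF that] by (intro exI[of _ O']) auto
  ultimately have "slow_pde_family I lam eta e0 K (\<lambda>x. u x - fst x) (\<lambda>x. gu x - (1, 0, 0)) h G C"
    unfolding slow_pde_family_def using * hG by blast
  then show ?thesis using *(1) by blast
qed

text \<open>The classification supplies a branch formula valid on an open set, and the sign of its
  slope decides between \<sigma> = 1 and \<sigma> = -1. The family is built on this formula h1,
  which is known to agree with h0 only on K.\<close>

theorem slow_pde_family_exists:
  assumes I: "smooth I" and K: "compact K" "connected K" "K \<noteq> {}" and h0: "continuous_on K h0"
    and nh: "\<forall>x\<in>K. normally_hyperbolic_zero I (h0 x, x)"
  shows "\<exists>e0>0. \<exists>h1 G1 h G C. slow_pde_family I lam eta e0 K h1 G1 h G C \<and> (\<forall>x\<in>K. h1 x = h0 x)"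
proof -
  have cI: "continuous_on UNIV I" using smooth_derivs(4)[OF I] by (simp add: continuous_on_eq_continuous_at)
  have pi: "\<exists>e0>0. \<exists>h G C. slow_pde_family I lam eta e0 K (\<lambda>x. of_int k * pi - fst x) (\<lambda>x. 0 - (1, 0, 0)) h G C"
    if "\<sigma> = 1 \<or> \<sigma> = (- 1::real)" "\<And>x. x \<in> K \<Longrightarrow> \<sigma> * fast_slope I (of_int k * pi) x > 0" for \<sigma> and k :: int
    by (rule slow_pde_family_from_branch[OF I K(1) open_UNIV _ _ _ _ _ that])
      (auto intro: GDERIV_const c11_at_const simp: fast_rhs_eq sin_int_pi)
  show ?thesis
  proof (cases rule: critical_branch_cases[OF K(2,3) h0 cI nh, case_names minus plus F])
    case (minus k)
    have "\<exists>e0>0. \<exists>h G C. slow_pde_family I lam eta e0 K (\<lambda>x. of_int k * pi - fst x) (\<lambda>x. 0 - (1, 0, 0)) h G C"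
      by (rule pi[of "-1"]) (use minus in \<open>auto simp: fast_slope_pi\<close>)
    then obtain e0 h G C where "e0 > 0" "slow_pde_family I lam eta e0 K (\<lambda>x. of_int k * pi - fst x) (\<lambda>x. 0 - (1, 0, 0)) h G C" by blast
    then show ?thesis
      by (intro exI[of _ e0] conjI exI[of _ "\<lambda>x. of_int k * pi - fst x"] exI[of _ "\<lambda>x. 0 - (1, 0, 0)"] exI[of _ h] exI[of _ G] exI[of _ C]) (auto simp: minus(1))
  next
    case (plus k)
    have "\<exists>e0>0. \<exists>h G C. slow_pde_family I lam eta e0 K (\<lambda>x. of_int k * pi - fst x) (\<lambda>x. 0 - (1, 0, 0)) h G C"
      by (rule pi[of 1]) (use plus in \<open>auto simp: fast_slope_pi\<close>)
    then obtain e0 h G C where "e0 > 0" "slow_pde_family I lam eta e0 K (\<lambda>x. of_int k * pi - fst x) (\<lambda>x. 0 - (1, 0, 0)) h G C" by blast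
    then show ?thesis
      by (intro exI[of _ e0] conjI exI[of _ "\<lambda>x. of_int k * pi - fst x"] exI[of _ "\<lambda>x. 0 - (1, 0, 0)"] exI[of _ h] exI[of _ G] exI[of _ C]) (auto simp: plus(1))
  next
    case (F m)
    obtain gu where gu: "\<And>x. x \<in> arccos_domain I \<Longrightarrow> GDERIV (arccos_branch I m) x :> gu x"
      "\<And>x. x \<in> arccos_domain I \<Longrightarrow> c11_at (arccos_branch I m) x" "\<And>x. x \<in> arccos_domain I \<Longrightarrow> c11_at gu x"
      using arccos_branch_smooth(2)[OF I, of m] by blast
    obtain \<sigma> where \<sigma>: "\<sigma> = 1 \<or> \<sigma> = (- 1::real)" "\<And>x. x \<in> K \<Longrightarrow> - \<sigma> * fst (snd x) > 0"
      using F(3)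
    proof
      assume "\<forall>x\<in>K. fst (snd x) > 0" then show ?thesis using that[of "-1"] by auto
    next
      assume "\<forall>x\<in>K. fst (snd x) < 0" then show ?thesis using that[of 1] by auto
    qed
    have "\<exists>e0>0. \<exists>h G C. slow_pde_family I lam eta e0 K (\<lambda>x. arccos_branch I m x - fst x) (\<lambda>x. gu x - (1, 0, 0)) h G C"
    proof (rule slow_pde_family_from_branch[OF I K(1) arccos_branch_smooth(1)[OF I] F(2) gu _ \<sigma>(1)])
      show "fast_rhs I (arccos_branch I m x - fst x, x) = 0" if "x \<in> arccos_domain I" for x
        using arccos_branch_cos_sin(1)[OF that] by (simp add: fast_rhs_eq)
      show "\<sigma> * fast_slope I (arccos_branch I m x) x > 0" if x: "x \<in> K" for x
      proof -
        have xd: "x \<in> arccos_domain I" using F(2) x by blast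
        have "(sin (arccos_branch I m x))\<^sup>2 > 0" using arccos_branch_cos_sin(2)[OF xd] by simp
        then have "(- \<sigma> * fst (snd x)) * (sin (arccos_branch I m x))\<^sup>2 > 0"
          by (rule mult_pos_pos[OF \<sigma>(2)[OF x]])
        then show ?thesis by (simp add: fast_slope_F[where I=I and x=x and u="arccos_branch I m x", OF arccos_branch_cos_sin(1)[OF xd]])
      qed
    qed
    then obtain e0 h G C where "e0 > 0" "slow_pde_family I lam eta e0 K (\<lambda>x. arccos_branch I m x - fst x) (\<lambda>x. gu x - (1, 0, 0)) h G C" by blast
    then show ?thesis
      by (intro exI[of _ e0] conjI exI[of _ "\<lambda>x. arccos_branch I m x - fst x"] exI[of _ "\<lambda>x. gu x - (1, 0, 0)"] exI[of _ h] exI[of _ G] exI[of _ C]) (auto simp: F(1))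
  qed
qed

section \<open>Local invariance and the invariance equation\<close>

text \<open>\<open>\<tau> = 1\<close> is the given flow and \<open>\<tau> = - 1\<close> the flow with time reversed.\<close>

definition directed_solution ::
  "(real \<Rightarrow> real) \<Rightarrow> real \<Rightarrow> real \<Rightarrow> real \<Rightarrow> real \<Rightarrow> (real \<Rightarrow> state) \<Rightarrow> real set \<Rightarrow> bool" where
  "directed_solution I lam eta eps \<tau> z S \<longleftrightarrow>
     (\<forall>t\<in>S. (z has_vector_derivative (\<tau> * (fast_rhs I (z t) / eps), \<tau> *\<^sub>R slow_rhs I lam eta (z t))) (at t within S))"

lemma solution_directed: "solution I lam eta eps z S \<longleftrightarrow> directed_solution I lam eta eps 1 z S"
  by (simp add: solution_def directed_solution_def)

lemma solution_reversed:
  assumes "solution I lam eta eps z {a..b}"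
  shows "directed_solution I lam eta eps (- 1) (\<lambda>t. z (- t)) {- b..- a}"
  unfolding directed_solution_def
proof
  fix t assume t: "t \<in> {- b..- a}"
  have "(z has_vector_derivative (fast_rhs I (z (- t)) / eps, slow_rhs I lam eta (z (- t)))) (at (- t) within {a..b})"
    using assms t unfolding solution_def by auto
  moreover have "uminus ` {- b..- a} = {a..b}" by simp
  ultimately have "((z \<circ> uminus) has_vector_derivative (- 1) *\<^sub>R (fast_rhs I (z (- t)) / eps, slow_rhs I lam eta (z (- t)))) (at t within {- b..- a})"
    by (intro vector_diff_chain_within) (auto intro!: derivative_eq_intros)
  then show "((\<lambda>t. z (- t)) has_vector_derivative (- 1 * (fast_rhs I (z (- t)) / eps), - 1 *\<^sub>R slow_rhs I lam eta (z (- t)))) (at t within {- b..- a})"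
    by (simp add: o_def)
qed

lemma directed_solution_subset:
  "directed_solution I lam eta eps \<tau> z S \<Longrightarrow> T \<subseteq> S \<Longrightarrow> directed_solution I lam eta eps \<tau> z T"
  unfolding directed_solution_def by (meson has_vector_derivative_within_subset subsetD)

lemma directed_solution_continuous:
  "directed_solution I lam eta eps \<tau> z S \<Longrightarrow> continuous_on S z"
  unfolding directed_solution_def
  by (auto simp: continuous_on_eq_continuous_within intro: has_vector_derivative_continuous)

lemma GDERIV_chain_within:
  assumes "GDERIV h (x t) :> G" "(x has_vector_derivative x') (at t within S)"
  shows "((\<lambda>t. h (x t)) has_real_derivative x' \<bullet> G) (at t within S)"
proof -
  have "((h \<circ> x) has_vector_derivative (x' \<bullet> G)) (at t within S)"
    by (rule vector_derivative_diff_chain_within[OF assms(2) has_derivative_at_withinI[OF assms(1)[unfolded gderiv_def]]])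
  then show ?thesis by (simp add: has_real_derivative_iff_has_vector_derivative o_def)
qed

text \<open>The rate of change of \<open>\<omega> - h x\<close> along solutions, after subtraction
  of the invariance equation. In this form both terms are differences between a point and the graph
  point over the same x, so the rate is bounded by a multiple of the deviation.\<close>

definition deviation_rate where
  "deviation_rate I lam eta eps h G p =
     (fast_rhs I p - fast_rhs I (h (snd p), snd p)) / eps
     - (slow_rhs I lam eta p - slow_rhs I lam eta (h (snd p), snd p)) \<bullet> G (snd p)"

lemma deviation_derivative:
  assumes z: "directed_solution I lam eta eps \<tau> z S" and t: "t \<in> S" and eps: "eps > 0"
    and G: "GDERIV h (snd (z t)) :> G (snd (z t))"
    and pde: "fast_rhs I (h (snd (z t)), snd (z t)) = eps * (slow_rhs I lam eta (h (snd (z t)), snd (z t)) \<bullet> G (snd (z t)))"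
  shows "((\<lambda>t. fst (z t) - h (snd (z t))) has_real_derivative \<tau> * deviation_rate I lam eta eps h G (z t)) (at t within S)"
proof -
  have d: "(z has_vector_derivative (\<tau> * (fast_rhs I (z t) / eps), \<tau> *\<^sub>R slow_rhs I lam eta (z t))) (at t within S)"
    using z t by (simp add: directed_solution_def)
  have a: "((\<lambda>t. h (snd (z t))) has_real_derivative (\<tau> *\<^sub>R slow_rhs I lam eta (z t)) \<bullet> G (snd (z t))) (at t within S)"
    by (rule GDERIV_chain_within[where x="\<lambda>t. snd (z t)" and h=h and t=t, OF G has_vector_derivative_fst_snd(2)[OF d]])
  have "((\<lambda>t. fst (z t) - h (snd (z t))) has_real_derivative
     \<tau> * (fast_rhs I (z t) / eps) - (\<tau> *\<^sub>R slow_rhs I lam eta (z t)) \<bullet> G (snd (z t))) (at t within S)"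
    using has_vector_derivative_fst_snd(1)[OF d]
    by (intro DERIV_diff a) (simp add: has_real_derivative_iff_has_vector_derivative)
  moreover have "fast_rhs I (h (snd (z t)), snd (z t)) / eps = slow_rhs I lam eta (h (snd (z t)), snd (z t)) \<bullet> G (snd (z t))"
    using pde eps by (simp add: field_simps)
  ultimately show ?thesis
    unfolding deviation_rate_def diff_divide_distrib inner_diff_left by (simp add: algebra_simps)
qed

lemma real_lipschitz_from_derivative:
  fixes f :: "real \<Rightarrow> real"
  assumes "\<And>u. (f has_real_derivative f' u) (at u)" "\<And>u. \<bar>f' u\<bar> \<le> B"
  shows "\<bar>f v - f w\<bar> \<le> B * \<bar>v - w\<bar>"
  using field_differentiable_bound[of UNIV f f' B v w] assms by auto

lemma sin_cos_lipschitz: "\<bar>sin a - sin b\<bar> \<le> \<bar>a - b\<bar>" "\<bar>cos a - cos b\<bar> \<le> \<bar>a - b :: real\<bar>"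
  using real_lipschitz_from_derivative[of sin cos 1 a b] real_lipschitz_from_derivative[of cos "\<lambda>x. - sin x" 1 a b]
  by (auto intro: DERIV_sin DERIV_cos)

text \<open>Products of sines and cosines are rewritten with double angles, so only bounds for I and
  \<alpha> on K and the Lipschitz constants of sine and cosine enter, uniformly in the
  phase.\<close>

lemma fast_direction_lipschitz:
  assumes cI: "continuous_on UNIV I" and K: "compact K"
  obtains L where "L \<ge> 0"
    "\<And>x v w. x \<in> K \<Longrightarrow> \<bar>fast_rhs I (v, x) - fast_rhs I (w, x)\<bar> \<le> L * \<bar>v - w\<bar>"
    "\<And>x v w. x \<in> K \<Longrightarrow> norm (slow_rhs I lam eta (v, x) - slow_rhs I lam eta (w, x)) \<le> L * \<bar>v - w\<bar>"
    "\<And>x v w. x \<in> K \<Longrightarrow> \<bar>fast_slope I v x - fast_slope I w x\<bar> \<le> L * \<bar>v - w\<bar>"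
proof -
  have "bounded ((\<lambda>x. \<bar>I (snd (snd x))\<bar> + \<bar>fst (snd x)\<bar>) ` K)"
    by (intro compact_imp_bounded compact_continuous_image K continuous_intros continuous_on_compose2[OF cI]) auto
  then obtain B where B0: "B > 0" and B': "\<And>x. x \<in> K \<Longrightarrow> \<bar>\<bar>I (snd (snd x))\<bar> + \<bar>fst (snd x)\<bar>\<bar> \<le> B"
    unfolding bounded_pos by auto
  define L where "L = \<bar>lam\<bar> + 2 * \<bar>eta\<bar> * B + 4 * B"
  have IB: "\<bar>I (snd (snd x))\<bar> \<le> B" "\<bar>fst (snd x)\<bar> \<le> B" if "x \<in> K" for x using B'[OF that] by linarith+
  have m: "\<bar>c * d\<bar> \<le> C * D" if "\<bar>c\<bar> \<le> C" "\<bar>d\<bar> \<le> D" for c d C D :: real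
    unfolding abs_mult using that by (intro mult_mono) auto
  have s2: "\<bar>sin (2 * a) - sin (2 * b)\<bar> \<le> 2 * \<bar>a - b\<bar>" "\<bar>cos (2 * a) - cos (2 * b)\<bar> \<le> 2 * \<bar>a - b\<bar>" for a b :: real
  proof -
    have "\<bar>2 * a - 2 * b\<bar> = 2 * \<bar>a - b\<bar>" by (auto simp: abs_if)
    then show "\<bar>sin (2 * a) - sin (2 * b)\<bar> \<le> 2 * \<bar>a - b\<bar>" "\<bar>cos (2 * a) - cos (2 * b)\<bar> \<le> 2 * \<bar>a - b\<bar>"
      using sin_cos_lipschitz[of "2 * a" "2 * b"] by simp_all
  qed
  show ?thesis
  proof (rule that[of L])
    show "L \<ge> 0" using B0 by (simp add: L_def)
    fix x v w assume x: "x \<in> K"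
    let ?a = "fst (snd x)" and ?i = "I (snd (snd x))" and ?p = "fst x + v" and ?q = "fst x + w" and ?d = "\<bar>v - w\<bar>"
    have d: "\<bar>?p - ?q\<bar> = ?d" by simp
    have f: "fast_rhs I (y, x) = - (?i * sin (fst x + y)) + ?a * (sin (2 * (fst x + y)) / 2)" for y
      using sin_double[of "fst x + y"] by (simp add: fast_rhs_eq algebra_simps)
    have a1: "\<bar>?i * (sin ?p - sin ?q)\<bar> \<le> B * ?d"
      by (rule m[OF IB(1)[OF x]]) (use sin_cos_lipschitz(1)[of ?p ?q] d in linarith)
    have a2: "\<bar>?a * ((sin (2 * ?p) - sin (2 * ?q)) / 2)\<bar> \<le> B * ?d"
      by (rule m[OF IB(2)[OF x]]) (use s2(1)[of ?p ?q] in simp)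
    have "fast_rhs I (v, x) - fast_rhs I (w, x) = - (?i * (sin ?p - sin ?q)) + ?a * ((sin (2 * ?p) - sin (2 * ?q)) / 2)"
      unfolding f by (simp add: algebra_simps diff_divide_distrib)
    also have "\<bar>\<dots>\<bar> \<le> B * ?d + B * ?d"
      using a1 a2 by linarith
    also have "\<dots> = (2 * B) * ?d" by simp
    also have "\<dots> \<le> L * ?d" using B0 by (intro mult_right_mono) (auto simp: L_def)
    finally show "\<bar>fast_rhs I (v, x) - fast_rhs I (w, x)\<bar> \<le> L * ?d" .
    have c2: "cos y * cos y = (1 + cos (2 * y)) / 2" for y :: real
      using cos_double_cos[of y] by (simp add: power2_eq_square)
    have s: "slow_rhs I lam eta (y, x) = (lam * y, eta * (?i * cos (fst x + y) - ?a * ((1 + cos (2 * (fst x + y))) / 2)), 1)" for y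
      unfolding slow_rhs_eq c2[symmetric] by (simp add: algebra_simps)
    have b1: "\<bar>?i * (cos ?p - cos ?q)\<bar> \<le> B * ?d"
      by (rule m[OF IB(1)[OF x]]) (use sin_cos_lipschitz(2)[of ?p ?q] d in linarith)
    have b2: "\<bar>?a * ((cos (2 * ?p) - cos (2 * ?q)) / 2)\<bar> \<le> B * ?d"
      by (rule m[OF IB(2)[OF x]]) (use s2(2)[of ?p ?q] in simp)
    have "\<bar>?i * (cos ?p - cos ?q) - ?a * ((cos (2 * ?p) - cos (2 * ?q)) / 2)\<bar> \<le> B * ?d + B * ?d"
      using b1 b2 by linarith
    then have e: "\<bar>eta * (?i * (cos ?p - cos ?q) - ?a * ((cos (2 * ?p) - cos (2 * ?q)) / 2))\<bar> \<le> \<bar>eta\<bar> * (B * ?d + B * ?d)"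
      unfolding abs_mult by (intro mult_left_mono) auto
    have "slow_rhs I lam eta (v, x) - slow_rhs I lam eta (w, x) =
        (lam * (v - w), eta * (?i * (cos ?p - cos ?q) - ?a * ((cos (2 * ?p) - cos (2 * ?q)) / 2)), 0)"
      unfolding s by (simp add: algebra_simps diff_divide_distrib add_divide_distrib)
    then have "norm (slow_rhs I lam eta (v, x) - slow_rhs I lam eta (w, x)) \<le> \<bar>lam * (v - w)\<bar> +
        (\<bar>eta * (?i * (cos ?p - cos ?q) - ?a * ((cos (2 * ?p) - cos (2 * ?q)) / 2))\<bar> + 0)"
      using norm_Pair_le[of "lam * (v - w)" "(eta * (?i * (cos ?p - cos ?q) - ?a * ((cos (2 * ?p) - cos (2 * ?q)) / 2)), 0::real)"]
      by (simp add: norm_Pair)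
    also have "\<dots> \<le> \<bar>lam\<bar> * ?d + \<bar>eta\<bar> * (B * ?d + B * ?d)" using e by (simp add: abs_mult)
    also have "\<dots> = (\<bar>lam\<bar> + 2 * \<bar>eta\<bar> * B) * ?d" by (simp add: algebra_simps)
    also have "\<dots> \<le> L * ?d" using B0 by (intro mult_right_mono) (auto simp: L_def)
    finally show "norm (slow_rhs I lam eta (v, x) - slow_rhs I lam eta (w, x)) \<le> L * ?d" .
    have sl: "fast_slope I y x = - (?i * cos y) + ?a * cos (2 * y)" for y
      unfolding fast_slope_def cos_double by (simp add: algebra_simps power2_eq_square)
    have e1: "\<bar>?i * (cos v - cos w)\<bar> \<le> B * ?d"
      by (rule m[OF IB(1)[OF x] sin_cos_lipschitz(2)])
    have e2: "\<bar>?a * (cos (2 * v) - cos (2 * w))\<bar> \<le> B * (2 * ?d)"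
      by (rule m[OF IB(2)[OF x] s2(2)])
    have "fast_slope I v x - fast_slope I w x = - (?i * (cos v - cos w)) + ?a * (cos (2 * v) - cos (2 * w))"
      unfolding sl by (simp add: algebra_simps)
    also have "\<bar>\<dots>\<bar> \<le> B * ?d + B * (2 * ?d)"
      using e1 e2 by linarith
    also have "\<dots> = (3 * B) * ?d" by simp
    also have "\<dots> \<le> L * ?d" using B0 by (intro mult_right_mono) (auto simp: L_def)
    finally show "\<bar>fast_slope I v x - fast_slope I w x\<bar> \<le> L * ?d" .
  qed
qed

lemma C1_with_gradientD:
  assumes "C1_with_gradient g G K"
  shows "x \<in> K \<Longrightarrow> GDERIV g x :> G x" "continuous_on K g" "continuous_on K G"
proof -
  obtain U where U: "open U" "K \<subseteq> U" "\<And>x. x \<in> U \<Longrightarrow> GDERIV g x :> G x" "continuous_on U G"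
    using assms by (auto simp: C1_with_gradient_def)
  show g: "GDERIV g x :> G x" if "x \<in> K" for x using U that by blast
  show "continuous_on K G" using U continuous_on_subset by blast
  show "continuous_on K g"
    using g by (meson continuous_at_imp_continuous_on has_derivative_continuous gderiv_def)
qed

lemma graph_over_iff: "p \<in> graph_over K h \<longleftrightarrow> snd p \<in> K \<and> fst p = h (snd p)"
  by (cases p) (auto simp: graph_over_def image_iff)

lemma snd_graph_over: "snd ` graph_over K h = K"
  by (auto simp: graph_over_def image_iff)

lemma graph_boundary_iff: "p \<in> graph_boundary (graph_over K h) \<longleftrightarrow> p \<in> graph_over K h \<and> snd p \<in> frontier K"
  by (simp add: graph_boundary_def snd_graph_over)

lemma deviation_rate_bound:
  assumes "eps > 0" "norm (G (snd p)) \<le> N" "L \<ge> 0"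
    "\<bar>fast_rhs I p - fast_rhs I (h (snd p), snd p)\<bar> \<le> L * \<bar>fst p - h (snd p)\<bar>"
    "norm (slow_rhs I lam eta p - slow_rhs I lam eta (h (snd p), snd p)) \<le> L * \<bar>fst p - h (snd p)\<bar>"
  shows "\<bar>deviation_rate I lam eta eps h G p\<bar> \<le> (L / eps + L * N) * \<bar>fst p - h (snd p)\<bar>"
proof -
  have "\<bar>(fast_rhs I p - fast_rhs I (h (snd p), snd p)) / eps\<bar> \<le> L * \<bar>fst p - h (snd p)\<bar> / eps"
    using assms by (simp add: divide_right_mono)
  moreover have "\<bar>(slow_rhs I lam eta p - slow_rhs I lam eta (h (snd p), snd p)) \<bullet> G (snd p)\<bar> \<le> L * \<bar>fst p - h (snd p)\<bar> * N"
    using assms by (intro order_trans[OF Cauchy_Schwarz_ineq2] mult_mono) auto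
  moreover have "\<bar>a - b\<bar> \<le> A + B" if "\<bar>a\<bar> \<le> A" "\<bar>b\<bar> \<le> B" for a b A B :: real using that by linarith
  ultimately have "\<bar>deviation_rate I lam eta eps h G p\<bar> \<le> L * \<bar>fst p - h (snd p)\<bar> / eps + L * \<bar>fst p - h (snd p)\<bar> * N"
    unfolding deviation_rate_def by blast
  then show ?thesis by (simp add: algebra_simps)
qed

text \<open>Follow the orbit up to the supremum t of the times until which it stays on the graph. If
  its slow part at t were interior to K and t not the end time, it would stay in K a little longer,
  and Gronwall for the squared deviation, which is 0 at t, would keep the orbit on the graph beyond
  t.\<close>

theorem directed_invariance:
  assumes cI: "continuous_on UNIV I" and K: "compact K" and C1: "C1_with_gradient h G K" and eps: "eps > 0"
    and pde: "\<And>x. x \<in> K \<Longrightarrow> fast_rhs I (h x, x) = eps * (slow_rhs I lam eta (h x, x) \<bullet> G x)"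
    and ab: "a \<le> b" and z: "directed_solution I lam eta eps \<tau> z {a..b}" and za: "z a \<in> graph_over K h"
  shows "(\<forall>t\<in>{a..b}. z t \<in> graph_over K h) \<or>
    (\<exists>t\<in>{a..b}. z t \<in> graph_boundary (graph_over K h) \<and> (\<forall>s\<in>{a..t}. z s \<in> graph_over K h))"
proof -
  let ?M = "graph_over K h"
  have "compact ?M"
    unfolding graph_over_def
    by (intro compact_continuous_image K continuous_intros C1_with_gradientD(2)[OF C1])
  then have clM: "closed ?M" by (rule compact_imp_closed)
  have cz: "continuous_on {a..b} z" by (rule directed_solution_continuous[OF z])
  define T where "T = {t\<in>{a..b}. \<forall>s\<in>{a..t}. z s \<in> ?M}"
  have aT: "a \<in> T" using ab za by (auto simp: T_def)
  have bT: "bdd_above T" by (auto simp: T_def intro: bdd_aboveI[of _ b])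
  define t where "t = Sup T"
  have tb: "t \<in> {a..b}" unfolding t_def using aT bT
    by (auto intro: cSup_upper intro!: cSup_least) (auto simp: T_def)
  have lt: "z s \<in> ?M" if s: "a \<le> s" "s < t" for s
  proof -
    obtain r where "r \<in> T" "s < r" using s aT less_cSup_iff[OF _ bT, of s] unfolding t_def by auto
    then show ?thesis using s by (auto simp: T_def)
  qed
  have "z t \<in> ?M"
  proof (cases "t = a")
    case False
    have cl: "closed ({a..t} \<inter> z -` ?M)"
      using continuous_closed_preimage[OF continuous_on_subset[OF cz] _ clM, of "{a..t}"] tb by auto
    have "{a..<t} \<subseteq> {a..t} \<inter> z -` ?M" using lt by auto
    then have "closure {a..<t} \<subseteq> {a..t} \<inter> z -` ?M" using cl by (rule closure_minimal)
    then show ?thesis using False tb by auto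
  qed (use za in simp)
  with lt have tM: "z s \<in> ?M" if "s \<in> {a..t}" for s using that by (cases "s = t") auto
  show ?thesis
  proof (cases "t = b \<or> snd (z t) \<in> frontier K")
    case True
    then show ?thesis
    proof
      assume "t = b" then show ?thesis using tM by blast
    next
      assume "snd (z t) \<in> frontier K"
      moreover have "z t \<in> ?M" using tM tb by auto
      ultimately have "z t \<in> graph_boundary ?M" by (simp add: graph_boundary_iff)
      then show ?thesis using tM tb by blast
    qed
  next
    case False
    have ztM: "z t \<in> ?M" using tM tb by auto
    then have "snd (z t) \<in> interior K" using False K
      by (auto simp: graph_over_iff frontier_def closure_closed compact_imp_closed)
    moreover have "continuous (at t within {a..b}) (\<lambda>t. snd (z t))"
      using cz tb by (auto simp: continuous_on_eq_continuous_within intro: continuous_snd)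
    ultimately have "eventually (\<lambda>s. snd (z s) \<in> interior K) (at t within {a..b})"
      unfolding continuous_within by (intro topological_tendstoD) auto
    then obtain d where d: "d > 0" "\<And>s. s \<in> {a..b} \<Longrightarrow> s \<noteq> t \<Longrightarrow> dist s t < d \<Longrightarrow> snd (z s) \<in> interior K"
      by (auto simp: eventually_at)
    define t' where "t' = min b (t + d / 2)"
    have t': "t < t'" "t' \<le> b" using False tb d by (auto simp: t'_def)
    have inK: "snd (z s) \<in> K" if "s \<in> {t..t'}" for s
    proof (cases "s = t")
      case False
      then show ?thesis using that d tb t' interior_subset[of K]
        by (intro subsetD[OF interior_subset d(2)]) (auto simp: t'_def dist_real_def)
    qed (use ztM in \<open>auto simp: graph_over_iff\<close>)
    obtain L where L: "L \<ge> 0"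
      "\<And>x v w. x \<in> K \<Longrightarrow> \<bar>fast_rhs I (v, x) - fast_rhs I (w, x)\<bar> \<le> L * \<bar>v - w\<bar>"
      "\<And>x v w. x \<in> K \<Longrightarrow> norm (slow_rhs I lam eta (v, x) - slow_rhs I lam eta (w, x)) \<le> L * \<bar>v - w\<bar>"
      using fast_direction_lipschitz[OF cI K, where lam=lam and eta=eta] by metis
    obtain N where N: "\<And>x. x \<in> K \<Longrightarrow> norm (G x) \<le> N"
      using compact_imp_bounded[OF compact_continuous_image[OF C1_with_gradientD(3)[OF C1] K]]
      by (auto simp: bounded_iff)
    define M where "M = L / eps + L * N"
    define y where "y = (\<lambda>t. fst (z t) - h (snd (z t)))"
    have z': "directed_solution I lam eta eps \<tau> z {t..t'}"
      using z by (rule directed_solution_subset) (use tb t' in auto)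
    have y0: "(y s)\<^sup>2 \<le> (y t)\<^sup>2 * exp (2 * \<bar>\<tau>\<bar> * M * (s - t))" if s: "s \<in> {t..t'}" for s
    proof (rule gronwall_le[OF _ _ s, where u'="\<lambda>s. 2 * (y s * (\<tau> * deviation_rate I lam eta eps h G (z s)))"])
      fix s assume s: "s \<in> {t..t'}"
      have "(y has_real_derivative \<tau> * deviation_rate I lam eta eps h G (z s)) (at s within {t..t'})"
        unfolding y_def
        by (rule deviation_derivative[where z=z and t=s and h=h and G=G, OF z' s eps C1_with_gradientD(1)[OF C1 inK[OF s]] pde[OF inK[OF s]]])
      then show "((\<lambda>s. (y s)\<^sup>2) has_real_derivative 2 * (y s * (\<tau> * deviation_rate I lam eta eps h G (z s)))) (at s within {t..t'})"
        by (auto intro!: derivative_eq_intros)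
      have "\<bar>deviation_rate I lam eta eps h G (z s)\<bar> \<le> M * \<bar>y s\<bar>"
        unfolding M_def y_def using inK[OF s] L(2)[OF inK[OF s], of "fst (z s)" "h (snd (z s))"]
          L(3)[OF inK[OF s], of "fst (z s)" "h (snd (z s))"]
        by (intro deviation_rate_bound[OF eps N L(1)]) auto
      then have "\<bar>y s\<bar> * (\<bar>\<tau>\<bar> * \<bar>deviation_rate I lam eta eps h G (z s)\<bar>) \<le> \<bar>y s\<bar> * (\<bar>\<tau>\<bar> * (M * \<bar>y s\<bar>))"
        by (intro mult_left_mono) auto
      moreover have "y s * (\<tau> * deviation_rate I lam eta eps h G (z s)) \<le> \<bar>y s\<bar> * (\<bar>\<tau>\<bar> * \<bar>deviation_rate I lam eta eps h G (z s)\<bar>)"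
        by (metis abs_ge_self abs_mult)
      moreover have "\<bar>y s\<bar> * (\<bar>\<tau>\<bar> * (M * \<bar>y s\<bar>)) = \<bar>\<tau>\<bar> * M * (y s)\<^sup>2"
        by (simp add: power2_eq_square mult_ac)
      ultimately show "2 * (y s * (\<tau> * deviation_rate I lam eta eps h G (z s))) \<le> 2 * \<bar>\<tau>\<bar> * M * (y s)\<^sup>2"
        by linarith
    qed
    have "z s \<in> ?M" if s: "s \<in> {t..t'}" for s
    proof -
      have "y t = 0" using ztM by (simp add: y_def graph_over_iff)
      then have "y s = 0" using y0[OF s] by simp
      then show ?thesis using inK[OF s] by (simp add: y_def graph_over_iff)
    qed
    then have "t' \<in> T" using tM tb t' by (auto simp: T_def) (metis atLeastAtMost_iff linear)
    then have "t' \<le> t" unfolding t_def using bT by (rule cSup_upper)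
    then show ?thesis using t' by simp
  qed
qed

text \<open>The backward half of local invariance is the forward half for the time-reversed flow,
  which has the same invariant graphs.\<close>

theorem pde_imp_locally_invariant:
  assumes cI: "continuous_on UNIV I" and K: "compact K" and C1: "C1_with_gradient h G K" and eps: "eps > 0"
    and pde: "\<And>x. x \<in> K \<Longrightarrow> fast_rhs I (h x, x) = eps * (slow_rhs I lam eta (h x, x) \<bullet> G x)"
  shows "locally_invariant I lam eta eps (graph_over K h)"
  unfolding locally_invariant_def
proof (intro allI impI conjI; elim conjE)
  fix z a b assume ab: "a \<le> b" and z: "solution I lam eta eps z {a..b}"
  show "(\<forall>t\<in>{a..b}. z t \<in> graph_over K h) \<or>
     (\<exists>t\<in>{a..b}. z t \<in> graph_boundary (graph_over K h) \<and> (\<forall>s\<in>{a..t}. z s \<in> graph_over K h))"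
    if "z a \<in> graph_over K h"
    by (rule directed_invariance[OF cI K C1 eps pde ab z[unfolded solution_directed] that])
  assume zb: "z b \<in> graph_over K h"
  have "(\<forall>t\<in>{- b..- a}. z (- t) \<in> graph_over K h) \<or>
     (\<exists>t\<in>{- b..- a}. z (- t) \<in> graph_boundary (graph_over K h) \<and> (\<forall>s\<in>{- b..t}. z (- s) \<in> graph_over K h))"
    by (rule directed_invariance[OF cI K C1 eps pde _ solution_reversed[OF z]]) (use ab zb in auto)
  then show "(\<forall>t\<in>{a..b}. z t \<in> graph_over K h) \<or>
     (\<exists>t\<in>{a..b}. z t \<in> graph_boundary (graph_over K h) \<and> (\<forall>s\<in>{t..b}. z s \<in> graph_over K h))"
  proof
    assume *: "\<forall>t\<in>{- b..- a}. z (- t) \<in> graph_over K h"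
    have "z t \<in> graph_over K h" if "t \<in> {a..b}" for t using bspec[OF *, of "- t"] that by simp
    then show ?thesis by blast
  next
    assume "\<exists>t\<in>{- b..- a}. z (- t) \<in> graph_boundary (graph_over K h) \<and> (\<forall>s\<in>{- b..t}. z (- s) \<in> graph_over K h)"
    then obtain t where t: "t \<in> {- b..- a}" "z (- t) \<in> graph_boundary (graph_over K h)"
      and *: "\<forall>s\<in>{- b..t}. z (- s) \<in> graph_over K h" by blast
    have "z s \<in> graph_over K h" if "s \<in> {- t..b}" for s using bspec[OF *, of "- s"] that by simp
    then show ?thesis using t by (intro disjI2 bexI[of _ "- t"]) auto
  qed
qed

section \<open>Attraction and repulsion\<close>

text \<open>Up to a first exit from the tube the estimate holds and keeps |y| at most its initial
  value, which is less than \<delta>. So there is no exit, and the estimate holds on the whole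
  interval.\<close>

lemma decay_within_tube:
  fixes y y' :: "real \<Rightarrow> real"
  assumes der: "\<And>t. t \<in> {a..b} \<Longrightarrow> (y has_real_derivative y' t) (at t within {a..b})"
    and decay: "\<And>t. t \<in> {a..b} \<Longrightarrow> \<bar>y t\<bar> < \<delta> \<Longrightarrow> y t * y' t \<le> - k * (y t)\<^sup>2"
    and k: "k \<ge> 0" and ab: "a \<le> b" and ya: "\<bar>y a\<bar> < \<delta>"
  shows "\<bar>y b\<bar> \<le> exp (- k * (b - a)) * \<bar>y a\<bar>"
proof -
  have cont: "continuous_on {a..b} y" by (rule DERIV_continuous_on) (rule der)
  have est: "\<bar>y c\<bar> \<le> exp (- k * (c - a)) * \<bar>y a\<bar>"
    if c: "c \<in> {a..b}" and tube: "\<And>t. t \<in> {a<..<c} \<Longrightarrow> \<bar>y t\<bar> < \<delta>" for c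
  proof -
    have "(y c)\<^sup>2 \<le> (y a)\<^sup>2 * exp (- 2 * k * (c - a))"
    proof (rule gronwall_open[where u="\<lambda>t. (y t)\<^sup>2" and u'="\<lambda>t. 2 * (y t * y' t)" and b=c])
      fix t assume "t \<in> {a..c}"
      then have "(y has_real_derivative y' t) (at t within {a..c})"
        using der[of t] c by (intro has_field_derivative_subset[of y "y' t" t "{a..b}" "{a..c}"]) auto
      then show "((\<lambda>t. (y t)\<^sup>2) has_real_derivative 2 * (y t * y' t)) (at t within {a..c})"
        by (auto intro!: derivative_eq_intros)
    next
      fix t assume "t \<in> {a<..<c}"
      then show "2 * (y t * y' t) \<le> - 2 * k * (y t)\<^sup>2" using decay[of t] tube[of t] c by auto
    qed (use c in auto)
    also have "\<dots> = (exp (- k * (c - a)) * \<bar>y a\<bar>)\<^sup>2"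
      by (simp add: power_mult_distrib exp_double[symmetric] algebra_simps)
    finally show ?thesis by (intro power2_le_imp_le[of "\<bar>y c\<bar>"]) auto
  qed
  have "\<bar>y t\<bar> < \<delta>" if t: "t \<in> {a..b}" for t
  proof (rule ccontr)
    assume neg: "\<not> \<bar>y t\<bar> < \<delta>"
    define S where "S = {a..b} \<inter> (\<lambda>t. \<bar>y t\<bar>) -` {\<delta>..}"
    have clS: "closed S" unfolding S_def
      by (intro continuous_closed_preimage continuous_intros cont)
    have tS: "t \<in> S" using t neg by (auto simp: S_def)
    have bS: "bdd_below S" by (auto simp: S_def)
    define c where "c = Inf S"
    have cS: "c \<in> S" unfolding c_def using closed_contains_Inf[OF _ bS clS] tS by blast
    have "\<bar>y s\<bar> < \<delta>" if s: "s \<in> {a<..<c}" for s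
    proof (rule ccontr)
      assume "\<not> \<bar>y s\<bar> < \<delta>"
      then have "s \<in> S" using s cS by (auto simp: S_def)
      then have "c \<le> s" unfolding c_def using bS by (rule cInf_lower)
      then show False using s by simp
    qed
    then have "\<bar>y c\<bar> \<le> exp (- k * (c - a)) * \<bar>y a\<bar>" using cS by (intro est) (auto simp: S_def)
    also have "\<dots> \<le> 1 * \<bar>y a\<bar>" using k cS by (intro mult_right_mono) (auto simp: S_def)
    finally show False using ya cS by (auto simp: S_def)
  qed
  then show ?thesis using ab by (intro est) auto
qed

lemma mvt_between:
  fixes f :: "real \<Rightarrow> real"
  assumes "\<And>u. (f has_real_derivative f' u) (at u)"
  shows "\<exists>\<xi>. \<bar>\<xi> - b\<bar> \<le> \<bar>a - b\<bar> \<and> f a - f b = (a - b) * f' \<xi>"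
proof (cases a b rule: linorder_cases)
  case less
  then obtain \<xi> where "a < \<xi>" "\<xi> < b" "f b - f a = (b - a) * f' \<xi>" using MVT2[of a b f f'] assms by auto
  then show ?thesis by (intro exI[of _ \<xi>]) (auto simp: algebra_simps)
next
  case greater
  then obtain \<xi> where "b < \<xi>" "\<xi> < a" "f a - f b = (a - b) * f' \<xi>" using MVT2[of b a f f'] assms by auto
  then show ?thesis by (intro exI[of _ \<xi>]) auto
qed auto

theorem slow_family_contraction:
  assumes cI: "continuous_on UNIV I" and K: "compact K" "K \<noteq> {}" and e0: "e0 > 0"
    and fam: "slow_pde_family I lam eta e0 K h0 G0 h G C" and \<tau>: "\<tau> = 1 \<or> \<tau> = (- 1::real)"
    and hyp: "\<And>x. x \<in> K \<Longrightarrow> \<tau> * fast_slope I (fst x + h0 x) x < 0"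
  obtains e1 \<delta> \<kappa> where "e1 > 0" "e1 \<le> e0" "\<delta> > 0" "\<kappa> > 0"
    "\<And>eps z a b. \<lbrakk>eps \<in> {0<..<e1}; a \<le> b; directed_solution I lam eta eps \<tau> z {a..b};
       \<forall>t\<in>{a..b}. snd (z t) \<in> K; \<bar>fst (z a) - h eps (snd (z a))\<bar> < \<delta>\<rbrakk> \<Longrightarrow>
       \<bar>fst (z b) - h eps (snd (z b))\<bar> \<le> exp (- \<kappa> * (b - a) / eps) * \<bar>fst (z a) - h eps (snd (z a))\<bar>"
proof -
  have C10: "C1_with_gradient h0 G0 K" using fam by (simp add: slow_pde_family_def)
  have "continuous_on K (\<lambda>x. \<tau> * fast_slope I (fst x + h0 x) x)"
    unfolding fast_slope_def
    by (intro continuous_intros continuous_on_compose2[OF cI] C1_with_gradientD(2)[OF C10]) auto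
  then obtain x0 where x0: "x0 \<in> K" "\<And>x. x \<in> K \<Longrightarrow> \<tau> * fast_slope I (fst x + h0 x) x \<le> \<tau> * fast_slope I (fst x0 + h0 x0) x0"
    using continuous_attains_sup[OF K] by blast
  \<comment> \<open>A quarter of the slowest rate on the critical branch. Moving from h0 to a point
    of the tube costs at most two quarters, the slow drift along the gradient of
    \<open>h eps\<close> at most one, and one remains as the rate.\<close>
  define \<kappa> where "\<kappa> = - (\<tau> * fast_slope I (fst x0 + h0 x0) x0) / 4"
  have \<kappa>: "\<kappa> > 0" using hyp[OF x0(1)] by (simp add: \<kappa>_def)
  have slope0: "\<tau> * fast_slope I (fst x + h0 x) x \<le> - 4 * \<kappa>" if "x \<in> K" for x
    using x0(2)[OF that] by (simp add: \<kappa>_def)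
  obtain L where L: "L \<ge> 0"
    "\<And>x v w. x \<in> K \<Longrightarrow> norm (slow_rhs I lam eta (v, x) - slow_rhs I lam eta (w, x)) \<le> L * \<bar>v - w\<bar>"
    "\<And>x v w. x \<in> K \<Longrightarrow> \<bar>fast_slope I v x - fast_slope I w x\<bar> \<le> L * \<bar>v - w\<bar>"
    using fast_direction_lipschitz[OF cI K(1), where lam=lam and eta=eta] by metis
  obtain N0 where N0: "\<And>x. x \<in> K \<Longrightarrow> norm (G0 x) \<le> N0"
    using compact_imp_bounded[OF compact_continuous_image[OF C1_with_gradientD(3)[OF C10] K(1)]]
    by (auto simp: bounded_iff)
  define N where "N = N0 + \<bar>C\<bar> * e0"
  have "N0 \<ge> 0" using N0[OF x0(1)] norm_ge_zero order_trans by blast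
  then have Npos: "N \<ge> 0" using e0 by (simp add: N_def)
  define \<delta> where "\<delta> = \<kappa> / (L + 1)"
  have \<delta>: "\<delta> > 0" "L * \<delta> \<le> \<kappa>" using \<kappa> L(1) by (auto simp: \<delta>_def field_simps)
  \<comment> \<open>Makes \<open>\<bar>C\<bar> * eps\<close> at most \<delta>, so that the slow
    manifold lies within \<delta> of the critical branch, and \<open>eps * (L * N)\<close> at most
    \<kappa>, which controls the slow drift.\<close>
  define e1 where "e1 = min e0 (min (\<delta> / (\<bar>C\<bar> + 1)) (\<kappa> / (L * N + 1)))"
  have LN: "L * N \<ge> 0" using L(1) Npos by simp
  show ?thesis
  proof (rule that[of e1 \<delta> \<kappa>])
    show "e1 > 0" using e0 \<delta> \<kappa> LN by (auto simp: e1_def intro!: divide_pos_pos add_nonneg_pos)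
    show "e1 \<le> e0" by (simp add: e1_def)
    fix eps z a b
    assume eps': "eps \<in> {0<..<e1}" and ab: "a \<le> b" and z: "directed_solution I lam eta eps \<tau> z {a..b}"
      and zK: "\<forall>t\<in>{a..b}. snd (z t) \<in> K" and za: "\<bar>fst (z a) - h eps (snd (z a))\<bar> < \<delta>"
    have eps: "eps > 0" "eps < e0" "\<bar>C\<bar> * eps \<le> \<delta>" "eps * (L * N) \<le> \<kappa>"
    proof -
      show e: "eps > 0" "eps < e0" using eps' by (auto simp: e1_def)
      have "eps \<le> \<delta> / (\<bar>C\<bar> + 1)" "eps \<le> \<kappa> / (L * N + 1)" using eps' by (auto simp: e1_def)
      then have "eps * (\<bar>C\<bar> + 1) \<le> \<delta>" "eps * (L * N + 1) \<le> \<kappa>"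
        using LN by (simp_all only: pos_le_divide_eq add_nonneg_pos abs_ge_zero zero_less_one)
      then show "\<bar>C\<bar> * eps \<le> \<delta>" "eps * (L * N) \<le> \<kappa>" using e by (auto simp: algebra_simps)
    qed
    have C1: "C1_with_gradient (h eps) (G eps) K"
      and hh: "\<And>x. x \<in> K \<Longrightarrow> \<bar>h eps x - h0 x\<bar> \<le> C * eps" "\<And>x. x \<in> K \<Longrightarrow> norm (G eps x - G0 x) \<le> C * eps"
      and pde: "\<And>x. x \<in> K \<Longrightarrow> fast_rhs I (h eps x, x) = eps * (slow_rhs I lam eta (h eps x, x) \<bullet> G eps x)"
      using fam eps by (auto simp: slow_pde_family_def)
    have Ceps: "C * eps \<le> \<bar>C\<bar> * eps" using eps by simp
    have GN: "norm (G eps x) \<le> N" if "x \<in> K" for x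
    proof -
      have "norm (G eps x) \<le> norm (G0 x) + norm (G eps x - G0 x)" by norm
      also have "\<dots> \<le> N0 + \<bar>C\<bar> * eps" using N0[OF that] hh(2)[OF that] Ceps by linarith
      also have "\<dots> \<le> N" unfolding N_def using eps by (intro add_left_mono mult_left_mono) auto
      finally show ?thesis .
    qed
    define y where "y = (\<lambda>t. fst (z t) - h eps (snd (z t)))"
    have "\<bar>y b\<bar> \<le> exp (- (\<kappa> / eps) * (b - a)) * \<bar>y a\<bar>"
    proof (rule decay_within_tube[where y'="\<lambda>t. \<tau> * deviation_rate I lam eta eps (h eps) (G eps) (z t)" and \<delta>=\<delta>])
      fix t assume t: "t \<in> {a..b}"
      have xK: "snd (z t) \<in> K" using zK t by blast
      show "(y has_real_derivative \<tau> * deviation_rate I lam eta eps (h eps) (G eps) (z t)) (at t within {a..b})"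
        unfolding y_def
        by (rule deviation_derivative[where z=z and t=t and h="h eps" and G="G eps", OF z t eps(1) C1_with_gradientD(1)[OF C1 xK] pde[OF xK]])
      assume yt: "\<bar>y t\<bar> < \<delta>"
      let ?x = "snd (z t)" and ?w = "fst (z t)"
      obtain \<xi> where \<xi>: "\<bar>\<xi> - h eps ?x\<bar> \<le> \<bar>y t\<bar>" "fast_rhs I (?w, ?x) - fast_rhs I (h eps ?x, ?x) = y t * fast_slope I (fst ?x + \<xi>) ?x"
        using mvt_between[OF fast_rhs_has_derivative[of I ?x], of "h eps ?x" ?w] unfolding y_def by blast
      have "\<bar>\<tau> * (fast_slope I (fst ?x + \<xi>) ?x - fast_slope I (fst ?x + h0 ?x) ?x)\<bar> \<le> L * \<bar>\<xi> - h0 ?x\<bar>"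
        using L(3)[OF xK, of "fst ?x + \<xi>" "fst ?x + h0 ?x"] \<tau> by (auto simp: abs_mult)
      also have "\<dots> \<le> L * (2 * \<delta>)"
        using hh(1)[OF xK] Ceps eps(3) \<xi>(1) yt L(1) by (intro mult_left_mono) linarith+
      finally have "\<tau> * fast_slope I (fst ?x + \<xi>) ?x \<le> \<tau> * fast_slope I (fst ?x + h0 ?x) ?x + 2 * (L * \<delta>)"
        unfolding right_diff_distrib by linarith
      then have sl: "\<tau> * fast_slope I (fst ?x + \<xi>) ?x \<le> - 2 * \<kappa>" using slope0[OF xK] \<delta>(2) by linarith
      have zt: "z t = (?w, ?x)" by simp
      have f: "fast_rhs I (z t) - fast_rhs I (h eps ?x, ?x) = y t * fast_slope I (fst ?x + \<xi>) ?x" using \<xi>(2) by simp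
      have "y t * (\<tau> * ((fast_rhs I (z t) - fast_rhs I (h eps ?x, ?x)) / eps)) = (\<tau> * fast_slope I (fst ?x + \<xi>) ?x) * (y t)\<^sup>2 / eps"
        unfolding f by (simp add: power2_eq_square)
      also have "\<dots> \<le> (- 2 * \<kappa>) * (y t)\<^sup>2 / eps" using sl eps by (intro divide_right_mono mult_right_mono) auto
      finally have A: "y t * (\<tau> * ((fast_rhs I (z t) - fast_rhs I (h eps ?x, ?x)) / eps)) \<le> (- 2 * \<kappa>) * (y t)\<^sup>2 / eps" .
      have "\<bar>(slow_rhs I lam eta (z t) - slow_rhs I lam eta (h eps ?x, ?x)) \<bullet> G eps ?x\<bar> \<le> (L * \<bar>y t\<bar>) * N"
        using L(2)[OF xK, of ?w "h eps ?x"] GN[OF xK] L(1)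
        by (intro order_trans[OF Cauchy_Schwarz_ineq2] mult_mono) (auto simp: y_def)
      then have "\<bar>y t * (\<tau> * ((slow_rhs I lam eta (z t) - slow_rhs I lam eta (h eps ?x, ?x)) \<bullet> G eps ?x))\<bar> \<le> \<bar>y t\<bar> * ((L * \<bar>y t\<bar>) * N)"
        using \<tau> unfolding abs_mult by (intro mult_left_mono) auto
      also have "\<dots> = (L * N) * (y t)\<^sup>2" by (simp add: power2_eq_square mult_ac)
      also have "\<dots> \<le> (\<kappa> / eps) * (y t)\<^sup>2" using eps(1,4) by (intro mult_right_mono) (auto simp: field_simps)
      finally have B: "\<bar>y t * (\<tau> * ((slow_rhs I lam eta (z t) - slow_rhs I lam eta (h eps ?x, ?x)) \<bullet> G eps ?x))\<bar> \<le> (\<kappa> / eps) * (y t)\<^sup>2" .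
      have "(- 2 * \<kappa>) * (y t)\<^sup>2 / eps = - 2 * ((\<kappa> / eps) * (y t)\<^sup>2)" by simp
      with A B show "y t * (\<tau> * deviation_rate I lam eta eps (h eps) (G eps) (z t)) \<le> - (\<kappa> / eps) * (y t)\<^sup>2"
        unfolding deviation_rate_def right_diff_distrib by linarith
    qed (use ab za \<kappa> eps in \<open>auto simp: y_def\<close>)
    then show "\<bar>fst (z b) - h eps (snd (z b))\<bar> \<le> exp (- \<kappa> * (b - a) / eps) * \<bar>fst (z a) - h eps (snd (z a))\<bar>"
      by (simp add: y_def)
  qed (use \<delta> \<kappa> in auto)
qed

lemma transverse_dist_graph_over:
  "snd p \<in> K \<Longrightarrow> transverse_dist (graph_over K h) p = \<bar>fst p - h (snd p)\<bar>"
proof -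
  assume "snd p \<in> K"
  then have "{w. (w, snd p) \<in> graph_over K h} = {h (snd p)}" by (auto simp: graph_over_iff)
  then show ?thesis by (simp add: transverse_dist_def dist_real_def)
qed

theorem slow_family_attracting:
  assumes cI: "continuous_on UNIV I" and K: "compact K" "K \<noteq> {}" and e0: "e0 > 0"
    and fam: "slow_pde_family I lam eta e0 K h0 G0 h G C"
    and hyp: "\<And>x. x \<in> K \<Longrightarrow> fast_slope I (fst x + h0 x) x < 0"
    and M: "\<And>eps. eps \<in> {0<..<e0} \<Longrightarrow> M eps = graph_over K (h eps)"
  shows "\<exists>e1\<in>{0<..e0}. locally_attracting I lam eta e1 M"
proof -
  obtain e1 \<delta> \<kappa> where e: "e1 > 0" "e1 \<le> e0" "\<delta> > 0" "\<kappa> > 0"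
    and con: "\<And>eps z a b. \<lbrakk>eps \<in> {0<..<e1}; a \<le> b; directed_solution I lam eta eps 1 z {a..b};
       \<forall>t\<in>{a..b}. snd (z t) \<in> K; \<bar>fst (z a) - h eps (snd (z a))\<bar> < \<delta>\<rbrakk> \<Longrightarrow>
       \<bar>fst (z b) - h eps (snd (z b))\<bar> \<le> exp (- \<kappa> * (b - a) / eps) * \<bar>fst (z a) - h eps (snd (z a))\<bar>"
    by (rule slow_family_contraction[OF cI K e0 fam, of 1]) (use hyp in simp_all)
  have "locally_attracting I lam eta e1 M"
    unfolding locally_attracting_def
  proof (rule exI[of _ \<delta>], rule conjI[OF e(3)], rule exI[of _ \<kappa>], rule conjI[OF e(4)], rule exI[of _ 1],
      intro ballI allI impI, elim conjE)
    fix eps z a b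
    assume *: "eps \<in> {0<..<e1}" "a \<le> b" "solution I lam eta eps z {a..b}"
      "\<forall>t\<in>{a..b}. snd (z t) \<in> snd ` M eps" "transverse_dist (M eps) (z a) < \<delta>"
    have Meps: "M eps = graph_over K (h eps)" using * e by (intro M) auto
    have zK: "\<forall>t\<in>{a..b}. snd (z t) \<in> K" using *(4) by (simp add: Meps snd_graph_over)
    have td: "transverse_dist (M eps) (z t) = \<bar>fst (z t) - h eps (snd (z t))\<bar>" if "t \<in> {a..b}" for t
      unfolding Meps using zK that by (intro transverse_dist_graph_over) auto
    show "transverse_dist (M eps) (z b) \<le> 1 * exp (- \<kappa> * (b - a) / eps) * transverse_dist (M eps) (z a)"
      using con[OF *(1,2) *(3)[unfolded solution_directed] zK] *(2,5) td by simp
  qed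
  then show ?thesis using e by auto
qed

theorem slow_family_repelling:
  assumes cI: "continuous_on UNIV I" and K: "compact K" "K \<noteq> {}" and e0: "e0 > 0"
    and fam: "slow_pde_family I lam eta e0 K h0 G0 h G C"
    and hyp: "\<And>x. x \<in> K \<Longrightarrow> fast_slope I (fst x + h0 x) x > 0"
    and M: "\<And>eps. eps \<in> {0<..<e0} \<Longrightarrow> M eps = graph_over K (h eps)"
  shows "\<exists>e1\<in>{0<..e0}. locally_repelling I lam eta e1 M"
proof -
  obtain e1 \<delta> \<kappa> where e: "e1 > 0" "e1 \<le> e0" "\<delta> > 0" "\<kappa> > 0"
    and con: "\<And>eps z a b. \<lbrakk>eps \<in> {0<..<e1}; a \<le> b; directed_solution I lam eta eps (- 1) z {a..b};
       \<forall>t\<in>{a..b}. snd (z t) \<in> K; \<bar>fst (z a) - h eps (snd (z a))\<bar> < \<delta>\<rbrakk> \<Longrightarrow>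
       \<bar>fst (z b) - h eps (snd (z b))\<bar> \<le> exp (- \<kappa> * (b - a) / eps) * \<bar>fst (z a) - h eps (snd (z a))\<bar>"
    by (rule slow_family_contraction[OF cI K e0 fam, of "- 1"]) (use hyp in simp_all)
  have "locally_repelling I lam eta e1 M"
    unfolding locally_repelling_def
  proof (rule exI[of _ \<delta>], rule conjI[OF e(3)], rule exI[of _ \<kappa>], rule conjI[OF e(4)], rule exI[of _ 1],
      intro ballI allI impI, elim conjE)
    fix eps z a b
    assume *: "eps \<in> {0<..<e1}" "a \<le> b" "solution I lam eta eps z {a..b}"
      "\<forall>t\<in>{a..b}. snd (z t) \<in> snd ` M eps" "transverse_dist (M eps) (z b) < \<delta>"
    have Meps: "M eps = graph_over K (h eps)" using * e by (intro M) auto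
    have zK: "\<forall>t\<in>{a..b}. snd (z t) \<in> K" using *(4) by (simp add: Meps snd_graph_over)
    have td: "transverse_dist (M eps) (z t) = \<bar>fst (z t) - h eps (snd (z t))\<bar>" if "t \<in> {a..b}" for t
      unfolding Meps using zK that by (intro transverse_dist_graph_over) auto
    have "\<forall>t\<in>{- b..- a}. snd (z (- t)) \<in> K" using zK by auto
    then show "transverse_dist (M eps) (z a) \<le> 1 * exp (- \<kappa> * (b - a) / eps) * transverse_dist (M eps) (z b)"
      using con[OF *(1) _ solution_reversed[OF *(3)]] *(2,5) td by (simp add: algebra_simps)
  qed
  then show ?thesis using e by auto
qed

section \<open>From local invariance to the invariance equation\<close>

lemma vector_field_c11:
  assumes I: "smooth I"
  shows "c11_at (\<lambda>p. (fast_rhs I p / eps, slow_rhs I lam eta p)) p"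
proof -
  have *: "(\<lambda>p. (fast_rhs I p / eps, slow_rhs I lam eta p)) = (\<lambda>p.
    (- sin (fst (snd p) + fst p) * (I (snd (snd (snd p))) - fst (snd (snd p)) * cos (fst (snd p) + fst p)) * inverse eps,
     lam * fst p, eta * cos (fst (snd p) + fst p) * (I (snd (snd (snd p))) - fst (snd (snd p)) * cos (fst (snd p) + fst p)), 1))"
    by (auto simp: fun_eq_iff divide_inverse)
  show ?thesis unfolding * by (intro c11_at_intros smooth_c11[OF I])
qed

text \<open>Multiplying the field by a bump at p makes it globally Lipschitz. The solution of the
  modified equation solves the original one as long as it stays where the bump is 1.\<close>

lemma local_solution_exists:
  assumes I: "smooth I" and W: "open W" "p \<in> W"
  obtains d z where "d > 0" "z 0 = p" "solution I lam eta eps z {0..d}" "\<And>t. t \<in> {0..d} \<Longrightarrow> z t \<in> W"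
proof -
  let ?X = "\<lambda>p. (fast_rhs I p / eps, slow_rhs I lam eta p)"
  obtain \<beta> :: "state \<Rightarrow> real" and O' S where \<beta>: "\<And>x. c11_at \<beta> x"
    and O': "open O'" "{p} \<subseteq> O'" "\<And>x. x \<in> O' \<Longrightarrow> \<beta> x = 1"
    and S: "compact S" "\<And>x. x \<notin> S \<Longrightarrow> \<beta> x = 0"
    using c11_bump[of "{p}", OF _ open_UNIV subset_UNIV] by (metis finite.emptyI finite_imp_compact finite_insert)
  have "c11_on UNIV (\<lambda>p. \<beta> p *\<^sub>R ?X p)"
    by (rule c11_on_UNIV_compact_support[OF c11_at_scaleR[OF \<beta> vector_field_c11[OF I]] S(1)]) (simp add: S zero_prod_def)
  then obtain L where "\<And>a b. norm (\<beta> a *\<^sub>R ?X a - \<beta> b *\<^sub>R ?X b) \<le> L * norm (a - b)"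
    by (rule c11_on_weaken) blast
  then obtain z where z: "z 0 = p" "\<And>t. t \<ge> 0 \<Longrightarrow> (z has_vector_derivative \<beta> (z t) *\<^sub>R ?X (z t)) (at t within {0..})"
    using lipschitz_ode_global_solution[of "\<lambda>p. \<beta> p *\<^sub>R ?X p" L p] by blast
  have "continuous (at 0 within {0..}) z" using z(2)[of 0] by (auto intro: has_vector_derivative_continuous)
  then have "eventually (\<lambda>t. z t \<in> O' \<inter> W) (at 0 within {0..})"
    unfolding continuous_within using O' W z(1) by (intro topological_tendstoD) auto
  then obtain d where d: "d > 0" "\<And>t. t \<in> {0..} \<Longrightarrow> t \<noteq> 0 \<Longrightarrow> dist t 0 < d \<Longrightarrow> z t \<in> O' \<inter> W"
    by (auto simp: eventually_at)
  have in': "z t \<in> O' \<inter> W" if "t \<in> {0..d / 2}" for t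
    using that d O' W z(1) by (cases "t = 0") auto
  show ?thesis
  proof (rule that[of "d / 2" z])
    show "solution I lam eta eps z {0..d / 2}"
      unfolding solution_def
    proof
      fix t assume t: "t \<in> {0..d / 2}"
      then have "(z has_vector_derivative \<beta> (z t) *\<^sub>R ?X (z t)) (at t within {0..d / 2})"
        by (intro has_vector_derivative_within_subset[OF z(2)]) auto
      then show "(z has_vector_derivative ?X (z t)) (at t within {0..d / 2})"
        using O'(3) in'[OF t] by simp
    qed
  qed (use d z in' in auto)
qed

text \<open>A short orbit started on the graph over an interior point stays over the interior, so it
  does not meet the boundary and local invariance keeps it on the graph. Its fast component then has
  two expressions for its derivative at time 0, and their equality is the equation.\<close>

lemma locally_invariant_imp_pde_interior:
  assumes I: "smooth I" and C1: "C1_with_gradient h G K" and eps: "eps > 0"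
    and inv: "locally_invariant I lam eta eps (graph_over K h)" and x: "x \<in> interior K"
  shows "fast_rhs I (h x, x) = eps * (slow_rhs I lam eta (h x, x) \<bullet> G x)"
proof -
  have xK: "x \<in> K" using x interior_subset by blast
  obtain d z where d: "d > 0" and z0: "z 0 = (h x, x)" and z: "solution I lam eta eps z {0..d}"
    and zW: "\<And>t. t \<in> {0..d} \<Longrightarrow> z t \<in> UNIV \<times> interior K"
    using local_solution_exists[OF I open_Times[OF open_UNIV open_interior], of "(h x, x)" K lam eta eps] x by auto
  have "z 0 \<in> graph_over K h" using z0 xK by (simp add: graph_over_iff)
  then have "(\<forall>t\<in>{0..d}. z t \<in> graph_over K h) \<or>
      (\<exists>t\<in>{0..d}. z t \<in> graph_boundary (graph_over K h) \<and> (\<forall>s\<in>{0..t}. z s \<in> graph_over K h))"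
    using inv d z unfolding locally_invariant_def by (meson less_imp_le)
  moreover have "z t \<notin> graph_boundary (graph_over K h)" if "t \<in> {0..d}" for t
    using zW[OF that] by (auto simp: graph_boundary_iff frontier_def)
  ultimately have zM: "fst (z t) = h (snd (z t))" if "t \<in> {0..d}" for t
    using that by (auto simp: graph_over_iff)
  have dz: "(z has_vector_derivative (fast_rhs I (z 0) / eps, slow_rhs I lam eta (z 0))) (at 0 within {0..d})"
    using z d by (auto simp: solution_def)
  have 1: "((\<lambda>t. fst (z t)) has_vector_derivative fast_rhs I (z 0) / eps) (at 0 within {0..d})"
    by (rule has_vector_derivative_fst_snd[OF dz])
  have "((\<lambda>t. h (snd (z t))) has_real_derivative slow_rhs I lam eta (z 0) \<bullet> G x) (at 0 within {0..d})"
    by (rule GDERIV_chain_within[where x="\<lambda>t. snd (z t)" and h=h and t=0 and G="G x", OF _ has_vector_derivative_fst_snd(2)[OF dz]])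
      (simp add: z0 C1_with_gradientD(1)[OF C1 xK])
  then have 2: "((\<lambda>t. fst (z t)) has_vector_derivative slow_rhs I lam eta (z 0) \<bullet> G x) (at 0 within {0..d})"
    unfolding has_real_derivative_iff_has_vector_derivative
    by (rule has_vector_derivative_transform[rotated 2]) (use d zM in auto)
  have "at (0::real) within {0..d} \<noteq> bot" using d by (simp add: at_within_Icc_at_right)
  then have "fast_rhs I (z 0) / eps = slow_rhs I lam eta (z 0) \<bullet> G x"
    using vector_derivative_unique_within[OF _ 1 2] by simp
  then show ?thesis using eps by (simp add: z0 field_simps)
qed

text \<open>From a boundary point, moving against the gradient of the defining function leads into
  the set where that function is negative, which consists of interior points. Continuous identities
  on the interior therefore extend to all of K.\<close>

lemma compact_domain_closure_interior:
  assumes "compact_domain K" shows "closure (interior K) = K"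
proof
  have cK: "closed K" using assms by (auto simp: compact_domain_def compact_imp_closed)
  show "closure (interior K) \<subseteq> K" using cK closure_minimal interior_subset by blast
  show "K \<subseteq> closure (interior K)"
  proof
    fix p assume pK: "p \<in> K"
    show "p \<in> closure (interior K)"
    proof (cases "p \<in> interior K")
      case False
      then have "p \<in> frontier K" using pK cK by (simp add: frontier_def)
      then obtain U g G where U: "open U" "p \<in> U" "C1_with_gradient g G U" "\<forall>x\<in>U. G x \<noteq> 0" "K \<inter> U = {x\<in>U. g x \<le> 0}"
        using assms unfolding compact_domain_def by blast
      have gU: "continuous_on U g" by (rule C1_with_gradientD(2)[OF U(3)])
      have neg: "x \<in> interior K" if "x \<in> U" "g x < 0" for x
      proof -
        have "open (U \<inter> g -` {..<0})" by (rule continuous_open_preimage[OF gU U(1)]) auto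
        moreover have "U \<inter> g -` {..<0} \<subseteq> K" using U(5) by force
        ultimately show ?thesis using that interior_maximal by blast
      qed
      have gp: "g p \<le> 0" using pK U by blast
      define f where "f = (\<lambda>t. p - t *\<^sub>R G p)"
      have df: "(f has_vector_derivative - G p) (at 0)"
        unfolding f_def by (auto intro!: derivative_eq_intros)
      have "GDERIV g (f 0) :> G p" using C1_with_gradientD(1)[OF U(3,2)] by (simp add: f_def)
      then have dg: "((\<lambda>t. g (f t)) has_real_derivative (- G p) \<bullet> G p) (at 0)"
        using GDERIV_chain_within[where x=f and h=g and t=0 and S=UNIV, OF _ df] by simp
      have Gp: "(- G p) \<bullet> G p < 0" using U by simp
      obtain d where d: "d > 0" "\<And>t. 0 < t \<Longrightarrow> t < d \<Longrightarrow> g (f (0 + t)) < g (f 0)"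
        using DERIV_neg_dec_right[OF dg Gp] by blast
      have cf: "isCont f 0" unfolding f_def by (intro continuous_intros)
      show ?thesis
        unfolding closure_approachable
      proof (intro allI impI)
        fix e :: real assume e: "e > 0"
        have "open (ball p e \<inter> U)" "f 0 \<in> ball p e \<inter> U" using U e by (auto simp: f_def)
        then have "eventually (\<lambda>t. f t \<in> ball p e \<inter> U) (at 0)"
          using cf unfolding isCont_def by (rule topological_tendstoD[rotated 1])
        then obtain d' where d': "d' > 0" "\<And>t. t \<noteq> 0 \<Longrightarrow> dist t 0 < d' \<Longrightarrow> f t \<in> ball p e \<inter> U"
          by (auto simp: eventually_at)
        define t where "t = min d d' / 2"
        have t: "0 < t" "t < d" "dist t 0 < d'" using d d' by (auto simp: t_def)
        have "f t \<in> ball p e \<inter> U" using d'(2)[OF _ t(3)] t by simp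
        moreover have "g (f t) < 0" using d(2)[OF t(1,2)] gp by (simp add: f_def)
        ultimately show "\<exists>y\<in>interior K. dist y p < e" using neg[of "f t"] by (intro bexI[of _ "f t"]) (auto simp: dist_commute)
      qed
    qed (use closure_subset in blast)
  qed
qed

text \<open>Local invariance says nothing directly at boundary points; there the equation follows by
  continuity and the density of the interior.\<close>

theorem locally_invariant_imp_pde:
  assumes I: "smooth I" and K: "compact_domain K" and C1: "C1_with_gradient h G K" and eps: "eps > 0"
    and inv: "locally_invariant I lam eta eps (graph_over K h)" and x: "x \<in> K"
  shows "fast_rhs I (h x, x) = eps * (slow_rhs I lam eta (h x, x) \<bullet> G x)"
proof -
  have cI: "continuous_on UNIV I" using smooth_derivs(4)[OF I] by (simp add: continuous_on_eq_continuous_at)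
  have "continuous_on K (\<lambda>x. fast_rhs I (h x, x) - eps * (slow_rhs I lam eta (h x, x) \<bullet> G x))"
    unfolding fast_rhs_eq slow_rhs_eq
    by (intro continuous_intros continuous_on_compose2[OF cI] C1_with_gradientD(2,3)[OF C1]) auto
  then have cont: "continuous_on (closure (interior K)) (\<lambda>x. fast_rhs I (h x, x) - eps * (slow_rhs I lam eta (h x, x) \<bullet> G x))"
    by (simp only: compact_domain_closure_interior[OF K])
  have "fast_rhs I (h y, y) - eps * (slow_rhs I lam eta (h y, y) \<bullet> G y) = 0" if "y \<in> interior K" for y
    using locally_invariant_imp_pde_interior[OF I C1 eps inv that] by simp
  from continuous_constant_on_closure[OF cont this] x
  show ?thesis by (simp add: compact_domain_closure_interior[OF K])
qed

section \<open>Slow manifolds\<close>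

lemma smooth_continuous: "smooth I \<Longrightarrow> continuous_on UNIV I"
  using smooth_derivs(4) by (simp add: continuous_on_eq_continuous_at)

lemma slow_invariant_manifoldE:
  assumes I: "smooth I" and M: "slow_invariant_manifold I lam eta e0 M0 M"
  obtains K h0 G0 h G C where "compact_domain K" "M0 = graph_over K h0"
    "\<forall>x\<in>K. normally_hyperbolic_zero I (h0 x, x)"
    "slow_pde_family I lam eta e0 K h0 G0 h G C"
    "\<And>eps. eps \<in> {0<..<e0} \<Longrightarrow> M eps = graph_over K (h eps)"
proof -
  obtain K h0 G0 h G C where K: "compact_domain K" and C1: "C1_with_gradient h0 G0 K" and M0: "M0 = graph_over K h0"
    and *: "\<forall>eps\<in>{0<..<e0}. C1_with_gradient (h eps) (G eps) K \<and> M eps = graph_over K (h eps) \<and>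
           (\<forall>x\<in>K. \<bar>h eps x - h0 x\<bar> \<le> C * eps \<and> norm (G eps x - G0 x) \<le> C * eps) \<and>
           locally_invariant I lam eta eps (M eps)"
    using M unfolding slow_invariant_manifold_def by blast
  have "fast_rhs I (h eps x, x) = eps * (slow_rhs I lam eta (h eps x, x) \<bullet> G eps x)"
    if "eps \<in> {0<..<e0}" "x \<in> K" for eps x
  proof (rule locally_invariant_imp_pde[OF I K])
    have "M eps = graph_over K (h eps)" "locally_invariant I lam eta eps (M eps)" using * that(1) by blast+
    then show "locally_invariant I lam eta eps (graph_over K (h eps))" by simp
  qed (use * that in auto)
  then have "slow_pde_family I lam eta e0 K h0 G0 h G C"
    using C1 * unfolding slow_pde_family_def by blast
  moreover have "\<forall>x\<in>K. normally_hyperbolic_zero I (h0 x, x)"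
    using M unfolding slow_invariant_manifold_def critical_manifold_def M0 by (auto simp: graph_over_iff)
  ultimately show ?thesis using that[OF K M0] * by blast
qed

lemma slow_invariant_manifoldI:
  assumes I: "smooth I" and K: "compact_domain K" and nh: "\<forall>x\<in>K. normally_hyperbolic_zero I (h0 x, x)"
    and fam: "slow_pde_family I lam eta e0 K h0 G0 h G C"
  shows "slow_invariant_manifold I lam eta e0 (graph_over K h0) (\<lambda>eps. graph_over K (h eps))"
proof -
  have cK: "compact K" using K by (simp add: compact_domain_def)
  have C1: "C1_with_gradient h0 G0 K" using fam by (simp add: slow_pde_family_def)
  have "locally_invariant I lam eta eps (graph_over K (h eps))" if "eps \<in> {0<..<e0}" for eps
    using fam that unfolding slow_pde_family_def
    by (intro pde_imp_locally_invariant[OF smooth_continuous[OF I] cK, of "h eps" "G eps"]) auto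
  moreover have "critical_manifold I (graph_over K h0)"
    unfolding critical_manifold_def using K C1 nh by (auto simp: graph_over_iff)
  ultimately show ?thesis
    using fam K C1 unfolding slow_invariant_manifold_def slow_pde_family_def by blast
qed

lemma slow_pde_family_mono:
  "slow_pde_family I lam eta e0 K h0 G0 h G C \<Longrightarrow> e1 \<le> e0 \<Longrightarrow> slow_pde_family I lam eta e1 K h0 G0 h G C"
  unfolding slow_pde_family_def by auto

lemma compact_domain_connected: "compact_domain K \<Longrightarrow> connected K"
  by (auto simp: compact_domain_def intro: simply_connected_imp_connected)

theorem critical_manifold_perturbs:
  assumes I: "smooth I" and M0: "critical_manifold I M0"
  shows "\<exists>e0>0. \<exists>M. slow_invariant_manifold I lam eta e0 M0 M"
proof -
  obtain K h0 G0 where K: "compact_domain K" and C1: "C1_with_gradient h0 G0 K" and M0': "M0 = graph_over K h0"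
    and nh: "\<forall>x\<in>K. normally_hyperbolic_zero I (h0 x, x)"
    using M0 unfolding critical_manifold_def by (auto simp: graph_over_iff)
  have cK: "compact K" "K \<noteq> {}" using K by (auto simp: compact_domain_def)
  obtain e0 h1 G1 h G C where e0: "e0 > 0" and fam: "slow_pde_family I lam eta e0 K h1 G1 h G C" and eq: "\<forall>x\<in>K. h1 x = h0 x"
    using slow_pde_family_exists[OF I cK(1) compact_domain_connected[OF K] cK(2) C1_with_gradientD(2)[OF C1] nh] by blast
  have "slow_invariant_manifold I lam eta e0 (graph_over K h1) (\<lambda>eps. graph_over K (h eps))"
    by (rule slow_invariant_manifoldI[OF I K _ fam]) (use nh eq in auto)
  moreover have "graph_over K h1 = M0" unfolding M0' graph_over_def using eq by (auto simp: image_iff)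
  ultimately show ?thesis using e0 by auto
qed

lemma compact_simply_connected_graph_over:
  assumes "compact_domain K" "continuous_on K h"
  shows "compact (graph_over K h)" "simply_connected (graph_over K h)"
proof -
  have K: "compact K" "simply_connected K" using assms by (auto simp: compact_domain_def)
  have c: "continuous_on K (\<lambda>x. (h x, x))" by (intro continuous_intros assms)
  show "compact (graph_over K h)" unfolding graph_over_def by (rule compact_continuous_image[OF c K(1)])
  have "homeomorphism K (graph_over K h) (\<lambda>x. (h x, x)) snd"
    unfolding graph_over_def by (rule homeomorphismI[OF c]) (auto intro!: continuous_intros)
  then have "K homeomorphic graph_over K h" using homeomorphic_def by blast
  then show "simply_connected (graph_over K h)" using K homeomorphic_simply_connected_eq by blast
qed

section \<open>First order expansions and the three forms\<close>

lemma zero_if_O_eps: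
  fixes a B e0 :: real
  assumes "e0 > 0" and *: "\<And>eps. eps \<in> {0<..<e0} \<Longrightarrow> \<bar>a\<bar> \<le> B * eps"
  shows "a = 0"
proof (rule ccontr)
  assume a: "a \<noteq> 0"
  define eps where "eps = min (e0 / 2) (\<bar>a\<bar> / (2 * (\<bar>B\<bar> + 1)))"
  have e: "eps > 0" "eps < e0" "eps \<le> \<bar>a\<bar> / (2 * (\<bar>B\<bar> + 1))" using a assms(1) by (auto simp: eps_def)
  have "B * eps \<le> (\<bar>B\<bar> + 1) * eps" using e by (intro mult_right_mono) auto
  also have "\<dots> \<le> \<bar>a\<bar> / 2" using e(3) by (simp add: field_simps)
  finally show False using *[of eps] e a by auto
qed

text \<open>The branch formula is known only on K, so it determines the gradient directly only in
  the interior; the boundary values follow by continuity.\<close>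

lemma gradient_of_pi_branch:
  assumes K: "compact_domain K" and C1: "C1_with_gradient h0 G0 K"
    and h0: "\<And>x. x \<in> K \<Longrightarrow> h0 x = of_int k * pi - fst x" and x: "x \<in> K"
  shows "G0 x = (- 1, 0, 0)"
proof -
  have int: "G0 y = (- 1, 0, 0)" if y: "y \<in> interior K" for y
  proof -
    have yK: "y \<in> K" using y interior_subset by blast
    have "GDERIV (\<lambda>x. of_int k * pi - fst x) y :> 0 - (1, 0, 0)"
      by (intro GDERIV_diff GDERIV_const GDERIV_coordinates)
    then have "((\<lambda>x. of_int k * pi - fst x) has_derivative (\<lambda>v. v \<bullet> (- 1, 0, 0))) (at y)"
      by (simp add: gderiv_def)
    then have "(h0 has_derivative (\<lambda>v. v \<bullet> (- 1, 0, 0))) (at y)"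
      by (rule has_derivative_transform_within_open[OF _ open_interior y]) (use h0 interior_subset in force)
    moreover have "(h0 has_derivative (\<lambda>v. v \<bullet> G0 y)) (at y)"
      using C1_with_gradientD(1)[OF C1 yK] by (simp add: gderiv_def)
    ultimately have "(\<lambda>v. v \<bullet> G0 y) = (\<lambda>v. v \<bullet> (- 1, 0, 0))" by (rule has_derivative_unique[rotated])
    then show ?thesis by (metis vector_eq_ldot)
  qed
  have "continuous_on (closure (interior K)) G0"
    using C1_with_gradientD(3)[OF C1] by (simp only: compact_domain_closure_interior[OF K])
  from continuous_constant_on_closure[OF this int] x show ?thesis
    by (simp add: compact_domain_closure_interior[OF K])
qed

text \<open>With \<open>v = h eps x - h0 x\<close>, which is O(eps), the left side of the invariance
  equation is \<open>- D x * v\<close> up to order \<open>eps\<^sup>2\<close>. Since gradients are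
  O(eps) close, the right side is, up to the same order, eps times the slow field at h0 paired with
  \<open>(- 1, 0, 0)\<close>, that is \<open>- eps * lam * (k * pi - \<Omega>)\<close>. Solving for
  v gives the formula.\<close>

theorem pi_family_expansion:
  assumes I: "smooth I" and K: "compact_domain K" and e0: "e0 > 0"
    and fam: "slow_pde_family I lam eta e0 K h0 G0 h G C"
    and h0: "\<And>x. x \<in> K \<Longrightarrow> h0 x = of_int k * pi - fst x"
    and ne: "\<And>x. x \<in> K \<Longrightarrow> (- 1) powi k * I (snd (snd x)) - fst (snd x) \<noteq> 0"
  shows "\<exists>C'. \<forall>eps\<in>{0<..<e0}. \<forall>x\<in>K.
     \<bar>h eps x - (of_int k * pi - fst x) * (1 + eps * lam / ((- 1) powi k * I (snd (snd x)) - fst (snd x)))\<bar> \<le> C' * eps\<^sup>2"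
proof -
  note cI = smooth_continuous[OF I]
  have cK: "compact K" "K \<noteq> {}" using K by (auto simp: compact_domain_def)
  have C10: "C1_with_gradient h0 G0 K" using fam by (simp add: slow_pde_family_def)
  have G0: "G0 x = (- 1, 0, 0)" if "x \<in> K" for x by (rule gradient_of_pi_branch[OF K C10 h0 that])
  define D where "D = (\<lambda>x::slow. (- 1) powi k * I (snd (snd x)) - fst (snd x))"
  have "continuous_on K (\<lambda>x. \<bar>D x\<bar>)"
    unfolding D_def by (intro continuous_intros continuous_on_compose2[OF cI]) auto
  then obtain x0 where x0: "x0 \<in> K" "\<And>x. x \<in> K \<Longrightarrow> \<bar>D x0\<bar> \<le> \<bar>D x\<bar>"
    using continuous_attains_inf[OF cK] by blast
  define d where "d = \<bar>D x0\<bar>"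
  have d: "d > 0" using ne[OF x0(1)] by (simp add: d_def D_def)
  obtain L where L: "L \<ge> 0"
    "\<And>x v w. x \<in> K \<Longrightarrow> norm (slow_rhs I lam eta (v, x) - slow_rhs I lam eta (w, x)) \<le> L * \<bar>v - w\<bar>"
    "\<And>x v w. x \<in> K \<Longrightarrow> \<bar>fast_slope I v x - fast_slope I w x\<bar> \<le> L * \<bar>v - w\<bar>"
    using fast_direction_lipschitz[OF cI cK(1), where lam=lam and eta=eta] by metis
  have "continuous_on K (\<lambda>x. slow_rhs I lam eta (h0 x, x))"
    unfolding slow_rhs_eq
    by (intro continuous_intros continuous_on_compose2[OF cI] C1_with_gradientD(2)[OF C10]) auto
  then obtain S where S: "\<And>x. x \<in> K \<Longrightarrow> norm (slow_rhs I lam eta (h0 x, x)) \<le> S"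
    using compact_imp_bounded[OF compact_continuous_image[OF _ cK(1)]] by (fastforce simp: bounded_iff)
  have S0: "S \<ge> 0" using S[OF x0(1)] norm_ge_zero order_trans by blast
  define N where "N = 1 + \<bar>C\<bar> * e0"
  have N0: "N \<ge> 0" using e0 by (simp add: N_def)
  define C' where "C' = (L * \<bar>C\<bar> * \<bar>C\<bar> + (L * \<bar>C\<bar> * N + S * \<bar>C\<bar>)) / d"
  show ?thesis
  proof (intro exI[of _ C'] ballI)
    fix eps x assume eps': "eps \<in> {0<..<e0}" and x: "x \<in> K"
    then have eps: "eps > 0" "eps < e0" by auto
    have hC: "\<bar>h eps x - h0 x\<bar> \<le> \<bar>C\<bar> * eps" and GC: "norm (G eps x - G0 x) \<le> \<bar>C\<bar> * eps"
      and pde: "fast_rhs I (h eps x, x) = eps * (slow_rhs I lam eta (h eps x, x) \<bullet> G eps x)"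
    proof -
      have "C * eps \<le> \<bar>C\<bar> * eps" using eps by simp
      moreover have "\<bar>h eps x - h0 x\<bar> \<le> C * eps" "norm (G eps x - G0 x) \<le> C * eps"
        using fam eps' x by (auto simp: slow_pde_family_def)
      ultimately show "\<bar>h eps x - h0 x\<bar> \<le> \<bar>C\<bar> * eps" "norm (G eps x - G0 x) \<le> \<bar>C\<bar> * eps" by linarith+
      show "fast_rhs I (h eps x, x) = eps * (slow_rhs I lam eta (h eps x, x) \<bullet> G eps x)"
        using fam eps' x by (auto simp: slow_pde_family_def)
    qed
    define v where "v = h eps x - h0 x"
    have Ce: "\<bar>C\<bar> * eps \<ge> 0" using eps by simp
    have ux: "fst x + h0 x = of_int k * pi" by (simp add: h0[OF x])
    have f0: "fast_rhs I (h0 x, x) = 0" by (simp add: fast_rhs_eq ux sin_int_pi)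
    obtain \<xi> where \<xi>: "\<bar>\<xi> - h0 x\<bar> \<le> \<bar>v\<bar>" "fast_rhs I (h eps x, x) - fast_rhs I (h0 x, x) = v * fast_slope I (fst x + \<xi>) x"
      using mvt_between[OF fast_rhs_has_derivative[of I x], of "h0 x" "h eps x"] unfolding v_def by blast
    define r1 where "r1 = v * (fast_slope I (fst x + \<xi>) x - fast_slope I (fst x + h0 x) x)"
    have f: "fast_rhs I (h eps x, x) = - D x * v + r1"
    proof -
      have "fast_slope I (fst x + h0 x) x = - D x" by (simp only: ux fast_slope_pi D_def)
      then show ?thesis using \<xi>(2) by (simp add: f0 r1_def algebra_simps)
    qed
    have "\<bar>r1\<bar> \<le> (\<bar>C\<bar> * eps) * (L * (\<bar>C\<bar> * eps))"
    proof -
      have "\<bar>fast_slope I (fst x + \<xi>) x - fast_slope I (fst x + h0 x) x\<bar> \<le> L * \<bar>\<xi> - h0 x\<bar>"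
        using L(3)[OF x, of "fst x + \<xi>" "fst x + h0 x"] by simp
      also have "\<dots> \<le> L * (\<bar>C\<bar> * eps)" using \<xi>(1) hC L(1) by (intro mult_left_mono) (auto simp: v_def)
      finally show ?thesis unfolding r1_def abs_mult using hC Ce by (intro mult_mono) (auto simp: v_def)
    qed
    then have r1: "\<bar>r1\<bar> \<le> L * \<bar>C\<bar> * \<bar>C\<bar> * eps\<^sup>2" by (simp add: power2_eq_square mult_ac)
    define r2 where "r2 = (slow_rhs I lam eta (h eps x, x) - slow_rhs I lam eta (h0 x, x)) \<bullet> G eps x
       + slow_rhs I lam eta (h0 x, x) \<bullet> (G eps x - G0 x)"
    have "slow_rhs I lam eta (h eps x, x) \<bullet> G eps x = slow_rhs I lam eta (h0 x, x) \<bullet> G0 x + r2"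
      by (simp add: r2_def inner_diff_left inner_diff_right)
    also have "slow_rhs I lam eta (h0 x, x) \<bullet> G0 x = - (lam * (of_int k * pi - fst x))"
      by (simp add: G0[OF x] slow_rhs_eq h0[OF x])
    finally have g: "slow_rhs I lam eta (h eps x, x) \<bullet> G eps x = - (lam * (of_int k * pi - fst x)) + r2" .
    have r2: "\<bar>r2\<bar> \<le> (L * \<bar>C\<bar> * N + S * \<bar>C\<bar>) * eps"
    proof -
      have "norm (G eps x) \<le> norm (G0 x) + norm (G eps x - G0 x)" by norm
      also have "norm (G0 x) = 1" by (simp add: G0[OF x] norm_Pair)
      also have "norm (G eps x - G0 x) \<le> \<bar>C\<bar> * e0" using GC eps by (intro order_trans[OF GC] mult_left_mono) auto
      finally have GN: "norm (G eps x) \<le> N" by (simp add: N_def)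
      have "norm (slow_rhs I lam eta (h eps x, x) - slow_rhs I lam eta (h0 x, x)) \<le> L * (\<bar>C\<bar> * eps)"
        using hC L(1) by (intro order_trans[OF L(2)[OF x]] mult_left_mono) auto
      then have "\<bar>(slow_rhs I lam eta (h eps x, x) - slow_rhs I lam eta (h0 x, x)) \<bullet> G eps x\<bar> \<le> L * (\<bar>C\<bar> * eps) * N"
        using GN L(1) Ce by (intro order_trans[OF Cauchy_Schwarz_ineq2] mult_mono) auto
      moreover have "\<bar>slow_rhs I lam eta (h0 x, x) \<bullet> (G eps x - G0 x)\<bar> \<le> S * (\<bar>C\<bar> * eps)"
        using GC S[OF x] S0 by (intro order_trans[OF Cauchy_Schwarz_ineq2] mult_mono) auto
      ultimately show ?thesis unfolding r2_def by (simp add: algebra_simps)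
    qed
    have "\<bar>eps * r2\<bar> \<le> eps * ((L * \<bar>C\<bar> * N + S * \<bar>C\<bar>) * eps)"
      unfolding abs_mult using eps r2 by (intro mult_mono) auto
    then have r2': "\<bar>eps * r2\<bar> \<le> (L * \<bar>C\<bar> * N + S * \<bar>C\<bar>) * eps\<^sup>2" by (simp add: power2_eq_square mult_ac)
    have Dx: "D x \<noteq> 0" "d \<le> \<bar>D x\<bar>" using ne[OF x] x0(2)[OF x] by (auto simp: D_def d_def)
    have "- D x * v + r1 = eps * (- (lam * (of_int k * pi - fst x)) + r2)" using pde f g by simp
    then have "D x * v = eps * (lam * (of_int k * pi - fst x)) + (r1 - eps * r2)" by (simp add: algebra_simps)
    then have "v = (eps * (lam * (of_int k * pi - fst x)) + (r1 - eps * r2)) / D x" using Dx by (simp add: field_simps)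
    then have "h eps x - (of_int k * pi - fst x) * (1 + eps * lam / D x) = (r1 - eps * r2) / D x"
      using Dx by (simp add: v_def h0[OF x] field_simps)
    then have "\<bar>h eps x - (of_int k * pi - fst x) * (1 + eps * lam / D x)\<bar> = \<bar>r1 - eps * r2\<bar> / \<bar>D x\<bar>"
      by (simp add: abs_divide)
    also have "\<dots> \<le> ((L * \<bar>C\<bar> * \<bar>C\<bar> + (L * \<bar>C\<bar> * N + S * \<bar>C\<bar>)) * eps\<^sup>2) / d"
      using r1 r2' d Dx(2) by (intro frac_le) (auto simp: algebra_simps)
    finally show "\<bar>h eps x - (of_int k * pi - fst x) * (1 + eps * lam / ((- 1) powi k * I (snd (snd x)) - fst (snd x)))\<bar> \<le> C' * eps\<^sup>2"
      by (simp add: C'_def D_def)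
  qed
qed

lemma Ball_graph_over: "(\<forall>p\<in>graph_over K h. P p) \<longleftrightarrow> (\<forall>x\<in>K. P (h x, x))"
  by (auto simp: graph_over_def)

lemma case_state_eq: "(case (w, x) of (\<omega>, \<Omega>, \<alpha>, \<theta>) \<Rightarrow> P \<omega> \<Omega> \<alpha> \<theta>) = P w (fst x) (fst (snd x)) (snd (snd x))"
  by (cases x) auto

lemma Ball_graph_family:
  assumes "\<forall>eps\<in>{0<..<e0}. M eps = graph_over K (h eps)"
  shows "(\<forall>eps\<in>{0<..<e0::real}. \<forall>p\<in>M eps. P eps p) \<longleftrightarrow> (\<forall>eps\<in>{0<..<e0}. \<forall>x\<in>K. P eps (h eps x, x))"
  using assms by (auto simp: Ball_graph_over)

lemma form_pi_minus_graph:
  assumes "\<forall>eps\<in>{0<..<e0}. M eps = graph_over K (h eps)"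
  shows "form_pi_minus I lam k e0 M \<longleftrightarrow> (\<exists>C. \<forall>eps\<in>{0<..<e0}. \<forall>x\<in>K. fst (snd x) < (- 1) powi k * I (snd (snd x)) \<and>
     \<bar>h eps x - (of_int k * pi - fst x) * (1 + eps * lam / ((- 1) powi k * I (snd (snd x)) - fst (snd x)))\<bar> \<le> C * eps\<^sup>2)"
  unfolding form_pi_minus_def Ball_graph_family[OF assms] case_state_eq ..

lemma form_pi_plus_graph:
  assumes "\<forall>eps\<in>{0<..<e0}. M eps = graph_over K (h eps)"
  shows "form_pi_plus I lam k e0 M \<longleftrightarrow> (\<exists>C. \<forall>eps\<in>{0<..<e0}. \<forall>x\<in>K. fst (snd x) > (- 1) powi k * I (snd (snd x)) \<and>
     \<bar>h eps x - (of_int k * pi - fst x) * (1 + eps * lam / ((- 1) powi k * I (snd (snd x)) - fst (snd x)))\<bar> \<le> C * eps\<^sup>2)"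
  unfolding form_pi_plus_def Ball_graph_family[OF assms] case_state_eq ..

lemma form_F_graph:
  assumes "\<forall>eps\<in>{0<..<e0}. M eps = graph_over K (h eps)"
  shows "form_F I e0 M \<longleftrightarrow> (\<exists>C. \<forall>eps\<in>{0<..<e0}. \<forall>x\<in>K.
     \<bar>fst (snd x) * cos (fst x + h eps x) - I (snd (snd x))\<bar> \<le> C * eps \<and> sin (fst x + h eps x) \<noteq> 0 \<and> fst (snd x) \<noteq> 0)"
  unfolding form_F_def Ball_graph_family[OF assms] case_state_eq ..

text \<open>Both claims pass from h0 to \<open>h eps\<close> by the Lipschitz continuity of cosine
  and sine. The bound e1 keeps the displacement \<open>\<bar>C\<bar> * eps\<close> below the minimum
  d of the modulus of the sine on the critical branch.\<close>

theorem F_family_form: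
  assumes I: "smooth I" and K: "compact_domain K" and e0: "e0 > 0"
    and fam: "slow_pde_family I lam eta e0 K h0 G0 h G C"
    and F: "\<And>x. x \<in> K \<Longrightarrow> fst (snd x) * cos (fst x + h0 x) = I (snd (snd x))"
      "\<And>x. x \<in> K \<Longrightarrow> sin (fst x + h0 x) \<noteq> 0" "\<And>x. x \<in> K \<Longrightarrow> fst (snd x) \<noteq> 0"
  shows "\<exists>e1\<in>{0<..e0}. \<exists>C'. \<forall>eps\<in>{0<..<e1}. \<forall>x\<in>K.
     \<bar>fst (snd x) * cos (fst x + h eps x) - I (snd (snd x))\<bar> \<le> C' * eps \<and> sin (fst x + h eps x) \<noteq> 0 \<and> fst (snd x) \<noteq> 0"
proof -
  have cK: "compact K" "K \<noteq> {}" using K by (auto simp: compact_domain_def)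
  have C10: "C1_with_gradient h0 G0 K" using fam by (simp add: slow_pde_family_def)
  have "continuous_on K (\<lambda>x. \<bar>sin (fst x + h0 x)\<bar>)" by (intro continuous_intros C1_with_gradientD(2)[OF C10])
  then obtain x0 where x0: "x0 \<in> K" "\<And>x. x \<in> K \<Longrightarrow> \<bar>sin (fst x0 + h0 x0)\<bar> \<le> \<bar>sin (fst x + h0 x)\<bar>"
    using continuous_attains_inf[OF cK] by blast
  define d where "d = \<bar>sin (fst x0 + h0 x0)\<bar>"
  have d: "d > 0" using F(2)[OF x0(1)] by (simp add: d_def)
  have "continuous_on K (\<lambda>x::slow. \<bar>fst (snd x)\<bar>)" by (intro continuous_intros)
  then obtain xm :: slow where xm: "\<And>x. x \<in> K \<Longrightarrow> \<bar>fst (snd x)\<bar> \<le> \<bar>fst (snd xm)\<bar>"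
    using continuous_attains_sup[OF cK] by blast
  define e1 where "e1 = min e0 (d / (\<bar>C\<bar> + 1))"
  show ?thesis
  proof (intro bexI[of _ e1] exI[of _ "\<bar>fst (snd xm)\<bar> * \<bar>C\<bar>"] ballI conjI)
    show "e1 \<in> {0<..e0}" using e0 d by (auto simp: e1_def intro!: divide_pos_pos add_nonneg_pos)
    fix eps x assume eps': "eps \<in> {0<..<e1}" and x: "x \<in> K"
    then have eps: "0 < eps" "eps < e0" "eps < d / (\<bar>C\<bar> + 1)" by (auto simp: e1_def)
    have "\<bar>h eps x - h0 x\<bar> \<le> C * eps" using fam eps x by (auto simp: slow_pde_family_def)
    moreover have "C * eps \<le> \<bar>C\<bar> * eps" using eps by simp
    ultimately have hC: "\<bar>h eps x - h0 x\<bar> \<le> \<bar>C\<bar> * eps" by linarith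
    have "\<bar>fst (snd x) * cos (fst x + h eps x) - I (snd (snd x))\<bar>
        = \<bar>fst (snd x)\<bar> * \<bar>cos (fst x + h eps x) - cos (fst x + h0 x)\<bar>"
      using F(1)[OF x] by (simp add: abs_mult[symmetric] right_diff_distrib)
    also have "\<dots> \<le> \<bar>fst (snd xm)\<bar> * (\<bar>C\<bar> * eps)"
      using xm[OF x] sin_cos_lipschitz(2)[of "fst x + h eps x" "fst x + h0 x"] hC by (intro mult_mono) auto
    finally show "\<bar>fst (snd x) * cos (fst x + h eps x) - I (snd (snd x))\<bar> \<le> \<bar>fst (snd xm)\<bar> * \<bar>C\<bar> * eps"
      by (simp add: mult.assoc)
    have "\<bar>C\<bar> * eps \<le> (\<bar>C\<bar> + 1) * eps" using eps by (intro mult_right_mono) auto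
    also have "\<dots> < d" using eps(3) by (simp add: field_simps)
    finally have "\<bar>C\<bar> * eps < d" .
    moreover have "d \<le> \<bar>sin (fst x + h0 x)\<bar>" using x0(2)[OF x] by (simp add: d_def)
    moreover have "\<bar>sin (fst x + h eps x) - sin (fst x + h0 x)\<bar> \<le> \<bar>h eps x - h0 x\<bar>"
      using sin_cos_lipschitz(1)[of "fst x + h eps x" "fst x + h0 x"] by simp
    ultimately show "sin (fst x + h eps x) \<noteq> 0" using hC by auto
    show "fst (snd x) \<noteq> 0" by (rule F(3)[OF x])
  qed
qed

text \<open>The type of a slow manifold is that of its critical branch. In the two cases with phase
  k pi the given e0 serves; in the remaining case it is reduced to keep the sine away from
  0.\<close>

theorem slow_manifold_of_three_forms:
  assumes I: "smooth I" and e0: "e0 > 0" and M: "slow_invariant_manifold I lam eta e0 M0 M"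
  shows "\<exists>e1\<in>{0<..e0}. of_three_forms I lam e1 M \<and> (\<forall>eps\<in>{0<..<e1}. compact (M eps) \<and> simply_connected (M eps))"
proof -
  obtain K h0 G0 h G C where K: "compact_domain K" and nh: "\<forall>x\<in>K. normally_hyperbolic_zero I (h0 x, x)"
    and fam: "slow_pde_family I lam eta e0 K h0 G0 h G C"
    and Meq: "\<And>eps. eps \<in> {0<..<e0} \<Longrightarrow> M eps = graph_over K (h eps)"
    using slow_invariant_manifoldE[OF I M] by metis
  have cK: "compact K" "K \<noteq> {}" using K by (auto simp: compact_domain_def)
  have C10: "C1_with_gradient h0 G0 K" using fam by (simp add: slow_pde_family_def)
  have cs: "compact (M eps) \<and> simply_connected (M eps)" if "eps \<in> {0<..<e0}" for eps
  proof -
    have "C1_with_gradient (h eps) (G eps) K" using fam that by (simp add: slow_pde_family_def)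
    then show ?thesis using compact_simply_connected_graph_over[OF K C1_with_gradientD(2)] Meq[OF that] by simp
  qed
  have Meq': "\<forall>eps\<in>{0<..<e1}. M eps = graph_over K (h eps)" if "e1 \<le> e0" for e1 using Meq that by auto
  have "\<exists>e1\<in>{0<..e0}. of_three_forms I lam e1 M"
  proof (cases rule: critical_branch_cases[OF compact_domain_connected[OF K] cK(2) C1_with_gradientD(2)[OF C10] smooth_continuous[OF I] nh, case_names minus plus F])
    case (minus k)
    have "form_pi_minus I lam k e0 M"
      unfolding form_pi_minus_graph[OF Meq'[OF order_refl]]
      using pi_family_expansion[OF I K e0 fam minus(1)] minus(2) by fastforce
    then show ?thesis using e0 unfolding of_three_forms_def by (intro bexI[of _ e0]) auto
  next
    case (plus k)
    have "form_pi_plus I lam k e0 M"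
      unfolding form_pi_plus_graph[OF Meq'[OF order_refl]]
      using pi_family_expansion[OF I K e0 fam plus(1)] plus(2) by fastforce
    then show ?thesis using e0 unfolding of_three_forms_def by (intro bexI[of _ e0]) auto
  next
    case (F m)
    have dom: "x \<in> arccos_domain I" if "x \<in> K" for x using F(2) that by blast
    have u: "fst x + h0 x = arccos_branch I m x" if "x \<in> K" for x using F(1)[OF that] by simp
    obtain e1 where e1: "e1 \<in> {0<..e0}" and *: "\<exists>C'. \<forall>eps\<in>{0<..<e1}. \<forall>x\<in>K.
       \<bar>fst (snd x) * cos (fst x + h eps x) - I (snd (snd x))\<bar> \<le> C' * eps \<and> sin (fst x + h eps x) \<noteq> 0 \<and> fst (snd x) \<noteq> 0"
      using F_family_form[OF I K e0 fam] arccos_branch_cos_sin[OF dom] u dom unfolding arccos_domain_def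
      by (smt (verit, best) mem_Collect_eq)
    have "form_F I e1 M" using * e1 by (subst form_F_graph[OF Meq']) auto
    then show ?thesis using e1 unfolding of_three_forms_def by blast
  qed
  then show ?thesis using cs by fastforce
qed

text \<open>In the limit of small eps each form yields the equation of the critical branch, either
  \<open>h0 x = k * pi - \<Omega>\<close> or \<open>\<alpha> * cos u = I \<theta>\<close>, and with
  it the sign of \<open>fast_slope\<close>. The contraction estimate, with time reversed in the
  repelling case, then applies.\<close>

theorem slow_manifold_stability:
  assumes I: "smooth I" and e0: "e0 > 0" and M: "slow_invariant_manifold I lam eta e0 M0 M"
  shows "form_pi_minus I lam k e0 M \<Longrightarrow> \<exists>e1\<in>{0<..e0}. locally_attracting I lam eta e1 M" (is "?m \<Longrightarrow> _")
    and "form_pi_plus I lam k e0 M \<Longrightarrow> \<exists>e1\<in>{0<..e0}. locally_repelling I lam eta e1 M" (is "?p \<Longrightarrow> _")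
    and "form_F I e0 M \<Longrightarrow> \<exists>e1\<in>{0<..e0}.
              if \<forall>eps\<in>{0<..<e0}. \<forall>(\<omega>, \<Omega>, \<alpha>, \<theta>)\<in>M eps. \<alpha> > 0
              then locally_attracting I lam eta e1 M
              else locally_repelling I lam eta e1 M" (is "?F \<Longrightarrow> _")
proof -
  obtain K h0 G0 h G C where K: "compact_domain K" and nh: "\<forall>x\<in>K. normally_hyperbolic_zero I (h0 x, x)"
    and fam: "slow_pde_family I lam eta e0 K h0 G0 h G C"
    and Meq: "\<And>eps. eps \<in> {0<..<e0} \<Longrightarrow> M eps = graph_over K (h eps)"
    using slow_invariant_manifoldE[OF I M] by metis
  have cK: "compact K" "K \<noteq> {}" using K by (auto simp: compact_domain_def)
  note cI = smooth_continuous[OF I]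
  have Meq': "\<forall>eps\<in>{0<..<e0}. M eps = graph_over K (h eps)" using Meq by blast
  have half: "e0 / 2 \<in> {0<..<e0}" using e0 by auto
  have hC: "\<bar>h eps x - h0 x\<bar> \<le> \<bar>C\<bar> * eps" if "eps \<in> {0<..<e0}" "x \<in> K" for eps x
  proof -
    have "\<bar>h eps x - h0 x\<bar> \<le> C * eps" using fam that by (auto simp: slow_pde_family_def)
    also have "\<dots> \<le> \<bar>C\<bar> * eps" using that by (intro mult_right_mono) auto
    finally show ?thesis .
  qed
  have limit: "h0 x = of_int k * pi - fst x"
    if "\<forall>eps\<in>{0<..<e0}. \<bar>h eps x - (of_int k * pi - fst x) * (1 + eps * lam / D)\<bar> \<le> C1 * eps\<^sup>2" and x: "x \<in> K"
    for x D C1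
  proof -
    have "h0 x - (of_int k * pi - fst x) = 0"
    proof (rule zero_if_O_eps[OF e0])
      fix eps assume e: "eps \<in> {0<..<e0}"
      have "\<bar>C1\<bar> * eps\<^sup>2 \<le> \<bar>C1\<bar> * (e0 * eps)"
        using e by (intro mult_left_mono) (auto simp: power2_eq_square)
      moreover have "C1 * eps\<^sup>2 \<le> \<bar>C1\<bar> * eps\<^sup>2" by (intro mult_right_mono) auto
      ultimately have 1: "\<bar>h eps x - (of_int k * pi - fst x) * (1 + eps * lam / D)\<bar> \<le> \<bar>C1\<bar> * (e0 * eps)"
        using bspec[OF that(1) e] by linarith
      have 2: "(of_int k * pi - fst x) * (1 + eps * lam / D) = (of_int k * pi - fst x) + ((of_int k * pi - fst x) * lam / D) * eps"
        by (simp add: distrib_left)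
      have 3: "\<bar>((of_int k * pi - fst x) * lam / D) * eps\<bar> = \<bar>(of_int k * pi - fst x) * lam / D\<bar> * eps"
        using e by (simp add: abs_mult)
      have "\<bar>h0 x - (of_int k * pi - fst x)\<bar> \<le> \<bar>C\<bar> * eps + \<bar>C1\<bar> * (e0 * eps) + \<bar>(of_int k * pi - fst x) * lam / D\<bar> * eps"
      proof -
        have "\<bar>b - q\<bar> \<le> Z + X + Y" if "\<bar>a - (q + r)\<bar> \<le> X" "\<bar>r\<bar> = Y" "\<bar>a - b\<bar> \<le> Z" for a b q r X Y Z :: real
          using that by linarith
        from this[OF 1[unfolded 2] 3 hC[OF e x]] show ?thesis .
      qed
      then show "\<bar>h0 x - (of_int k * pi - fst x)\<bar> \<le> (\<bar>C\<bar> + \<bar>C1\<bar> * e0 + \<bar>(of_int k * pi - fst x) * lam / D\<bar>) * eps"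
        by (simp add: algebra_simps)
    qed
    then show ?thesis by simp
  qed
  show "\<exists>e1\<in>{0<..e0}. locally_attracting I lam eta e1 M" if m: ?m
  proof (rule slow_family_attracting[OF cI cK e0 fam _ Meq])
    fix x assume x: "x \<in> K"
    obtain C1 where C1: "\<forall>eps\<in>{0<..<e0}. \<forall>x\<in>K. fst (snd x) < (- 1) powi k * I (snd (snd x)) \<and>
       \<bar>h eps x - (of_int k * pi - fst x) * (1 + eps * lam / ((- 1) powi k * I (snd (snd x)) - fst (snd x)))\<bar> \<le> C1 * eps\<^sup>2"
      using m[unfolded form_pi_minus_graph[OF Meq']] by blast
    have "h0 x = of_int k * pi - fst x" by (rule limit[OF _ x]) (use C1 x in blast)
    then have "fst x + h0 x = of_int k * pi" by simp
    moreover have "fst (snd x) < (- 1) powi k * I (snd (snd x))" using C1 half x by blast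
    ultimately show "fast_slope I (fst x + h0 x) x < 0" by (simp only: fast_slope_pi)
  qed
  show "\<exists>e1\<in>{0<..e0}. locally_repelling I lam eta e1 M" if p: ?p
  proof (rule slow_family_repelling[OF cI cK e0 fam _ Meq])
    fix x assume x: "x \<in> K"
    obtain C1 where C1: "\<forall>eps\<in>{0<..<e0}. \<forall>x\<in>K. fst (snd x) > (- 1) powi k * I (snd (snd x)) \<and>
       \<bar>h eps x - (of_int k * pi - fst x) * (1 + eps * lam / ((- 1) powi k * I (snd (snd x)) - fst (snd x)))\<bar> \<le> C1 * eps\<^sup>2"
      using p[unfolded form_pi_plus_graph[OF Meq']] by blast
    have "h0 x = of_int k * pi - fst x" by (rule limit[OF _ x]) (use C1 x in blast)
    then have "fst x + h0 x = of_int k * pi" by simp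
    moreover have "fst (snd x) > (- 1) powi k * I (snd (snd x))" using C1 half x by blast
    ultimately show "fast_slope I (fst x + h0 x) x > 0" by (simp only: fast_slope_pi)
  qed
  show "\<exists>e1\<in>{0<..e0}.
              if \<forall>eps\<in>{0<..<e0}. \<forall>(\<omega>, \<Omega>, \<alpha>, \<theta>)\<in>M eps. \<alpha> > 0
              then locally_attracting I lam eta e1 M
              else locally_repelling I lam eta e1 M" if F: ?F
  proof -
    obtain C1 where C1: "\<forall>eps\<in>{0<..<e0}. \<forall>x\<in>K. \<bar>fst (snd x) * cos (fst x + h eps x) - I (snd (snd x))\<bar> \<le> C1 * eps \<and>
        sin (fst x + h eps x) \<noteq> 0 \<and> fst (snd x) \<noteq> 0"
      using F[unfolded form_F_graph[OF Meq']] by blast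
    have slope: "fast_slope I (fst x + h0 x) x = - (fst (snd x) * (sin (fst x + h0 x))\<^sup>2)"
      and sin0: "sin (fst x + h0 x) \<noteq> 0" if x: "x \<in> K" for x
    proof -
      have "fst (snd x) * cos (fst x + h0 x) - I (snd (snd x)) = 0"
      proof (rule zero_if_O_eps[OF e0])
        fix eps assume e: "eps \<in> {0<..<e0}"
        have "\<bar>fst (snd x) * cos (fst x + h eps x) - fst (snd x) * cos (fst x + h0 x)\<bar> \<le> \<bar>fst (snd x)\<bar> * (\<bar>C\<bar> * eps)"
          unfolding right_diff_distrib[symmetric] abs_mult
          using sin_cos_lipschitz(2)[of "fst x + h eps x" "fst x + h0 x"] hC[OF e x] by (intro mult_left_mono) auto
        moreover have "\<bar>fst (snd x) * cos (fst x + h eps x) - I (snd (snd x))\<bar> \<le> C1 * eps" using C1 e x by blast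
        ultimately have "\<bar>fst (snd x) * cos (fst x + h0 x) - I (snd (snd x))\<bar> \<le> C1 * eps + \<bar>fst (snd x)\<bar> * (\<bar>C\<bar> * eps)"
          by linarith
        then show "\<bar>fst (snd x) * cos (fst x + h0 x) - I (snd (snd x))\<bar> \<le> (C1 + \<bar>fst (snd x)\<bar> * \<bar>C\<bar>) * eps"
          by (simp add: algebra_simps)
      qed
      then show s: "fast_slope I (fst x + h0 x) x = - (fst (snd x) * (sin (fst x + h0 x))\<^sup>2)"
        by (intro fast_slope_F) simp
      \<comment> \<open>That the sine is nonzero for each positive eps could be lost in the limit;
        normal hyperbolicity of the critical branch supplies it for h0.\<close>
      have "fast_slope I (fst x + h0 x) x \<noteq> 0" using bspec[OF nh x] by (simp add: normally_hyperbolic_zero_iff)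
      then show "sin (fst x + h0 x) \<noteq> 0" using s by auto
    qed
    have a0: "fst (snd x) \<noteq> 0" if "x \<in> K" for x using C1 half that by blast
    \<comment> \<open>As \<alpha> has one sign on the connected set K, failing to be positive
      everywhere amounts to being negative everywhere, which is what the else branch
      requires.\<close>
    have sign: "(\<forall>x\<in>K. fst (snd x) > 0) \<or> (\<forall>x\<in>K. fst (snd x) < 0)"
      by (rule connected_nonzero_sign[OF compact_domain_connected[OF K]]) (auto intro!: continuous_intros a0)
    have cond: "(\<forall>eps\<in>{0<..<e0}. \<forall>(\<omega>, \<Omega>, \<alpha>, \<theta>)\<in>M eps. \<alpha> > 0) \<longleftrightarrow> (\<forall>x\<in>K. fst (snd x) > 0)"
      unfolding Ball_graph_family[OF Meq'] case_state_eq using half by blast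
    show ?thesis
    proof (cases "\<forall>x\<in>K. fst (snd x) > 0")
      case True
      have "\<exists>e1\<in>{0<..e0}. locally_attracting I lam eta e1 M"
      proof (rule slow_family_attracting[OF cI cK e0 fam _ Meq])
        fix x assume x: "x \<in> K"
        have "fst (snd x) * (sin (fst x + h0 x))\<^sup>2 > 0" using True x sin0[OF x] by (intro mult_pos_pos) auto
        then show "fast_slope I (fst x + h0 x) x < 0" using slope[OF x] by linarith
      qed
      then show ?thesis unfolding cond if_P[OF True] .
    next
      case False
      then have neg: "\<forall>x\<in>K. fst (snd x) < 0" using sign by blast
      have "\<exists>e1\<in>{0<..e0}. locally_repelling I lam eta e1 M"
      proof (rule slow_family_repelling[OF cI cK e0 fam _ Meq])
        fix x assume x: "x \<in> K"
        have "fst (snd x) * (sin (fst x + h0 x))\<^sup>2 < 0" using neg x sin0[OF x] by (intro mult_neg_pos) auto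
        then show "fast_slope I (fst x + h0 x) x > 0" using slope[OF x] by linarith
      qed
      then show ?thesis unfolding cond if_not_P[OF False] .
    qed
  qed
qed

section \<open>Infinitely many slow manifolds with one bound for \<open>eps\<close>\<close>

lemma compact_domain_cball: 
  assumes r: "r > 0" shows "compact_domain (cball c r)"
  unfolding compact_domain_def
proof (intro conjI ballI)
  show "cball c r \<noteq> {}" using r by simp
  show "simply_connected (cball c r)" by (intro convex_imp_simply_connected) simp
  fix p assume p: "p \<in> frontier (cball c r)"
  \<comment> \<open>The squared distance to the centre minus the squared radius. Its only critical
    point is the centre, so the complement of the centre serves as the neighbourhood of every
    boundary point.\<close>
  define g where "g = (\<lambda>x::slow. (x - c) \<bullet> (x - c) - r * r)"
  define G where "G = (\<lambda>x::slow. 2 *\<^sub>R (x - c))"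
  have "GDERIV g x :> G x" for x
    unfolding gderiv_def g_def G_def by (auto intro!: derivative_eq_intros simp: inner_commute)
  then have "C1_with_gradient g G (- {c})"
    unfolding C1_with_gradient_def by (intro exI[of _ UNIV]) (auto simp: G_def intro!: continuous_intros)
  moreover have "g x \<le> 0 \<longleftrightarrow> x \<in> cball c r" for x
  proof -
    have "g x = (dist c x)\<^sup>2 - r\<^sup>2"
      by (simp add: g_def dist_commute dist_norm power2_norm_eq_inner) (simp add: power2_eq_square inner_diff_left inner_diff_right inner_commute)
    moreover have "(dist c x)\<^sup>2 \<le> r\<^sup>2 \<longleftrightarrow> dist c x \<le> r" using r by (auto intro: power_mono power2_le_imp_le)
    ultimately show ?thesis by simp
  qed
  then have "cball c r \<inter> (- {c}) = {x \<in> - {c}. g x \<le> 0}" by blast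
  moreover have "p \<in> - {c}" using p r by (auto simp: frontier_cball)
  moreover have "\<forall>x\<in>- {c}. G x \<noteq> 0" by (simp add: G_def)
  ultimately show "\<exists>U g G. open U \<and> p \<in> U \<and> C1_with_gradient g G U \<and>
        (\<forall>x\<in>U. G x \<noteq> 0) \<and> cball c r \<inter> U = {x\<in>U. g x \<le> 0}"
    by (intro exI[of _ "- {c}"] exI[of _ g] exI[of _ G]) auto
qed auto

lemma C1_with_gradient_shift:
  assumes "C1_with_gradient h G K"
  shows "C1_with_gradient (\<lambda>x. h (x - a)) (\<lambda>x. G (x - a)) {x. x - a \<in> K}"
proof -
  obtain U where U: "open U" "K \<subseteq> U" "\<And>x. x \<in> U \<Longrightarrow> GDERIV h x :> G x" "continuous_on U G"
    using assms by (auto simp: C1_with_gradient_def)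
  have "open {x. x - a \<in> U}"
  proof -
    have "continuous_on UNIV (\<lambda>x::slow. x - a)" by (intro continuous_intros)
    from open_vimage[OF U(1) this] show ?thesis by (simp add: vimage_def)
  qed
  moreover have "GDERIV (\<lambda>x. h (x - a)) x :> G (x - a)" if "x - a \<in> U" for x
    using U(3)[OF that] unfolding gderiv_def
    by (rule has_derivative_compose[where f="\<lambda>x. x - a" and f'="\<lambda>x. x", rotated]) (auto intro!: derivative_eq_intros)
  moreover have "continuous_on {x. x - a \<in> U} (\<lambda>x. G (x - a))"
    by (rule continuous_on_compose2[OF U(4)]) (auto intro!: continuous_intros)
  ultimately show ?thesis
    unfolding C1_with_gradient_def using U(2) by (intro exI[of _ "{x. x - a \<in> U}"]) auto
qed

lemma sin_cos_shift:
  "sin (y - of_int (2 * j) * pi) = sin y" "cos (y - of_int (2 * j) * pi) = cos y"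
  unfolding sin_diff cos_diff cos_int_pi sin_int_pi by (simp_all add: minus_one_powi)

text \<open>\<Omega> enters the vector field only through the sine and cosine of \<Omega> +
  \<omega>, so shifting \<Omega> by a multiple of 2 pi at fixed \<omega> preserves the equation,
  with the same e0 and C.\<close>

lemma slow_pde_family_shift:
  assumes fam: "slow_pde_family I lam eta e0 K h0 G0 h G C" and a: "a = (of_int (2 * j) * pi, 0, 0)"
  shows "slow_pde_family I lam eta e0 {x. x - a \<in> K} (\<lambda>x. h0 (x - a)) (\<lambda>x. G0 (x - a))
    (\<lambda>eps x. h eps (x - a)) (\<lambda>eps x. G eps (x - a)) C"
proof -
  have sh: "fast_rhs I (w, x - a) = fast_rhs I (w, x)" "slow_rhs I lam eta (w, x - a) = slow_rhs I lam eta (w, x)" for w x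
  proof -
    have "fst (x - a) + w = (fst x + w) - of_int (2 * j) * pi" "fst (snd (x - a)) = fst (snd x)" "snd (snd (x - a)) = snd (snd x)"
      unfolding a by simp_all
    then show "fast_rhs I (w, x - a) = fast_rhs I (w, x)" "slow_rhs I lam eta (w, x - a) = slow_rhs I lam eta (w, x)"
      by (simp_all only: fast_rhs_eq slow_rhs_eq sin_cos_shift)
  qed
  show ?thesis
    unfolding slow_pde_family_def
  proof (intro conjI ballI)
    show "C1_with_gradient (\<lambda>x. h0 (x - a)) (\<lambda>x. G0 (x - a)) {x. x - a \<in> K}"
      using fam by (intro C1_with_gradient_shift) (simp add: slow_pde_family_def)
    fix eps assume e: "eps \<in> {0<..<e0}"
    show "C1_with_gradient (\<lambda>x. h eps (x - a)) (\<lambda>x. G eps (x - a)) {x. x - a \<in> K}"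
      using fam e by (intro C1_with_gradient_shift) (simp add: slow_pde_family_def)
    fix x assume x: "x \<in> {x. x - a \<in> K}"
    then have "x - a \<in> K" by simp
    then have "\<bar>h eps (x - a) - h0 (x - a)\<bar> \<le> C * eps \<and> norm (G eps (x - a) - G0 (x - a)) \<le> C * eps \<and>
           fast_rhs I (h eps (x - a), x - a) = eps * (slow_rhs I lam eta (h eps (x - a), x - a) \<bullet> G eps (x - a))"
      using fam e unfolding slow_pde_family_def by blast
    then show "\<bar>h eps (x - a) - h0 (x - a)\<bar> \<le> C * eps" "norm (G eps (x - a) - G0 (x - a)) \<le> C * eps"
      "fast_rhs I (h eps (x - a), x) = eps * (slow_rhs I lam eta (h eps (x - a), x) \<bullet> G eps (x - a))"
      unfolding sh by blast+
  qed
qed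

lemma cball_shift: "{x. x - a \<in> cball c r} = cball (c + a) r" for a :: "'a::real_normed_vector"
  by (auto simp: dist_norm algebra_simps)

lemma cball_coordinates:
  fixes x :: slow
  assumes "x \<in> cball (t, a, b) (1::real)"
  shows "\<bar>fst (snd x) - a\<bar> \<le> 1" "\<bar>snd (snd x) - b\<bar> \<le> 1"
proof -
  have d: "dist (snd x) (a, b) \<le> 1"
    using assms dist_snd_le[of "(t, a, b)" x] by (simp add: dist_commute)
  show "\<bar>fst (snd x) - a\<bar> \<le> 1" "\<bar>snd (snd x) - b\<bar> \<le> 1"
    using order_trans[OF dist_fst_le[of "snd x" "(a, b)"] d] order_trans[OF dist_snd_le[of "snd x" "(a, b)"] d]
    by (simp_all add: dist_real_def)
qed

text \<open>The perturbation theorem gives an e0 that depends on the branch. Constructing only k = 0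
  and k = 1 over one ball and translating \<Omega> by \<open>2 * (k div 2)\<close> times pi serves
  all k with the smaller of two bounds. On the ball \<open>s * \<alpha> \<ge> B + 1\<close>, which
  exceeds the values of |I| there, so \<open>\<alpha> - (- 1) powi k * I \<theta>\<close> has the
  sign s for every k at once.\<close>

theorem uniform_pi_families:
  assumes I: "smooth I" and B: "\<And>\<theta>. \<bar>\<theta>\<bar> \<le> 1 \<Longrightarrow> \<bar>I \<theta>\<bar> \<le> B" and s: "s = 1 \<or> s = (- 1 :: real)"
  obtains e0 h0 G0 h G C where "e0 > 0"
    "\<And>k. slow_pde_family I lam eta e0 (cball (of_int (2 * (k div 2)) * pi, s * (B + 2), 0) 1) (h0 k) (G0 k) (h k) (G k) (C k)"
    "\<And>k x. x \<in> cball (of_int (2 * (k div 2)) * pi, s * (B + 2), 0) 1 \<Longrightarrow> h0 k x = of_int k * pi - fst x"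
    "\<And>k x. x \<in> cball (of_int (2 * (k div 2)) * pi, s * (B + 2), 0) 1 \<Longrightarrow> s * (fst (snd x) - (- 1) powi k * I (snd (snd x))) > 0"
proof -
  have sgn: "s * (fst (snd x) - (- 1) powi k * I (snd (snd x))) > 0" if "x \<in> cball (t, s * (B + 2), 0) 1" for x :: slow and t and k :: int
  proof -
    have 1: "\<bar>fst (snd x) - s * (B + 2)\<bar> \<le> 1" using cball_coordinates(1)[OF that] .
    have 2: "\<bar>I (snd (snd x))\<bar> \<le> B" using cball_coordinates(2)[OF that] by (intro B) simp
    have "\<bar>(- 1) powi k * I (snd (snd x))\<bar> \<le> B" using 2 by (simp add: minus_one_powi)
    with 1 show ?thesis using s by auto
  qed
  let ?K = "cball (0, s * (B + 2), 0) 1 :: slow set"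
  have K: "compact_domain ?K" by (intro compact_domain_cball) simp
  have base: "\<exists>e0>0. \<exists>h1 G1 h G C. slow_pde_family I lam eta e0 ?K h1 G1 h G C \<and> (\<forall>x\<in>?K. h1 x = of_int k * pi - fst x)" for k :: int
  proof (rule slow_pde_family_exists[OF I])
    show "compact ?K" "?K \<noteq> {}" by simp_all
    show "connected ?K" by (rule compact_domain_connected[OF K])
    show "continuous_on ?K (\<lambda>x. of_int k * pi - fst x)" by (intro continuous_intros)
    show "\<forall>x\<in>?K. normally_hyperbolic_zero I (of_int k * pi - fst x, x)"
    proof
      fix x assume x: "x \<in> ?K"
      have u: "fst x + (of_int k * pi - fst x) = of_int k * pi" by simp
      have "fast_slope I (of_int k * pi) x \<noteq> 0" using sgn[OF x, of k] by (auto simp: fast_slope_pi)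
      then show "normally_hyperbolic_zero I (of_int k * pi - fst x, x)"
        unfolding normally_hyperbolic_zero_iff fast_rhs_eq u by (simp add: sin_int_pi)
    qed
  qed
  obtain ea ha Ga hh GG CC where a': "ea > 0" "slow_pde_family I lam eta ea ?K ha Ga hh GG CC" "\<forall>x\<in>?K. ha x = of_int 0 * pi - fst x"
    using base[of 0] by blast
  obtain eb hb Gb hh' GG' CC' where b: "eb > 0" "slow_pde_family I lam eta eb ?K hb Gb hh' GG' CC'" "\<forall>x\<in>?K. hb x = of_int 1 * pi - fst x"
    using base[of 1] by blast
  define e0 where "e0 = min ea eb"
  have ex: "\<exists>h0 G0 h G C. slow_pde_family I lam eta e0 (cball (of_int (2 * (k div 2)) * pi, s * (B + 2), 0) 1) h0 G0 h G C \<and>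
      (\<forall>x\<in>cball (of_int (2 * (k div 2)) * pi, s * (B + 2), 0) 1. h0 x = of_int k * pi - fst x)" for k
  proof -
    define a where "a = (of_int (2 * (k div 2)) * pi, 0::real, 0::real)"
    have sh: "{x. x - a \<in> ?K} = cball (of_int (2 * (k div 2)) * pi, s * (B + 2), 0) 1"
      using cball_shift[of a "(0, s * (B + 2), 0)" 1] by (simp add: a_def)
    have "\<exists>h0 G0 h G C. slow_pde_family I lam eta e0 ?K h0 G0 h G C \<and> (\<forall>x\<in>?K. h0 x = of_int (k mod 2) * pi - fst x)"
    proof (cases "k mod 2 = 0")
      case True
      then have "\<forall>x\<in>?K. ha x = of_int (k mod 2) * pi - fst x" using a'(3) by simp
      moreover have "slow_pde_family I lam eta e0 ?K ha Ga hh GG CC"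
        by (rule slow_pde_family_mono[OF a'(2)]) (simp add: e0_def)
      ultimately show ?thesis by blast
    next
      case False
      then have "k mod 2 = 1" by presburger
      then have "\<forall>x\<in>?K. hb x = of_int (k mod 2) * pi - fst x" using b(3) by simp
      moreover have "slow_pde_family I lam eta e0 ?K hb Gb hh' GG' CC'"
        by (rule slow_pde_family_mono[OF b(2)]) (simp add: e0_def)
      ultimately show ?thesis by blast
    qed
    then obtain h0 G0 h G C where f: "slow_pde_family I lam eta e0 ?K h0 G0 h G C" "\<forall>x\<in>?K. h0 x = of_int (k mod 2) * pi - fst x"
      by blast
    have k: "of_int k = of_int (k mod 2) + (of_int (2 * (k div 2)) :: real)"
      unfolding of_int_add[symmetric] by simp
    have "h0 (x - a) = of_int k * pi - fst x" if "x \<in> {x. x - a \<in> ?K}" for x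
    proof -
      have "h0 (x - a) = of_int (k mod 2) * pi - fst (x - a)" using f(2) that by blast
      then show ?thesis unfolding k by (simp add: a_def algebra_simps)
    qed
    then show ?thesis using slow_pde_family_shift[OF f(1) a_def] unfolding sh by blast
  qed
  then obtain h0 G0 h G C where "\<And>k. slow_pde_family I lam eta e0 (cball (of_int (2 * (k div 2)) * pi, s * (B + 2), 0) 1) (h0 k) (G0 k) (h k) (G k) (C k) \<and>
      (\<forall>x\<in>cball (of_int (2 * (k div 2)) * pi, s * (B + 2), 0) 1. h0 k x = of_int k * pi - fst x)"
    by metis
  note * = this
  show ?thesis
  proof (rule that[of e0 h0 G0 h G C])
    show "e0 > 0" using a'(1) b(1) by (simp add: e0_def)
  qed (use * sgn in blast)+
qed

lemma pi_family_slow_invariant: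
  assumes I: "smooth I" and K: "compact_domain K"
    and fam: "slow_pde_family I lam eta e0 K h0 G0 h G C"
    and h0: "\<And>x. x \<in> K \<Longrightarrow> h0 x = of_int k * pi - fst x"
    and ne: "\<And>x. x \<in> K \<Longrightarrow> (- 1) powi k * I (snd (snd x)) - fst (snd x) \<noteq> 0"
  shows "slow_invariant_manifold I lam eta e0 (graph_over K h0) (\<lambda>eps. graph_over K (h eps))"
proof (rule slow_invariant_manifoldI[OF I K _ fam], rule ballI)
  fix x assume x: "x \<in> K"
  have u: "fst x + h0 x = of_int k * pi" by (simp add: h0[OF x])
  have "fast_slope I (of_int k * pi) x \<noteq> 0" using ne[OF x] by (simp add: fast_slope_pi)
  then show "normally_hyperbolic_zero I (h0 x, x)"
    unfolding normally_hyperbolic_zero_iff fast_rhs_eq u by (simp add: sin_int_pi)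
qed

lemma Ball_shrink: "\<forall>eps\<in>{0<..<e0}. P eps \<Longrightarrow> e1 \<le> e0 \<Longrightarrow> \<forall>eps\<in>{0<..<e1::real}. P eps"
  by auto

lemma slow_invariant_manifold_mono:
  "slow_invariant_manifold I lam eta e0 M0 M \<Longrightarrow> e1 \<le> e0 \<Longrightarrow> slow_invariant_manifold I lam eta e1 M0 M"
  unfolding slow_invariant_manifold_def
  by (elim conjE exE, intro conjI exI, assumption, assumption, assumption, assumption, erule (1) Ball_shrink)

text \<open>On the unit ball about \<alpha> = B + 2 one has \<alpha> > |I|, so the ball lies in the
  domain of the arccosine branches and the branch m = 0 can be perturbed.\<close>

lemma F_manifold_exists:
  assumes I: "smooth I" and B: "\<And>\<theta>. \<bar>\<theta>\<bar> \<le> 1 \<Longrightarrow> \<bar>I \<theta>\<bar> \<le> B"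
  shows "\<exists>e0>0. \<exists>M0 M. slow_invariant_manifold I lam eta e0 M0 M \<and> form_F I e0 M"
proof -
  let ?K = "cball (0, B + 2, 0) 1 :: slow set"
  have K: "compact_domain ?K" by (intro compact_domain_cball) simp
  have B0: "B \<ge> 0" using B[of 0] by auto
  have dom: "x \<in> arccos_domain I" if "x \<in> ?K" for x
  proof -
    have "\<bar>fst (snd x) - (B + 2)\<bar> \<le> 1" using cball_coordinates(1)[OF that] .
    then have 1: "fst (snd x) \<ge> B + 1" by linarith
    have 2: "\<bar>I (snd (snd x))\<bar> \<le> B" using cball_coordinates(2)[OF that] by (intro B) simp
    show ?thesis using 1 2 B0 by (auto simp: arccos_domain_def abs_mult field_simps)
  qed
  obtain gu where gu: "\<forall>x\<in>arccos_domain I. GDERIV (arccos_branch I 0) x :> gu x \<and> c11_at (arccos_branch I 0) x \<and> c11_at gu x"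
    using arccos_branch_smooth(2)[OF I, of 0] by blast
  have "continuous_on ?K (arccos_branch I 0)"
    using gu dom by (intro continuous_at_imp_continuous_on ballI) (auto intro: c11_at_imp_isCont)
  then have c: "continuous_on ?K (\<lambda>x. arccos_branch I 0 x - fst x)" by (intro continuous_intros)
  have nh: "normally_hyperbolic_zero I (arccos_branch I 0 x - fst x, x)" if x: "x \<in> ?K" for x
  proof -
    note cs = arccos_branch_cos_sin[OF dom[OF x], of 0]
    have "fst (snd x) \<noteq> 0" using dom[OF x] by (simp add: arccos_domain_def)
    then have "fast_slope I (arccos_branch I 0 x) x \<noteq> 0"
      unfolding fast_slope_F[where I=I and x=x and u="arccos_branch I 0 x", OF cs(1)] using cs(2) by simp
    then show ?thesis unfolding normally_hyperbolic_zero_iff using cs(1) by (simp add: fast_rhs_eq)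
  qed
  obtain e0 h0 G0 h G C where e0: "e0 > 0" and fam: "slow_pde_family I lam eta e0 ?K h0 G0 h G C"
    and h0: "\<forall>x\<in>?K. h0 x = arccos_branch I 0 x - fst x"
    using slow_pde_family_exists[OF I _ compact_domain_connected[OF K] _ c] nh by auto blast
  have u: "fst x + h0 x = arccos_branch I 0 x" if "x \<in> ?K" for x using h0 that by simp
  have inv: "slow_invariant_manifold I lam eta e0 (graph_over ?K h0) (\<lambda>eps. graph_over ?K (h eps))"
    by (rule slow_invariant_manifoldI[OF I K _ fam]) (use h0 nh in auto)
  have "\<exists>e1\<in>{0<..e0}. \<exists>C'. \<forall>eps\<in>{0<..<e1}. \<forall>x\<in>?K.
     \<bar>fst (snd x) * cos (fst x + h eps x) - I (snd (snd x))\<bar> \<le> C' * eps \<and> sin (fst x + h eps x) \<noteq> 0 \<and> fst (snd x) \<noteq> 0"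
    by (rule F_family_form[OF I K e0 fam])
      (use dom in \<open>auto simp: u arccos_branch_cos_sin arccos_domain_def simp del: mem_cball\<close>)
  then obtain e1 where e1: "e1 \<in> {0<..e0}" and *: "\<exists>C'. \<forall>eps\<in>{0<..<e1}. \<forall>x\<in>?K.
     \<bar>fst (snd x) * cos (fst x + h eps x) - I (snd (snd x))\<bar> \<le> C' * eps \<and> sin (fst x + h eps x) \<noteq> 0 \<and> fst (snd x) \<noteq> 0"
    by blast
  have "form_F I e1 (\<lambda>eps. graph_over ?K (h eps))" by (subst form_F_graph[OF ballI[OF refl]]) (rule *)
  then show ?thesis using slow_invariant_manifold_mono[OF inv, of e1] e1 by auto
qed

lemma form_pi_minus_mono: "form_pi_minus I lam k e0 M \<Longrightarrow> e1 \<le> e0 \<Longrightarrow> form_pi_minus I lam k e1 M"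
  and form_pi_plus_mono: "form_pi_plus I lam k e0 M \<Longrightarrow> e1 \<le> e0 \<Longrightarrow> form_pi_plus I lam k e1 M"
  and form_F_mono: "form_F I e0 M \<Longrightarrow> e1 \<le> e0 \<Longrightarrow> form_F I e1 M"
  unfolding form_pi_minus_def form_pi_plus_def form_F_def
  by (elim exE, intro exI, erule (1) Ball_shrink)+

theorem slow_manifolds_of_all_forms:
  assumes I: "smooth I"
  shows "\<exists>e0>0.
        (\<forall>k. \<exists>M0 M. slow_invariant_manifold I lam eta e0 M0 M \<and> form_pi_minus I lam k e0 M) \<and>
        (\<forall>k. \<exists>M0 M. slow_invariant_manifold I lam eta e0 M0 M \<and> form_pi_plus I lam k e0 M) \<and>
        (\<exists>M0 M. slow_invariant_manifold I lam eta e0 M0 M \<and> form_F I e0 M) \<and>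
        (\<forall>eps\<in>{0<..<e0}.
           infinite {M eps |M0 M. slow_invariant_manifold I lam eta e0 M0 M \<and>
                                  of_three_forms I lam e0 M})"
proof -
  have "bounded (I ` {- 1..1})"
    by (intro compact_imp_bounded compact_continuous_image continuous_on_subset[OF smooth_continuous[OF I]]) auto
  then obtain B where B': "\<forall>y\<in>I ` {- 1..1}. norm y \<le> B" unfolding bounded_iff by blast
  have B: "\<bar>I \<theta>\<bar> \<le> B" if "\<bar>\<theta>\<bar> \<le> 1" for \<theta>
  proof -
    have "\<theta> \<in> {- 1..1}" using that by auto
    then show ?thesis using B' by auto
  qed
  let ?c = "\<lambda>s (k::int). (of_int (2 * (k div 2)) * pi, s * (B + 2), 0) :: slow"
  have dom: "compact_domain (cball (?c s k) 1)" for s k by (rule compact_domain_cball) simp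
  obtain em h0 G0 h G C where em: "em > 0"
    and fm: "\<And>k. slow_pde_family I lam eta em (cball (?c (- 1) k) 1) (h0 k) (G0 k) (h k) (G k) (C k)"
    and hm: "\<And>k x. x \<in> cball (?c (- 1) k) 1 \<Longrightarrow> h0 k x = of_int k * pi - fst x"
    and sm: "\<And>k x. x \<in> cball (?c (- 1) k) 1 \<Longrightarrow> (- 1) * (fst (snd x) - (- 1) powi k * I (snd (snd x))) > 0"
    using uniform_pi_families[OF I B, of "- 1" lam eta] by blast
  define Mm where "Mm = (\<lambda>k eps. graph_over (cball (?c (- 1) k) 1) (h k eps))"
  have invm: "slow_invariant_manifold I lam eta em (graph_over (cball (?c (- 1) k) 1) (h0 k)) (Mm k)" for k
    unfolding Mm_def
    by (rule pi_family_slow_invariant[OF I dom fm hm]) (use sm[of _ k] in force)+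
  have formm: "form_pi_minus I lam k em (Mm k)" for k
  proof -
    have "(- 1) powi k * I (snd (snd x)) - fst (snd x) \<noteq> 0" if "x \<in> cball (?c (- 1) k) 1" for x
      using sm[OF that] by auto
    from pi_family_expansion[OF I dom em fm hm this]
    obtain C' where C': "\<forall>eps\<in>{0<..<em}. \<forall>x\<in>cball (?c (- 1) k) 1.
      \<bar>h k eps x - (of_int k * pi - fst x) * (1 + eps * lam / ((- 1) powi k * I (snd (snd x)) - fst (snd x)))\<bar> \<le> C' * eps\<^sup>2"
      by blast
    have lt: "fst (snd x) < (- 1) powi k * I (snd (snd x))" if "x \<in> cball (?c (- 1) k) 1" for x
      using sm[OF that] unfolding mult_minus1 by linarith
    show ?thesis
      unfolding Mm_def by (subst form_pi_minus_graph[OF ballI[OF refl]]) (use C' lt in blast)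
  qed
  obtain ep k0 K0 k1 K1 D where ep: "ep > 0"
    and fp: "\<And>k. slow_pde_family I lam eta ep (cball (?c 1 k) 1) (k0 k) (K0 k) (k1 k) (K1 k) (D k)"
    and hp: "\<And>k x. x \<in> cball (?c 1 k) 1 \<Longrightarrow> k0 k x = of_int k * pi - fst x"
    and sp: "\<And>k x. x \<in> cball (?c 1 k) 1 \<Longrightarrow> 1 * (fst (snd x) - (- 1) powi k * I (snd (snd x))) > 0"
    using uniform_pi_families[OF I B, of 1 lam eta] by blast
  define Mp where "Mp = (\<lambda>k eps. graph_over (cball (?c 1 k) 1) (k1 k eps))"
  have invp: "slow_invariant_manifold I lam eta ep (graph_over (cball (?c 1 k) 1) (k0 k)) (Mp k)" for k
    unfolding Mp_def
    by (rule pi_family_slow_invariant[OF I dom fp hp]) (use sp[of _ k] in force)+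
  have formp: "form_pi_plus I lam k ep (Mp k)" for k
  proof -
    have "(- 1) powi k * I (snd (snd x)) - fst (snd x) \<noteq> 0" if "x \<in> cball (?c 1 k) 1" for x
      using sp[OF that] by auto
    from pi_family_expansion[OF I dom ep fp hp this]
    obtain C' where C': "\<forall>eps\<in>{0<..<ep}. \<forall>x\<in>cball (?c 1 k) 1.
      \<bar>k1 k eps x - (of_int k * pi - fst x) * (1 + eps * lam / ((- 1) powi k * I (snd (snd x)) - fst (snd x)))\<bar> \<le> C' * eps\<^sup>2"
      by blast
    have lt: "fst (snd x) > (- 1) powi k * I (snd (snd x))" if "x \<in> cball (?c 1 k) 1" for x
      using sp[OF that] unfolding mult_1 by linarith
    show ?thesis
      unfolding Mp_def by (subst form_pi_plus_graph[OF ballI[OF refl]]) (use C' lt in blast)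
  qed
  obtain ef MF0 MF where ef: "ef > 0" "slow_invariant_manifold I lam eta ef MF0 MF" "form_F I ef MF"
    using F_manifold_exists[OF I B] by blast
  define e0 where "e0 = min em (min ep ef)"
  have le: "e0 \<le> em" "e0 \<le> ep" "e0 \<le> ef" by (auto simp: e0_def)
  have 1: "slow_invariant_manifold I lam eta e0 (graph_over (cball (?c (- 1) k) 1) (h0 k)) (Mm k) \<and> form_pi_minus I lam k e0 (Mm k)" for k
    using slow_invariant_manifold_mono[OF invm le(1)] form_pi_minus_mono[OF formm le(1)] by blast
  have 2: "slow_invariant_manifold I lam eta e0 (graph_over (cball (?c 1 k) 1) (k0 k)) (Mp k) \<and> form_pi_plus I lam k e0 (Mp k)" for k
    using slow_invariant_manifold_mono[OF invp le(2)] form_pi_plus_mono[OF formp le(2)] by blast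
  have 3: "slow_invariant_manifold I lam eta e0 MF0 MF \<and> form_F I e0 MF"
    using slow_invariant_manifold_mono[OF ef(2) le(3)] form_F_mono[OF ef(3) le(3)] by blast
  have "infinite {M eps |M0 M. slow_invariant_manifold I lam eta e0 M0 M \<and> of_three_forms I lam e0 M}" for eps
  proof (rule infinite_super)
    \<comment> \<open>Even indices only, because the indices 2j and 2j + 1 share the same ball. For
      even ones the projections to the slow variables are balls with different centres, so the
      manifolds are distinct.\<close>
    show "range (\<lambda>j. Mm (2 * j) eps) \<subseteq> {M eps |M0 M. slow_invariant_manifold I lam eta e0 M0 M \<and> of_three_forms I lam e0 M}"
      using 1 unfolding of_three_forms_def by blast
    have "inj (\<lambda>j. Mm (2 * j) eps)"
    proof (rule injI)
      fix i j assume "Mm (2 * i) eps = Mm (2 * j) eps"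
      then have "snd ` Mm (2 * i) eps = snd ` Mm (2 * j) eps" by simp
      then show "i = j" by (simp add: Mm_def snd_graph_over cball_eq_cball_iff)
    qed
    then show "infinite (range (\<lambda>j. Mm (2 * j) eps))"
      using finite_imageD infinite_UNIV_int by blast
  qed
  moreover have "e0 > 0" using em ep ef by (simp add: e0_def)
  ultimately show ?thesis using 1 2 3 by blast
qed

theorem theorem2:
  fixes I :: "real \<Rightarrow> real" and lam eta :: real
  assumes "smooth I" and "lam > 0" and "eta > 0"
  shows
    "(\<forall>M0. critical_manifold I M0 \<longrightarrow> (\<exists>e0>0. \<exists>M. slow_invariant_manifold I lam eta e0 M0 M))
     \<and>
     (\<exists>e0>0.
        (\<forall>k. \<exists>M0 M. slow_invariant_manifold I lam eta e0 M0 M \<and> form_pi_minus I lam k e0 M) \<and>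
        (\<forall>k. \<exists>M0 M. slow_invariant_manifold I lam eta e0 M0 M \<and> form_pi_plus I lam k e0 M) \<and>
        (\<exists>M0 M. slow_invariant_manifold I lam eta e0 M0 M \<and> form_F I e0 M) \<and>
        (\<forall>eps\<in>{0<..<e0}.
           infinite {M eps |M0 M. slow_invariant_manifold I lam eta e0 M0 M \<and>
                                  of_three_forms I lam e0 M}))
     \<and>
     (\<forall>e0>0. \<forall>M0 M. slow_invariant_manifold I lam eta e0 M0 M \<longrightarrow>
        (\<exists>e1\<in>{0<..e0}. of_three_forms I lam e1 M \<and>
           (\<forall>eps\<in>{0<..<e1}. compact (M eps) \<and> simply_connected (M eps))))
     \<and>
     (\<forall>e0>0. \<forall>M0 M. slow_invariant_manifold I lam eta e0 M0 M \<longrightarrow>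
        (\<forall>k. form_pi_minus I lam k e0 M \<longrightarrow> (\<exists>e1\<in>{0<..e0}. locally_attracting I lam eta e1 M)) \<and>
        (\<forall>k. form_pi_plus I lam k e0 M \<longrightarrow> (\<exists>e1\<in>{0<..e0}. locally_repelling I lam eta e1 M)) \<and>
        (form_F I e0 M \<longrightarrow>
           (\<exists>e1\<in>{0<..e0}.
              if \<forall>eps\<in>{0<..<e0}. \<forall>(\<omega>, \<Omega>, \<alpha>, \<theta>)\<in>M eps. \<alpha> > 0
              then locally_attracting I lam eta e1 M
              else locally_repelling I lam eta e1 M)))"
proof (intro conjI)
  note I = assms(1)
  show "\<forall>M0. critical_manifold I M0 \<longrightarrow> (\<exists>e0>0. \<exists>M. slow_invariant_manifold I lam eta e0 M0 M)"
    using critical_manifold_perturbs[OF I] by blast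
  show "\<forall>e0>0. \<forall>M0 M. slow_invariant_manifold I lam eta e0 M0 M \<longrightarrow>
        (\<exists>e1\<in>{0<..e0}. of_three_forms I lam e1 M \<and>
           (\<forall>eps\<in>{0<..<e1}. compact (M eps) \<and> simply_connected (M eps)))"
    by (intro allI impI) (rule slow_manifold_of_three_forms[OF I])
  show "\<forall>e0>0. \<forall>M0 M. slow_invariant_manifold I lam eta e0 M0 M \<longrightarrow>
        (\<forall>k. form_pi_minus I lam k e0 M \<longrightarrow> (\<exists>e1\<in>{0<..e0}. locally_attracting I lam eta e1 M)) \<and>
        (\<forall>k. form_pi_plus I lam k e0 M \<longrightarrow> (\<exists>e1\<in>{0<..e0}. locally_repelling I lam eta e1 M)) \<and>
        (form_F I e0 M \<longrightarrow>
           (\<exists>e1\<in>{0<..e0}.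
              if \<forall>eps\<in>{0<..<e0}. \<forall>(\<omega>, \<Omega>, \<alpha>, \<theta>)\<in>M eps. \<alpha> > 0
              then locally_attracting I lam eta e1 M
              else locally_repelling I lam eta e1 M))"
    by (intro allI impI conjI; rule slow_manifold_stability[OF I])
qed (rule slow_manifolds_of_all_forms[OF assms(1)])

end
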